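(* Let $K$ be an infinite field of prime characteristic $p$, $G=\mathrm{GL}(2,K)$, and let $E$ be the natural $KG$-module. Let $r\ge 2$ be an integer. Then $T(r-1,1)$ is isomorphic to a direct summand of $L^r(E)$ if and only if either $r=p$ or $r$ is not a power of $p$.
   Context: $E$ is the space $K^2$ of column vectors with its natural $G$-action. $L(E)$ is the free Lie algebra on $E$, realized as the Lie subalgebra of the tensor algebra of $E$ generated by $E$; $L^r(E)=L(E)\cap E^{\otimes r}$ is its $r$th homogeneous component, a $KG$-submodule of $E^{\otimes r}$. For a partition $\lambda=(\lambda_1,\lambda_2)$ of $r$ (with $\lambda_2\geq 0$), the dual Weyl module is $\nabla(\lambda)=S^{\lambda_1-\lambda_2}(E)\otimes\det^{\lambda_2}$ and the Weyl module $\Delta(\lambda)$ is its contravariant dual. $T(\lambda)$ denotes the indecomposable tilting module of highest weight $\lambda$: the unique (up to isomorphism) indecomposable polynomial $KG$-module of degree $r$ that has both a filtration with all sections Weyl modules and a filtration with all sections dual Weyl modules, and whose highest weight (in dominance order) is $\lambda$. *)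

theory Defs
  imports
    "HOL-Analysis.Determinants"
    "HOL-Computational_Algebra.Polynomial"
    "HOL-Library.Function_Algebras"
begin

definition GL2 :: "('k::field^2^2) set" where
  "GL2 = {g. invertible g}"

definition diag2 :: "'k \<Rightarrow> 'k \<Rightarrow> 'k::field^2^2" where
  "diag2 s t = vector [vector [s, 0], vector [0, t]]"

section \<open>Modules for the group algebra of GL(2,K)\<close>

text \<open>
  The underlying space of a module is a subspace of an ambient vector space, so that modules on
  subspaces of one type (submodules, direct summands) share addition, scaling and action.
  The action is only constrained on the underlying space.
\<close>

record ('k, 'v) rep =
  rep_space :: "'v set"
  rep_scale :: "'k \<Rightarrow> 'v \<Rightarrow> 'v"
  rep_act :: "'k^2^2 \<Rightarrow> 'v \<Rightarrow> 'v"

definition linear_map_on ::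
  "'v set \<Rightarrow> ('k \<Rightarrow> 'v \<Rightarrow> 'v) \<Rightarrow> ('k \<Rightarrow> 'w \<Rightarrow> 'w) \<Rightarrow> ('v::ab_group_add \<Rightarrow> 'w::ab_group_add) \<Rightarrow> bool" where
  "linear_map_on V s s' f \<longleftrightarrow>
     (\<forall>x\<in>V. \<forall>y\<in>V. f (x + y) = f x + f y) \<and> (\<forall>c. \<forall>x\<in>V. f (s c x) = s' c (f x))"

definition kg_module :: "('k::field, 'v::ab_group_add) rep \<Rightarrow> bool" where
  "kg_module M \<longleftrightarrow>
     vector_space (rep_scale M) \<and> module.subspace (rep_scale M) (rep_space M) \<and>
     (\<forall>g\<in>GL2. rep_act M g ` rep_space M \<subseteq> rep_space M \<and>
        linear_map_on (rep_space M) (rep_scale M) (rep_scale M) (rep_act M g)) \<and>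
     (\<forall>v\<in>rep_space M. rep_act M (mat 1) v = v) \<and>
     (\<forall>g\<in>GL2. \<forall>h\<in>GL2. \<forall>v\<in>rep_space M. rep_act M (g ** h) v = rep_act M g (rep_act M h v))"

definition submodule :: "'v set \<Rightarrow> ('k::field, 'v::ab_group_add) rep \<Rightarrow> bool" where
  "submodule W M \<longleftrightarrow>
     W \<subseteq> rep_space M \<and> module.subspace (rep_scale M) W \<and> (\<forall>g\<in>GL2. rep_act M g ` W \<subseteq> W)"

definition kg_hom ::
  "('k::field, 'v::ab_group_add) rep \<Rightarrow> ('k, 'w::ab_group_add) rep \<Rightarrow> ('v \<Rightarrow> 'w) \<Rightarrow> bool" where
  "kg_hom M N f \<longleftrightarrow>
     f ` rep_space M \<subseteq> rep_space N \<and>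
     linear_map_on (rep_space M) (rep_scale M) (rep_scale N) f \<and>
     (\<forall>g\<in>GL2. \<forall>v\<in>rep_space M. f (rep_act M g v) = rep_act N g (f v))"

definition kg_iso :: "('k::field, 'v::ab_group_add) rep \<Rightarrow> ('k, 'w::ab_group_add) rep \<Rightarrow> bool" where
  "kg_iso M N \<longleftrightarrow> (\<exists>f. kg_hom M N f \<and> bij_betw f (rep_space M) (rep_space N))"

definition direct_sum_decomp ::
  "('k::field, 'v::ab_group_add) rep \<Rightarrow> 'v set \<Rightarrow> 'v set \<Rightarrow> bool" where
  "direct_sum_decomp M A B \<longleftrightarrow>
     submodule A M \<and> submodule B M \<and> A \<inter> B = {0} \<and> {a + b | a b. a \<in> A \<and> b \<in> B} = rep_space M"

definition iso_direct_summand ::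
  "('k::field, 'v::ab_group_add) rep \<Rightarrow> ('k, 'w::ab_group_add) rep \<Rightarrow> bool" where
  "iso_direct_summand N M \<longleftrightarrow>
     (\<exists>A B. direct_sum_decomp M A B \<and> kg_iso N (M\<lparr>rep_space := A\<rparr>))"

definition indecomposable :: "('k::field, 'v::ab_group_add) rep \<Rightarrow> bool" where
  "indecomposable M \<longleftrightarrow>
     rep_space M \<noteq> {0} \<and> (\<forall>A B. direct_sum_decomp M A B \<longrightarrow> A = {0} \<or> B = {0})"

text \<open>The contravariant dual: the dual space, on which \<open>g\<close> acts through the transpose of \<open>g\<close>.
  Functionals are normalised to vanish outside the underlying space.\<close>

definition contravariant_dual :: "('k::field, 'v::ab_group_add) rep \<Rightarrow> ('k, 'v \<Rightarrow> 'k) rep" where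
  "contravariant_dual M =
     \<lparr>rep_space = {\<phi>. linear_map_on (rep_space M) (rep_scale M) (*) \<phi> \<and> (\<forall>v. v \<notin> rep_space M \<longrightarrow> \<phi> v = 0)},
      rep_scale = (\<lambda>c \<phi> v. c * \<phi> v),
      rep_act = (\<lambda>g \<phi> v. if v \<in> rep_space M then \<phi> (rep_act M (transpose g) v) else 0)\<rparr>"

section \<open>Polynomial modules and weights\<close>

text \<open>Functions on \<open>GL2\<close> that are homogeneous polynomials of degree \<open>r\<close> in the four matrix
  entries; \<open>m i j\<close> is the exponent of the entry in position \<open>(i, j)\<close>.\<close>

definition homogeneous_poly_fun :: "nat \<Rightarrow> ('k::field^2^2 \<Rightarrow> 'k) \<Rightarrow> bool" where
  "homogeneous_poly_fun r f \<longleftrightarrow>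
     (\<exists>c. \<forall>g\<in>GL2. f g =
        (\<Sum>m | (\<Sum>i\<in>UNIV. \<Sum>j\<in>UNIV. m i j) = r. c m * (\<Prod>i\<in>UNIV. \<Prod>j\<in>UNIV. (g $ i $ j) ^ m i j)))"

definition polynomial_module :: "nat \<Rightarrow> ('k::field, 'v::ab_group_add) rep \<Rightarrow> bool" where
  "polynomial_module r M \<longleftrightarrow>
     kg_module M \<and>
     (\<exists>B. finite B \<and> module.span (rep_scale M) B = rep_space M) \<and>
     (\<forall>v\<in>rep_space M. \<forall>\<phi>. linear_map_on (rep_space M) (rep_scale M) (*) \<phi> \<longrightarrow>
        homogeneous_poly_fun r (\<lambda>g. \<phi> (rep_act M g v)))"

definition weight_space :: "('k::field, 'v::ab_group_add) rep \<Rightarrow> nat \<times> nat \<Rightarrow> 'v set" where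
  "weight_space M \<mu> =
     {v \<in> rep_space M. \<forall>s t. s \<noteq> 0 \<longrightarrow> t \<noteq> 0 \<longrightarrow>
        rep_act M (diag2 s t) v = rep_scale M (s ^ fst \<mu> * t ^ snd \<mu>) v}"

definition is_weight :: "('k::field, 'v::ab_group_add) rep \<Rightarrow> nat \<times> nat \<Rightarrow> bool" where
  "is_weight M \<mu> \<longleftrightarrow> weight_space M \<mu> \<noteq> {0}"

definition dominated :: "nat \<times> nat \<Rightarrow> nat \<times> nat \<Rightarrow> bool" where
  "dominated \<mu> \<nu> \<longleftrightarrow> fst \<mu> \<le> fst \<nu> \<and> fst \<mu> + snd \<mu> = fst \<nu> + snd \<nu>"

definition highest_weight :: "('k::field, 'v::ab_group_add) rep \<Rightarrow> nat \<times> nat \<Rightarrow> bool" where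
  "highest_weight M \<nu> \<longleftrightarrow> is_weight M \<nu> \<and> (\<forall>\<mu>. is_weight M \<mu> \<longrightarrow> dominated \<mu> \<nu>)"

section \<open>Weyl modules, dual Weyl modules and tilting modules\<close>

text \<open>
  The symmetric power \<open>S\<^sup>n(E)\<close> is the space of homogeneous polynomials of degree \<open>n\<close> in the
  basis \<open>e\<^sub>1, e\<^sub>2\<close> of \<open>E\<close>, written in dehomogenised form \<open>e\<^sub>1 = 1\<close>, \<open>e\<^sub>2 = t\<close>: the monomial
  \<open>e\<^sub>1\<^sup>n\<^sup>-\<^sup>i e\<^sub>2\<^sup>i\<close> is the coefficient position \<open>i\<close> of a polynomial of degree at most \<open>n\<close>. The matrix
  \<open>g\<close> substitutes its first column \<open>g\<^sub>1\<^sub>1 e\<^sub>1 + g\<^sub>2\<^sub>1 e\<^sub>2\<close> for \<open>e\<^sub>1\<close> and its second column for \<open>e\<^sub>2\<close>.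
\<close>

definition sym_act :: "nat \<Rightarrow> 'k::field^2^2 \<Rightarrow> 'k poly \<Rightarrow> 'k poly" where
  "sym_act n g f =
     (\<Sum>i\<le>n. smult (coeff f i) ([:g $ 1 $ 1, g $ 2 $ 1:] ^ (n - i) * [:g $ 1 $ 2, g $ 2 $ 2:] ^ i))"

definition dual_weyl :: "nat \<times> nat \<Rightarrow> ('k::field, 'k poly) rep" where
  "dual_weyl \<nu> =
     \<lparr>rep_space = {f. degree f \<le> fst \<nu> - snd \<nu>},
      rep_scale = smult,
      rep_act = (\<lambda>g f. smult (det g ^ snd \<nu>) (sym_act (fst \<nu> - snd \<nu>) g f))\<rparr>"

definition weyl :: "nat \<times> nat \<Rightarrow> ('k::field, 'k poly \<Rightarrow> 'k) rep" where
  "weyl \<nu> = contravariant_dual (dual_weyl \<nu>)"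

definition two_part_partitions :: "nat \<Rightarrow> (nat \<times> nat) set" where
  "two_part_partitions r = {\<nu>. snd \<nu> \<le> fst \<nu> \<and> fst \<nu> + snd \<nu> = r}"

text \<open>\<open>section_iso M A B N\<close> says that the quotient module \<open>B/A\<close> is isomorphic to \<open>N\<close>:
  there is a surjective homomorphism from \<open>B\<close> onto \<open>N\<close> with kernel \<open>A\<close>.\<close>

definition section_iso ::
  "('k::field, 'v::ab_group_add) rep \<Rightarrow> 'v set \<Rightarrow> 'v set \<Rightarrow> ('k, 'w::ab_group_add) rep \<Rightarrow> bool" where
  "section_iso M A B N \<longleftrightarrow>
     (\<exists>f. kg_hom (M\<lparr>rep_space := B\<rparr>) N f \<and> f ` B = rep_space N \<and> {v \<in> B. f v = 0} = A)"

definition has_filtration ::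
  "('k::field, 'v::ab_group_add) rep \<Rightarrow> ('k, 'w::ab_group_add) rep set \<Rightarrow> bool" where
  "has_filtration M F \<longleftrightarrow>
     (\<exists>n W. W 0 = {0} \<and> W n = rep_space M \<and> (\<forall>i\<le>n. submodule (W i) M) \<and>
        (\<forall>i<n. W i \<subseteq> W (Suc i) \<and> (\<exists>N\<in>F. section_iso M (W i) (W (Suc i)) N)))"

definition is_indecomposable_tilting ::
  "nat \<times> nat \<Rightarrow> ('k::field, 'v::ab_group_add) rep \<Rightarrow> bool" where
  "is_indecomposable_tilting \<nu> T \<longleftrightarrow>
     (let r = fst \<nu> + snd \<nu> in
        polynomial_module r T \<and> indecomposable T \<and>
        has_filtration T (weyl ` two_part_partitions r) \<and>
        has_filtration T (dual_weyl ` two_part_partitions r) \<and>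
        highest_weight T \<nu>)"

section \<open>The tensor algebra and the free Lie algebra\<close>

text \<open>
  A tensor is given by its coordinates with respect to the basis of words in \<open>e\<^sub>1, e\<^sub>2\<close>, i.e. by a
  function on lists over the index type \<open>2\<close>; a finitely supported function is an element of the
  tensor algebra, and \<open>tensor_power r\<close> consists of the functions supported on words of length \<open>r\<close>.
\<close>

type_synonym 'k tensor = "2 list \<Rightarrow> 'k"

definition tensor_of_vec :: "'k::field^2 \<Rightarrow> 'k tensor" where
  "tensor_of_vec x = (\<lambda>w. if length w = 1 then x $ hd w else 0)"

definition tensor_scale :: "'k::field \<Rightarrow> 'k tensor \<Rightarrow> 'k tensor" where
  "tensor_scale c x = (\<lambda>w. c * x w)"

definition tensor_mult :: "'k::field tensor \<Rightarrow> 'k tensor \<Rightarrow> 'k tensor" where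
  "tensor_mult x y = (\<lambda>w. \<Sum>i\<le>length w. x (take i w) * y (drop i w))"

definition tensor_act :: "'k::field^2^2 \<Rightarrow> 'k tensor \<Rightarrow> 'k tensor" where
  "tensor_act g x = (\<lambda>w. \<Sum>v | length v = length w. (\<Prod>i<length w. g $ (w ! i) $ (v ! i)) * x v)"

definition tensor_power :: "nat \<Rightarrow> 'k::field tensor set" where
  "tensor_power r = {x. \<forall>w. length w \<noteq> r \<longrightarrow> x w = 0}"

inductive_set free_lie :: "'k::field tensor set" where
  gen: "tensor_of_vec e \<in> free_lie"
| zero: "0 \<in> free_lie"
| add: "x \<in> free_lie \<Longrightarrow> y \<in> free_lie \<Longrightarrow> x + y \<in> free_lie"
| scale: "x \<in> free_lie \<Longrightarrow> tensor_scale c x \<in> free_lie"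
| bracket: "x \<in> free_lie \<Longrightarrow> y \<in> free_lie \<Longrightarrow> tensor_mult x y - tensor_mult y x \<in> free_lie"

definition lie_power :: "nat \<Rightarrow> ('k::field, 'k tensor) rep" where
  "lie_power r =
     \<lparr>rep_space = free_lie \<inter> tensor_power r, rep_scale = tensor_scale, rep_act = tensor_act\<rparr>"

end

theory Submission
  imports Defs
begin

text \<open>
  Write \<open>x = e\<^sub>1\<close>, \<open>y = e\<^sub>2\<close>, \<open>\<nu> = (r - 1, 1)\<close>, let \<open>e\<^sup>i / i!\<close> and \<open>f\<^sup>i / i!\<close> be the divided powers, that is the
  coefficients of \<open>t\<^sup>i\<close> in the actions of the upper and lower unitriangular matrices, and let
  \<open>w = ad(x)\<^sup>r\<^sup>-\<^sup>1(y)\<close>. In \<open>L\<^sup>r(E)\<close> there is no weight above \<open>\<nu>\<close>, and \<open>w\<close> spans the weight space of \<open>\<nu>\<close>. In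
  terms of the words with a single \<open>y\<close>, the coordinate of \<open>w\<close> at the word with \<open>j\<close> letters \<open>x\<close> after \<open>y\<close> is
  \<open>(-1)\<^sup>j\<close> times the binomial coefficient of \<open>r - 1\<close> over \<open>j\<close>. In characteristic \<open>p\<close> these coordinates
  all agree if and only if \<open>r\<close> is a power of \<open>p\<close>, and this is what decides the theorem.

  \<^emph>\<open>Splitting.\<close> By Fitting's lemma the indecomposable module \<open>T = T(\<nu>)\<close> is a direct summand of \<open>L\<^sup>r(E)\<close> as
  soon as there are homomorphisms \<open>T \<rightarrow> L\<^sup>r(E) \<rightarrow> T\<close> whose composite fixes a nonzero vector
  (\<open>iso_direct_summand_of_retract\<close>).

  \<^emph>\<open>Maps into tensor powers.\<close> If \<open>M\<close> has a Weyl filtration and \<open>\<nu>\<close> is its highest weight, then a nonzero vector of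
  weight \<open>\<nu>\<close> can be sent to every vector of weight \<open>\<nu>\<close> of \<open>E\<^sup>\<otimes>\<^sup>r\<close> that is fixed by the upper unitriangular
  matrices (\<open>highest_weight_hom_to_tensor_power\<close>). The reason is that extensions of Weyl modules by
  \<open>E\<^sup>\<otimes>\<^sup>r\<close> split. Extending a homomorphism along a Weyl section of weight \<open>\<mu>\<close> amounts to writing a
  cocycle of the Borel subgroup as a coboundary (\<open>extend_along_weyl_section\<close>), and in \<open>E\<^sup>\<otimes>\<^sup>r\<close> this is possible for
  all weights with \<open>\<mu>\<^sub>1 - \<mu>\<^sub>2 \<ge> -1\<close> (\<open>eop_cocycle_trivial\<close>): splitting off one tensor factor shifts
  \<open>\<mu>\<^sub>1 - \<mu>\<^sub>2\<close> by one up or down, and the value \<open>-1\<close>, from which this step would leave the range, has an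
  explicit solution for every \<open>r\<close> (\<open>eop_cocycle_singular\<close>).

  \<^emph>\<open>The degree \<open>r\<close> is not a power of \<open>p\<close>.\<close> A map \<open>T \<rightarrow> E\<^sup>\<otimes>\<^sup>r\<close> followed by the Dynkin operator
  \<open>E\<^sup>\<otimes>\<^sup>r \<rightarrow> L\<^sup>r(E)\<close> can be arranged to hit a nonzero multiple of \<open>w\<close>. The contravariant dual of \<open>T\<close> has a Weyl
  filtration as well; a map from it to \<open>E\<^sup>\<otimes>\<^sup>r\<close> transposes to a map \<open>E\<^sup>\<otimes>\<^sup>r \<rightarrow> T\<close>, which does not kill \<open>w\<close> when
  the image of the highest weight vector of the dual pairs nontrivially with \<open>w\<close>. That image may be the
  difference of any two words with a single \<open>y\<close>, so two different coordinates of \<open>w\<close> suffice.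

  \<^emph>\<open>The degree \<open>r\<close> is \<open>p\<close>.\<close> Now the binomial coefficients of \<open>r - 2\<close> are invertible, so that the dual Weyl
  module \<open>\<nabla>(\<nu>)\<close> is simple. Both \<open>T\<close> and \<open>L\<^sup>p(E)\<close> map to it and receive a map from it, and all four maps
  preserve highest weight vectors; then \<open>T \<rightarrow> \<nabla>(\<nu>) \<rightarrow> L\<^sup>p(E) \<rightarrow> \<nabla>(\<nu>) \<rightarrow> T\<close> fixes a vector.

  \<^emph>\<open>The degree \<open>r\<close> is \<open>p\<^sup>k\<close> with \<open>k \<ge> 2\<close>.\<close> Now \<open>w\<close> is the sum of all words with a single \<open>y\<close>, which is the
  image of the word \<open>x\<dots>x\<close> under \<open>f\<close>. The divided power of \<open>f\<close> of exponent \<open>p - 1\<close> composed with \<open>f\<close>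
  is \<open>p\<close> times the divided power of exponent \<open>p\<close>, so it kills \<open>w\<close>. In \<open>T\<close> it does not kill the highest weight
  vector, whose image in a suitable section generates the Weyl module of \<open>\<nu>\<close>. Hence no injective
  homomorphism \<open>T \<rightarrow> L\<^sup>r(E)\<close> exists.
\<close>

section \<open>Two by two matrices\<close>

definition mat2 :: "'k \<Rightarrow> 'k \<Rightarrow> 'k \<Rightarrow> 'k \<Rightarrow> 'k::field^2^2" where
  "mat2 a b c d = vector [vector [a, b], vector [c, d]]"

abbreviation low :: "'k \<Rightarrow> 'k::field^2^2" where "low t \<equiv> mat2 1 0 t 1"
abbreviation up :: "'k \<Rightarrow> 'k::field^2^2" where "up t \<equiv> mat2 1 t 0 1"

lemma mat2_nth [simp]:
  "mat2 a b c d $ 1 $ 1 = a" "mat2 a b c d $ 1 $ 2 = b"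
  "mat2 a b c d $ 2 $ 1 = c" "mat2 a b c d $ 2 $ 2 = d"
  by (simp_all add: mat2_def)

lemma matrix2_eqI:
  fixes g h :: "'k::field^2^2"
  assumes "g $ 1 $ 1 = h $ 1 $ 1" "g $ 1 $ 2 = h $ 1 $ 2" "g $ 2 $ 1 = h $ 2 $ 1" "g $ 2 $ 2 = h $ 2 $ 2"
  shows "g = h"
  using assms by (simp add: vec_eq_iff forall_2)

lemma matrix_mult_nth:
  fixes g h :: "'k::field^2^2"
  shows "(g ** h) $ i $ j = g $ i $ 1 * h $ 1 $ j + g $ i $ 2 * h $ 2 $ j"
  by (simp add: matrix_matrix_mult_def sum_2)

lemma mat2_mult:
  "mat2 a b c d ** mat2 a' b' c' d' =
     mat2 (a * a' + b * c') (a * b' + b * d') (c * a' + d * c') (c * b' + d * d')"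
  by (rule matrix2_eqI) (simp_all add: matrix_mult_nth)

lemma transpose_mat2: "transpose (mat2 a b c d) = mat2 a c b d"
  by (rule matrix2_eqI) (simp_all add: transpose_def)

lemma diag2_mat2: "diag2 s t = mat2 s 0 0 t"
  by (simp add: diag2_def mat2_def)

lemma mat_1_mat2: "mat 1 = mat2 1 0 0 1"
  by (rule matrix2_eqI) (simp_all add: mat_def)

lemma GL2_iff: "g \<in> GL2 \<longleftrightarrow> det g \<noteq> 0" for g :: "'k::field^2^2"
  by (simp add: GL2_def invertible_det_nz)

lemma det_mat2 [simp]: "det (mat2 a b c d) = a * d - b * c"
  by (simp add: det_2)

lemma mat2_GL2_iff: "mat2 a b c d \<in> GL2 \<longleftrightarrow> a * d \<noteq> b * c"
  by (simp add: GL2_iff)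

lemma GL2_simps [simp]:
  "low t \<in> GL2" "up t \<in> GL2" "mat 1 \<in> GL2" "diag2 a b \<in> GL2 \<longleftrightarrow> a \<noteq> 0 \<and> b \<noteq> 0"
  by (simp_all add: mat2_GL2_iff mat_1_mat2 diag2_mat2)

lemma GL2_mult [simp]: "g \<in> GL2 \<Longrightarrow> h \<in> GL2 \<Longrightarrow> g ** h \<in> GL2"
  by (simp add: GL2_iff det_mul)

lemma GL2_transpose [simp]: "transpose g \<in> GL2 \<longleftrightarrow> g \<in> GL2"
  by (simp add: GL2_iff det_transpose)

lemma up_add: "up s ** up t = up (s + t)"
  by (simp add: mat2_mult add.commute)

text \<open>
  The big cell of the Bruhat decomposition. A matrix outside it can be moved into it along a line, so
  identities of polynomial functions need only be checked on the big cell.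
\<close>
lemma mat2_eq_low_diag_up:
  assumes "s \<noteq> 0"
  shows "mat2 s b c d = low (c / s) ** (diag2 s ((s * d - b * c) / s) ** up (b / s))"
  using assms by (simp add: diag2_mat2 mat2_mult field_simps)

lemma GL2_mult_low:
  fixes g :: "'k::field^2^2"
  assumes "g $ 1 $ 1 + g $ 1 $ 2 * t \<noteq> 0"
  defines "s \<equiv> g $ 1 $ 1 + g $ 1 $ 2 * t"
  shows "g ** low t = low ((g $ 2 $ 1 + g $ 2 $ 2 * t) / s) ** (diag2 s (det g / s) ** up (g $ 1 $ 2 / s))"
proof -
  have "g ** low t = mat2 s (g $ 1 $ 2) (g $ 2 $ 1 + g $ 2 $ 2 * t) (g $ 2 $ 2)"
    by (rule matrix2_eqI) (simp_all add: matrix_mult_nth s_def)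
  moreover have "s * g $ 2 $ 2 - g $ 1 $ 2 * (g $ 2 $ 1 + g $ 2 $ 2 * t) = det g"
    by (simp add: s_def det_2 algebra_simps)
  ultimately show ?thesis using mat2_eq_low_diag_up[of s] assms by simp
qed

lemma up_mult_GL2:
  fixes g :: "'k::field^2^2"
  assumes "g $ 1 $ 1 + g $ 2 $ 1 * t \<noteq> 0"
  defines "s \<equiv> g $ 1 $ 1 + g $ 2 $ 1 * t"
  shows "up t ** g = low (g $ 2 $ 1 / s) ** (diag2 s (det g / s) ** up ((g $ 1 $ 2 + g $ 2 $ 2 * t) / s))"
proof -
  have "up t ** g = mat2 s (g $ 1 $ 2 + g $ 2 $ 2 * t) (g $ 2 $ 1) (g $ 2 $ 2)"
    by (rule matrix2_eqI) (simp_all add: matrix_mult_nth s_def mult.commute)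
  moreover have "s * g $ 2 $ 2 - (g $ 1 $ 2 + g $ 2 $ 2 * t) * g $ 2 $ 1 = det g"
    by (simp add: s_def det_2 algebra_simps)
  ultimately show ?thesis using mat2_eq_low_diag_up[of s] assms by simp
qed

lemma infinite_affine_nonzero:
  fixes a b :: "'k::field"
  assumes "infinite (UNIV :: 'k set)" "a \<noteq> 0 \<or> b \<noteq> 0"
  shows "infinite {t. a + b * t \<noteq> 0}"
proof
  assume fin: "finite {t. a + b * t \<noteq> 0}"
  have "{t. a + b * t = 0} \<subseteq> {- a / b}"
    using assms(2) by (cases "b = 0") (auto simp: field_simps eq_neg_iff_add_eq_0)
  hence "finite {t. a + b * t = 0}" by (rule finite_subset) simp
  with fin have "finite ({t. a + b * t \<noteq> 0} \<union> {t. a + b * t = 0})" by blast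
  also have "{t. a + b * t \<noteq> 0} \<union> {t. a + b * t = 0} = UNIV" by auto
  finally show False using assms(1) by simp
qed

section \<open>Polynomial curves in vector spaces\<close>

text \<open>
  The rows of \<open>q\<close> are the coefficients of the Lagrange interpolation polynomials. They express the coefficients
  of a polynomial curve through finitely many of its values; applied to the curve of a unipotent
  subgroup, they realise divided powers as elements of the group algebra.
\<close>
lemma coefficient_extraction:
  fixes S :: "'k::field set"
  assumes "infinite S"
  shows "\<exists>t q. (\<forall>k. t k \<in> S) \<and>
     (\<forall>i\<le>d. \<forall>j\<le>d. (\<Sum>k\<le>d. q i k * t k ^ j) = (if i = j then 1 else (0::'k)))"
proof -
  obtain t :: "nat \<Rightarrow> 'k" where t: "inj t" "range t \<subseteq> S"
    using infinite_countable_subset[OF assms] by blast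
  define L where "L k = smult (inverse (\<Prod>l\<in>{..d}-{k}. t k - t l)) (\<Prod>l\<in>{..d}-{k}. [:- t l, 1:])" for k
  have Lv: "poly (L k) (t l) = (if k = l then 1 else 0)" if "k \<le> d" "l \<le> d" for k l
  proof (cases "k = l")
    case True
    have "(\<Prod>l\<in>{..d}-{k}. t k - t l) \<noteq> 0" using t(1) by (auto simp: inj_eq)
    then show ?thesis using True by (simp add: L_def poly_prod)
  next
    case False
    have "(\<Prod>i\<in>{..d}-{k}. poly [:- t i, 1:] (t l)) = 0"
      using False that by (intro prod_zero) auto
    then show ?thesis using False by (simp add: L_def poly_prod)
  qed
  have Ld: "degree (L k) \<le> d" if "k \<le> d" for k
  proof -
    have "degree (\<Prod>l\<in>{..d}-{k}. [:- t l, 1:]) \<le> (\<Sum>l\<in>{..d}-{k}. degree [:- t l, 1:])"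
      using degree_prod_sum_le[of "{..d}-{k}" "\<lambda>l. [:- t l, 1:]"] by (simp add: o_def)
    also have "\<dots> = d" using that by simp
    finally show ?thesis unfolding L_def using degree_smult_le order_trans by blast
  qed
  have eq: "(\<Sum>k\<le>d. smult (t k ^ j) (L k)) = monom 1 j" if "j \<le> d" for j
  proof (rule poly_eqI_degree[of "t ` {..d}"])
    show "poly (\<Sum>k\<le>d. smult (t k ^ j) (L k)) x = poly (monom 1 j) x" if "x \<in> t ` {..d}" for x
      using that by (auto simp: poly_sum Lv poly_monom if_distrib if_distribR cong: if_cong)
    have c: "card (t ` {..d}) = d + 1" using t(1) by (simp add: card_image inj_on_subset)
    have "degree (\<Sum>k\<le>d. smult (t k ^ j) (L k)) \<le> d"
      by (intro degree_sum_le) (auto intro: order_trans[OF degree_smult_le] Ld)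
    thus "degree (\<Sum>k\<le>d. smult (t k ^ j) (L k)) < card (t ` {..d})" using c by simp
    show "degree (monom (1::'k) j) < card (t ` {..d})" using c \<open>j \<le> d\<close> by (simp add: degree_monom_eq)
  qed
  have "(\<Sum>k\<le>d. coeff (L k) i * t k ^ j) = (if i = j then 1 else 0)" if "i \<le> d" "j \<le> d" for i j
    using arg_cong[OF eq[OF that(2)], of "\<lambda>p. coeff p i"]
    by (simp add: coeff_sum mult.commute eq_commute)
  thus ?thesis using t(2) by (intro exI[of _ t] exI[of _ "\<lambda>i k. coeff (L k) i"]) auto
qed

context vector_space
begin

lemma poly_curve_coeff_combination:
  assumes "\<And>i j. i \<le> d \<Longrightarrow> j \<le> d \<Longrightarrow> (\<Sum>k\<le>d. q i k * t k ^ j) = (if i = j then 1 else 0)" "i \<le> d"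
  shows "z i = (\<Sum>k\<le>d. scale (q i k) (\<Sum>j\<le>d. scale (t k ^ j) (z j)))"
proof -
  have "(\<Sum>k\<le>d. scale (q i k) (\<Sum>j\<le>d. scale (t k ^ j) (z j))) = (\<Sum>j\<le>d. scale (\<Sum>k\<le>d. q i k * t k ^ j) (z j))"
    by (simp add: scale_sum_right scale_sum_left) (rule sum.swap)
  also have "\<dots> = (\<Sum>j\<le>d. if i = j then z j else 0)"
    using assms by (intro sum.cong) auto
  also have "\<dots> = z i" using assms(2) by simp
  finally show ?thesis by simp
qed

lemma poly_curve_coeff_in:
  assumes "infinite S" "subspace W" "\<And>t. t \<in> S \<Longrightarrow> (\<Sum>j\<le>d. scale (t ^ j) (z j)) \<in> W" "i \<le> d"
  shows "z i \<in> W"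
proof -
  obtain t q where tq: "\<forall>k. t k \<in> S"
    "\<forall>i\<le>d. \<forall>j\<le>d. (\<Sum>k\<le>d. q i k * t k ^ j) = (if i = j then 1 else 0)"
    using coefficient_extraction[OF assms(1)] by metis
  have "(\<Sum>k\<le>d. scale (q i k) (\<Sum>j\<le>d. scale (t k ^ j) (z j))) \<in> W"
    by (intro subspace_sum[OF assms(2)] subspace_scale[OF assms(2)] assms(3)) (use tq(1) in auto)
  also have "(\<Sum>k\<le>d. scale (q i k) (\<Sum>j\<le>d. scale (t k ^ j) (z j))) = z i"
    using poly_curve_coeff_combination[of d q t i z] tq(2) assms(4) by simp
  finally show ?thesis .
qed

lemma poly_curve_unique:
  assumes "infinite S" "\<And>t. t \<in> S \<Longrightarrow> (\<Sum>j\<le>d. scale (t ^ j) (y j)) = (\<Sum>j\<le>d. scale (t ^ j) (z j))" "i \<le> d"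
  shows "y i = z i"
proof -
  have "y i - z i \<in> {0}"
    by (rule poly_curve_coeff_in[OF assms(1) subspace_single_0 _ assms(3), where z = "\<lambda>i. y i - z i"])
       (simp add: assms(2) scale_right_diff_distrib sum_subtractf)
  thus ?thesis by simp
qed

text \<open>
  If a curve is polynomial in \<open>t\<close> and is also \<open>t\<^sup>n\<close> times a polynomial in \<open>1/t\<close>, the latter has degree at most
  \<open>n\<close>. Applied to orbits of highest weight vectors of weight \<open>\<mu>\<close> with \<open>n = \<mu>\<^sub>1 - \<mu>\<^sub>2\<close>, this makes the divided powers
  \<open>f\<^sup>i / i!\<close> with \<open>i > n\<close> vanish on them.
\<close>

lemma poly_curve_pole_order:
  assumes inf: "infinite (UNIV :: 'a set)" and n: "n \<le> r"
    and eq: "\<And>t. t \<noteq> 0 \<Longrightarrow> (\<Sum>j\<le>r. scale (t ^ j) (y j)) = scale (c * t ^ n) (\<Sum>i\<le>r. scale ((1 / t) ^ i) (z i))"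
    and c: "c \<noteq> 0" and i: "n < i" "i \<le> r"
  shows "z i = 0"
proof -
  define Y where "Y j = (if j < r then 0 else y (j - r))" for j
  define Z where "Z j = (if n \<le> j \<and> j \<le> n + r then scale c (z (n + r - j)) else 0)" for j
  have inf': "infinite (UNIV - {0::'a})" using inf by simp
  have Yeq: "(\<Sum>j\<le>r+r. scale (t ^ j) (Y j)) = scale (t ^ r) (\<Sum>j\<le>r. scale (t ^ j) (y j))" for t
  proof -
    have "(\<Sum>j\<le>r+r. scale (t ^ j) (Y j)) = (\<Sum>j\<in>{r..r+r}. scale (t ^ j) (y (j - r)))"
      by (rule sum.mono_neutral_cong_right) (auto simp: Y_def)
    also have "\<dots> = (\<Sum>j\<le>r. scale (t ^ (j + r)) (y j))"
      by (rule sum.reindex_bij_witness[of _ "\<lambda>j. j + r" "\<lambda>j. j - r"]) auto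
    also have "\<dots> = scale (t ^ r) (\<Sum>j\<le>r. scale (t ^ j) (y j))"
      by (simp add: scale_sum_right power_add mult.commute)
    finally show ?thesis .
  qed
  have Zeq: "(\<Sum>j\<le>r+r. scale (t ^ j) (Z j)) =
      scale (t ^ r) (scale (c * t ^ n) (\<Sum>i\<le>r. scale ((1 / t) ^ i) (z i)))" if t: "t \<noteq> 0" for t
  proof -
    have "(\<Sum>j\<le>r+r. scale (t ^ j) (Z j)) = (\<Sum>j\<in>{n..n+r}. scale (t ^ j) (scale c (z (n + r - j))))"
      using n by (intro sum.mono_neutral_cong_right) (auto simp: Z_def)
    also have "\<dots> = (\<Sum>i\<le>r. scale (t ^ (n + r - i)) (scale c (z i)))"
      by (rule sum.reindex_bij_witness[of _ "\<lambda>i. n + r - i" "\<lambda>i. n + r - i"]) auto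
    also have "\<dots> = (\<Sum>i\<le>r. scale (t ^ r) (scale (c * t ^ n) (scale ((1 / t) ^ i) (z i))))"
      using t by (intro sum.cong) (auto simp: power_diff power_add field_simps)
    finally show ?thesis by (simp add: scale_sum_right)
  qed
  have "Y (n + r - i) = Z (n + r - i)"
    by (rule poly_curve_unique[OF inf', where d = "r + r"]) (use i n in \<open>auto simp: Yeq Zeq eq\<close>)
  with i c show ?thesis by (simp add: Y_def Z_def split: if_splits)
qed

end

section \<open>Modules with polynomial action\<close>

definition matrix_monomial :: "(2 \<Rightarrow> 2 \<Rightarrow> nat) \<Rightarrow> 'k::field^2^2 \<Rightarrow> 'k" where
  "matrix_monomial m g = (\<Prod>i\<in>UNIV. \<Prod>j\<in>UNIV. (g $ i $ j) ^ m i j)"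

definition exponents :: "nat \<Rightarrow> (2 \<Rightarrow> 2 \<Rightarrow> nat) set" where
  "exponents r = {m. (\<Sum>i\<in>UNIV. \<Sum>j\<in>UNIV. m i j) = r}"

text \<open>
  The coefficients \<open>c\<close> of the action may be arbitrary vectors of the ambient space. In this form the notion is
  inherited by submodules without any argument; that the coefficients along a curve lie in a submodule
  is recovered by interpolation where it is needed.
\<close>
definition poly_rep :: "nat \<Rightarrow> ('k::field, 'v::ab_group_add) rep \<Rightarrow> bool" where
  "poly_rep r M \<longleftrightarrow> kg_module M \<and>
     (\<forall>v\<in>rep_space M. \<exists>c. \<forall>g\<in>GL2.
        rep_act M g v = (\<Sum>m\<in>exponents r. rep_scale M (matrix_monomial m g) (c m)))"

lemma finite_exponents: "finite (exponents r)"
proof -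
  have "exponents r \<subseteq> (\<lambda>f i j. f (i, j)) ` (UNIV \<rightarrow>\<^sub>E {..r})"
  proof
    fix m assume "m \<in> exponents r"
    hence m: "(\<Sum>i\<in>UNIV. \<Sum>j\<in>UNIV. m i j) = r" by (simp add: exponents_def)
    have "m i j \<le> r" for i j
      using member_le_sum[of j UNIV "m i"] member_le_sum[of i UNIV "\<lambda>i. \<Sum>j\<in>UNIV. m i j"] m
      by (simp add: order_trans)
    thus "m \<in> (\<lambda>f i j. f (i, j)) ` (UNIV \<rightarrow>\<^sub>E {..r})"
      by (intro image_eqI[of _ _ "\<lambda>(i, j). m i j"]) auto
  qed
  thus ?thesis by (rule finite_subset) (intro finite_imageI finite_PiE; simp)
qed

lemma kg_moduleD:
  assumes "kg_module M"
  shows "vector_space (rep_scale M)" "module.subspace (rep_scale M) (rep_space M)"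
    and "\<And>g v. g \<in> GL2 \<Longrightarrow> v \<in> rep_space M \<Longrightarrow> rep_act M g v \<in> rep_space M"
    and "\<And>g v w. g \<in> GL2 \<Longrightarrow> v \<in> rep_space M \<Longrightarrow> w \<in> rep_space M \<Longrightarrow>
           rep_act M g (v + w) = rep_act M g v + rep_act M g w"
    and "\<And>g c v. g \<in> GL2 \<Longrightarrow> v \<in> rep_space M \<Longrightarrow>
           rep_act M g (rep_scale M c v) = rep_scale M c (rep_act M g v)"
    and "\<And>v. v \<in> rep_space M \<Longrightarrow> rep_act M (mat 1) v = v"
    and "\<And>g h v. g \<in> GL2 \<Longrightarrow> h \<in> GL2 \<Longrightarrow> v \<in> rep_space M \<Longrightarrow>
           rep_act M (g ** h) v = rep_act M g (rep_act M h v)"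
  using assms unfolding kg_module_def linear_map_on_def by (auto simp: image_subset_iff)

locale kg =
  fixes M :: "('k::field, 'v::ab_group_add) rep"
  assumes kg: "kg_module M"
begin

abbreviation "carr \<equiv> rep_space M"
abbreviation "scal \<equiv> rep_scale M"
abbreviation "act \<equiv> rep_act M"

sublocale vs: vector_space scal
  using kg_moduleD(1)[OF kg] .

lemma carr_subspace: "vs.subspace carr"
  using kg_moduleD(2)[OF kg] .

lemma act_in [simp, intro]: "g \<in> GL2 \<Longrightarrow> v \<in> carr \<Longrightarrow> act g v \<in> carr"
  using kg_moduleD(3)[OF kg] .

lemma act_one [simp]: "v \<in> carr \<Longrightarrow> act (mat 1) v = v"
  using kg_moduleD(6)[OF kg] .

lemma act_mult: "g \<in> GL2 \<Longrightarrow> h \<in> GL2 \<Longrightarrow> v \<in> carr \<Longrightarrow> act (g ** h) v = act g (act h v)"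
  using kg_moduleD(7)[OF kg] .

lemma linear_act: "g \<in> GL2 \<Longrightarrow> linear_map_on carr scal scal (act g)"
  using kg_moduleD(4,5)[OF kg] unfolding linear_map_on_def by blast

end

lemma linear_map_on_add:
  "linear_map_on V s s' f \<Longrightarrow> x \<in> V \<Longrightarrow> y \<in> V \<Longrightarrow> f (x + y) = f x + f y"
  by (auto simp: linear_map_on_def)

lemma linear_map_on_scale: "linear_map_on V s s' f \<Longrightarrow> x \<in> V \<Longrightarrow> f (s c x) = s' c (f x)"
  by (auto simp: linear_map_on_def)

lemma linear_map_on_subset: "linear_map_on V s s' f \<Longrightarrow> W \<subseteq> V \<Longrightarrow> linear_map_on W s s' f"
  unfolding linear_map_on_def by blast

lemma linear_map_on_zero:
  assumes "linear_map_on V s s' f" "0 \<in> V"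
  shows "f 0 = 0"
  using linear_map_on_add[OF assms(1) assms(2) assms(2)] by simp

lemma linear_map_on_diff:
  assumes "linear_map_on V s s' f" "vector_space s" "module.subspace s V" "x \<in> V" "y \<in> V"
  shows "f (x - y) = f x - f y"
proof -
  interpret vector_space s by fact
  have "x - y \<in> V" using assms by (simp add: subspace_diff)
  from linear_map_on_add[OF assms(1) this \<open>y \<in> V\<close>] show ?thesis by simp
qed

lemma linear_map_on_sum:
  assumes "linear_map_on V s s' f" "vector_space s" "module.subspace s V" "\<And>i. i \<in> I \<Longrightarrow> x i \<in> V"
  shows "f (\<Sum>i\<in>I. x i) = (\<Sum>i\<in>I. f (x i))"
proof -
  interpret vector_space s by fact
  have 0: "0 \<in> V" using assms by (simp add: subspace_0)
  show ?thesis using assms(4)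
  proof (induction I rule: infinite_finite_induct)
    case (insert i I)
    then have "(\<Sum>i\<in>I. x i) \<in> V" using assms(3) by (auto intro: subspace_sum)
    with insert show ?case by (simp add: linear_map_on_add[OF assms(1)])
  qed (simp_all add: linear_map_on_zero[OF assms(1) 0])
qed

lemma linear_map_on_sum_scale:
  assumes "linear_map_on V s s' f" "vector_space s" "module.subspace s V" "\<And>i. i \<in> I \<Longrightarrow> x i \<in> V"
  shows "f (\<Sum>i\<in>I. s (c i) (x i)) = (\<Sum>i\<in>I. s' (c i) (f (x i)))"
proof -
  interpret vector_space s by fact
  have "f (\<Sum>i\<in>I. s (c i) (x i)) = (\<Sum>i\<in>I. f (s (c i) (x i)))"
    using assms by (intro linear_map_on_sum) (auto intro: subspace_scale)
  also have "\<dots> = (\<Sum>i\<in>I. s' (c i) (f (x i)))"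
    using assms(1,4) by (intro sum.cong refl linear_map_on_scale) auto
  finally show ?thesis .
qed

lemma linear_map_on_compose:
  assumes "linear_map_on V s s' f" "linear_map_on W s' s'' h" "f ` V \<subseteq> W"
  shows "linear_map_on V s s'' (\<lambda>x. h (f x))"
  using assms unfolding linear_map_on_def by (auto simp: image_subset_iff)

lemma kg_hom_compose:
  assumes "kg_hom M N f" "kg_hom N P h"
  shows "kg_hom M P (\<lambda>x. h (f x))"
  using assms linear_map_on_compose[of "rep_space M" _ _ f "rep_space N" _ h]
  unfolding kg_hom_def by (auto simp: image_subset_iff)

lemma kg_module_submodule:
  assumes "kg_module M" "submodule W M"
  shows "kg_module (M\<lparr>rep_space := W\<rparr>)"
  using assms unfolding kg_module_def submodule_def
  by (auto intro: linear_map_on_subset)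

lemma poly_rep_submodule:
  assumes "poly_rep r M" "submodule W M"
  shows "poly_rep r (M\<lparr>rep_space := W\<rparr>)"
  using assms kg_module_submodule[of M W] unfolding poly_rep_def submodule_def by auto

lemma poly_matrix_monomial:
  fixes Q :: "2 \<Rightarrow> 2 \<Rightarrow> 'k::field poly"
  assumes "\<And>i j. degree (Q i j) \<le> 1" "m \<in> exponents r"
  shows "\<exists>P. degree P \<le> r \<and> (\<forall>t. matrix_monomial m (\<chi> i j. poly (Q i j) t) = poly P t)"
proof (intro exI conjI allI)
  let ?P = "\<Prod>i\<in>UNIV. \<Prod>j\<in>UNIV. Q i j ^ m i j"
  have "degree ?P \<le> (\<Sum>i\<in>UNIV. \<Sum>j\<in>UNIV. m i j)"
  proof (rule order_trans[OF degree_prod_sum_le], simp, unfold o_def, rule sum_mono)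
    fix i :: 2
    show "degree (\<Prod>j\<in>UNIV. Q i j ^ m i j) \<le> (\<Sum>j\<in>UNIV. m i j)"
    proof (rule order_trans[OF degree_prod_sum_le], simp, unfold o_def, rule sum_mono)
      fix j :: 2
      have "degree (Q i j ^ m i j) \<le> degree (Q i j) * m i j" by (rule degree_power_le)
      also have "\<dots> \<le> 1 * m i j" by (intro mult_right_mono assms) simp
      finally show "degree (Q i j ^ m i j) \<le> m i j" by simp
    qed
  qed
  thus "degree ?P \<le> r" using assms(2) by (simp add: exponents_def)
  show "matrix_monomial m (\<chi> i j. poly (Q i j) t) = poly ?P t" for t
    by (simp add: matrix_monomial_def poly_prod)
qed

lemma poly_altdef_le:
  fixes p :: "'k::field poly"
  assumes "degree p \<le> n"
  shows "poly p x = (\<Sum>i\<le>n. coeff p i * x ^ i)"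
  unfolding poly_altdef using assms
  by (intro sum.mono_neutral_left) (auto intro: coeff_eq_0 simp: not_le)

text \<open>
  Along an affine line in the matrix space a polynomial action of degree \<open>r\<close> is a polynomial curve of degree at most
  \<open>r\<close>. In the lemmas below the subspace \<open>W\<close> serves to record that the coefficients lie in every subspace that
  contains the orbit.
\<close>
locale prep = kg M for M :: "('k::field, 'v::ab_group_add) rep" +
  fixes r :: nat
  assumes poly_rep: "poly_rep r M" and inf: "infinite (UNIV :: 'k set)"
begin

lemma affine_curve:
  assumes v: "v \<in> carr" and W: "vs.subspace W" "\<And>g. g \<in> GL2 \<Longrightarrow> act g v \<in> W"
    and g: "\<And>t. g t = mat2 (a + a' * t) (b + b' * t) (c + c' * t) (d + d' * t)"
    and S: "infinite S" "\<And>t. t \<in> S \<Longrightarrow> g t \<in> GL2"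
  obtains z where "\<And>i. z i \<in> W" "\<And>t. g t \<in> GL2 \<Longrightarrow> act (g t) v = (\<Sum>i\<le>r. scal (t ^ i) (z i))"
proof -
  define Q :: "2 \<Rightarrow> 2 \<Rightarrow> 'k poly" where "Q i j = (if i = 1 then if j = 1 then [:a, a':] else [:b, b':]
     else if j = 1 then [:c, c':] else [:d, d':])" for i j
  have Q: "degree (Q i j) \<le> 1" for i j by (simp add: Q_def)
  have gQ: "g t = (\<chi> i j. poly (Q i j) t)" for t
    by (rule matrix2_eqI) (simp_all add: g Q_def mult.commute)
  obtain C where C: "\<And>g. g \<in> GL2 \<Longrightarrow> act g v = (\<Sum>m\<in>exponents r. scal (matrix_monomial m g) (C m))"
    using poly_rep v unfolding poly_rep_def by blast
  obtain P where P: "\<And>m. m \<in> exponents r \<Longrightarrow> degree (P m) \<le> r"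
      "\<And>m t. m \<in> exponents r \<Longrightarrow> matrix_monomial m (g t) = poly (P m) t"
    using poly_matrix_monomial[of Q _ r] Q unfolding gQ by metis
  define z where "z i = (if i \<le> r then \<Sum>m\<in>exponents r. scal (coeff (P m) i) (C m) else 0)" for i
  have eq: "act (g t) v = (\<Sum>i\<le>r. scal (t ^ i) (z i))" if "g t \<in> GL2" for t
  proof -
    have "act (g t) v = (\<Sum>m\<in>exponents r. scal (poly (P m) t) (C m))"
      by (simp add: C[OF that] P(2))
    also have "\<dots> = (\<Sum>m\<in>exponents r. scal (\<Sum>i\<le>r. coeff (P m) i * t ^ i) (C m))"
      by (intro sum.cong refl arg_cong2[of _ _ _ _ scal] poly_altdef_le P(1))
    also have "\<dots> = (\<Sum>i\<le>r. scal (t ^ i) (\<Sum>m\<in>exponents r. scal (coeff (P m) i) (C m)))"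
      by (simp add: vs.scale_sum_left vs.scale_sum_right mult.commute) (rule sum.swap)
    also have "\<dots> = (\<Sum>i\<le>r. scal (t ^ i) (z i))"
      by (intro sum.cong) (auto simp: z_def)
    finally show ?thesis .
  qed
  have "z i \<in> W" for i
  proof (cases "i \<le> r")
    case True
    show ?thesis
    proof (rule vs.poly_curve_coeff_in[OF S(1) W(1) _ True])
      show "(\<Sum>j\<le>r. scal (t ^ j) (z j)) \<in> W" if "t \<in> S" for t
        using eq[OF S(2)[OF that]] W(2)[OF S(2)[OF that]] by simp
    qed
  qed (simp add: z_def vs.subspace_0[OF W(1)])
  with eq show thesis using that by blast
qed

lemma act_scalar:
  assumes "v \<in> carr" "t \<noteq> 0"
  shows "act (diag2 t t) v = scal (t ^ r) v"
proof -
  obtain C where C: "\<And>g. g \<in> GL2 \<Longrightarrow> act g v = (\<Sum>m\<in>exponents r. scal (matrix_monomial m g) (C m))"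
    using poly_rep assms(1) unfolding poly_rep_def by blast
  have "matrix_monomial m (diag2 t t) = t ^ r * matrix_monomial m (mat 1)" if "m \<in> exponents r" for m
    using that unfolding exponents_def
    by (auto simp: matrix_monomial_def diag2_mat2 mat_1_mat2 UNIV_2 power_add power_0_left)
  hence "act (diag2 t t) v = scal (t ^ r) (act (mat 1) v)"
    using assms by (simp add: C vs.scale_sum_right)
  thus ?thesis using assms by simp
qed

text \<open>
  The components are the coefficients of the curve of \<open>diag(t, 1)\<close>; scalar matrices act through the degree and
  account for the second diagonal entry.
\<close>
lemma weight_components:
  assumes v: "v \<in> carr" and W: "vs.subspace W" "\<And>g. g \<in> GL2 \<Longrightarrow> act g v \<in> W" "W \<subseteq> carr"
  obtains z where "\<And>i. z i \<in> W" "\<And>i. i \<le> r \<Longrightarrow> z i \<in> weight_space M (i, r - i)"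
    "\<And>s t. s \<noteq> 0 \<Longrightarrow> t \<noteq> 0 \<Longrightarrow> act (diag2 s t) v = (\<Sum>i\<le>r. scal (s ^ i * t ^ (r - i)) (z i))"
    "v = (\<Sum>i\<le>r. z i)"
proof -
  have inf': "infinite (- {0::'k})" using inf by (simp add: Compl_eq_Diff_UNIV)
  obtain z where z: "\<And>i. z i \<in> W" "\<And>t. mat2 t 0 0 1 \<in> GL2 \<Longrightarrow> act (mat2 t 0 0 1) v = (\<Sum>i\<le>r. scal (t ^ i) (z i))"
    using affine_curve[OF v W(1,2), of "\<lambda>t. mat2 t 0 0 1" 0 1 0 0 0 0 1 0 "- {0}"] inf'
    by (auto simp: mat2_GL2_iff)
  have zc: "z i \<in> carr" for i using z(1) W(3) by blast
  have eq: "act (diag2 s t) v = (\<Sum>i\<le>r. scal (s ^ i * t ^ (r - i)) (z i))" if "s \<noteq> 0" "t \<noteq> 0" for s t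
  proof -
    have "diag2 s t = diag2 t t ** mat2 (s / t) 0 0 1" using that by (simp add: diag2_mat2 mat2_mult)
    hence "act (diag2 s t) v = scal (t ^ r) (act (mat2 (s / t) 0 0 1) v)"
      using that v by (simp add: act_mult mat2_GL2_iff act_scalar)
    also have "\<dots> = scal (t ^ r) (\<Sum>i\<le>r. scal ((s / t) ^ i) (z i))"
      using that by (subst z(2)) (auto simp: mat2_GL2_iff)
    also have "\<dots> = (\<Sum>i\<le>r. scal (s ^ i * t ^ (r - i)) (z i))"
      using that by (simp add: vs.scale_sum_right) (intro sum.cong arg_cong2[of _ _ _ _ scal], auto simp: power_divide power_diff)
    finally show ?thesis .
  qed
  have "act (diag2 s t) (z i) = scal (s ^ i * t ^ (r - i)) (z i)" if st: "s \<noteq> 0" "t \<noteq> 0" and i: "i \<le> r" for s t i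
  proof (rule vs.poly_curve_unique[OF inf', where d = r and y = "\<lambda>i. act (diag2 s t) (z i)"])
    fix a :: 'k assume a: "a \<in> - {0}"
    have "(\<Sum>j\<le>r. scal (a ^ j) (act (diag2 s t) (z j))) = act (diag2 s t) (\<Sum>j\<le>r. scal (a ^ j) (z j))"
      by (subst linear_map_on_sum_scale[OF linear_act vs.vector_space_axioms carr_subspace]) (use st zc in auto)
    also have "(\<Sum>j\<le>r. scal (a ^ j) (z j)) = act (diag2 a 1) v" using a by (simp add: eq)
    also have "act (diag2 s t) (act (diag2 a 1) v) = act (diag2 (s * a) t) v"
      using a st v by (subst act_mult[symmetric]) (auto simp: diag2_mat2 mat2_mult mat2_GL2_iff)
    also have "\<dots> = (\<Sum>j\<le>r. scal (a ^ j) (scal (s ^ j * t ^ (r - j)) (z j)))"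
      using a st by (simp add: eq power_mult_distrib mult_ac)
    finally show "(\<Sum>j\<le>r. scal (a ^ j) (act (diag2 s t) (z j))) = (\<Sum>j\<le>r. scal (a ^ j) (scal (s ^ j * t ^ (r - j)) (z j)))" .
  qed (use i in auto)
  hence "z i \<in> weight_space M (i, r - i)" if "i \<le> r" for i
    using zc that by (auto simp: weight_space_def)
  moreover have "v = (\<Sum>i\<le>r. z i)"
    using eq[of 1 1] v by (simp add: diag2_mat2 flip: mat_1_mat2)
  ultimately show thesis using that z(1) eq by blast
qed

lemma low_curve:
  assumes "v \<in> carr" "vs.subspace W" "\<And>g. g \<in> GL2 \<Longrightarrow> act g v \<in> W"
  obtains z where "\<And>i. z i \<in> W" "\<And>t. act (low t) v = (\<Sum>i\<le>r. scal (t ^ i) (z i))"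
  using affine_curve[OF assms, of low 1 0 0 0 0 1 1 0 UNIV] inf by auto

lemma up_curve:
  assumes "v \<in> carr" "vs.subspace W" "\<And>g. g \<in> GL2 \<Longrightarrow> act g v \<in> W"
  obtains z where "\<And>i. z i \<in> W" "\<And>t. act (up t) v = (\<Sum>i\<le>r. scal (t ^ i) (z i))"
  using affine_curve[OF assms, of up 1 0 0 1 0 0 1 0 UNIV] inf by auto

lemma swap_curve:
  assumes "v \<in> carr" "vs.subspace W" "\<And>g. g \<in> GL2 \<Longrightarrow> act g v \<in> W"
  obtains z where "\<And>i. z i \<in> W" "\<And>t. act (mat2 t 1 1 0) v = (\<Sum>i\<le>r. scal (t ^ i) (z i))"
  using affine_curve[OF assms, of "\<lambda>t. mat2 t 1 1 0" 0 1 1 0 1 0 0 0 UNIV] inf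
  by (auto simp: mat2_GL2_iff)

end

lemma prepI: "poly_rep r M \<Longrightarrow> infinite (UNIV :: 'k set) \<Longrightarrow> prep M r" for M :: "('k::field, 'v::ab_group_add) rep"
  by unfold_locales (auto simp: poly_rep_def)

section \<open>The highest weight vector of a Weyl module\<close>

lemma coeff_0_sym_act:
  "coeff (sym_act n g f) 0 = (\<Sum>i\<le>n. coeff f i * ((g $ 1 $ 1) ^ (n - i) * (g $ 1 $ 2) ^ i))"
  by (simp add: sym_act_def coeff_sum coeff_mult_0 coeff_0_power)

lemma poly_sym_act:
  "poly (sym_act n g f) t =
     (\<Sum>i\<le>n. coeff f i * ((g $ 1 $ 1 + g $ 2 $ 1 * t) ^ (n - i) * (g $ 1 $ 2 + g $ 2 $ 2 * t) ^ i))"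
  by (simp add: sym_act_def poly_sum mult.commute)

lemma degree_sym_act: "degree (sym_act n g f) \<le> n"
  unfolding sym_act_def
proof (intro degree_sum_le order_trans[OF degree_smult_le])
  fix i assume "i \<in> {..n}"
  have 1: "degree ([:a, b:] ^ k) \<le> k" for a b :: 'a and k
    using degree_power_le[of "[:a, b:]" k] by (rule order_trans) (simp split: if_splits)
  show "degree ([:g $ 1 $ 1, g $ 2 $ 1:] ^ (n - i) * [:g $ 1 $ 2, g $ 2 $ 2:] ^ i) \<le> n"
    using degree_mult_le[of "[:g $ 1 $ 1, g $ 2 $ 1:] ^ (n - i)" "[:g $ 1 $ 2, g $ 2 $ 2:] ^ i"]
      1[of "g $ 1 $ 1" "g $ 2 $ 1" "n - i"] 1[of "g $ 1 $ 2" "g $ 2 $ 2" i] \<open>i \<in> {..n}\<close> by simp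
qed simp

text \<open>
  The highest weight vector of the Weyl module, as a functional on polynomials: evaluation at \<open>0\<close>. A lower
  unitriangular matrix moves it to evaluation at another point, so that the submodule that it generates is
  spanned by evaluations.
\<close>
definition weyl_generator :: "nat \<Rightarrow> 'k::field poly \<Rightarrow> 'k" where
  "weyl_generator n f = (if degree f \<le> n then coeff f 0 else 0)"

lemma weyl_act:
  assumes "degree f \<le> fst \<mu> - snd \<mu>"
  shows "rep_act (weyl \<mu>) g \<phi> f = \<phi> (smult (det g ^ snd \<mu>) (sym_act (fst \<mu> - snd \<mu>) (transpose g) f))"
  using assms by (simp add: weyl_def contravariant_dual_def dual_weyl_def det_transpose)

lemma weyl_act_generator:
  assumes "degree f \<le> fst \<mu> - snd \<mu>"
  shows "rep_act (weyl \<mu>) g (weyl_generator (fst \<mu> - snd \<mu>)) f =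
    det g ^ snd \<mu> * (\<Sum>i\<le>fst \<mu> - snd \<mu>. coeff f i * ((g $ 1 $ 1) ^ (fst \<mu> - snd \<mu> - i) * (g $ 2 $ 1) ^ i))"
proof -
  have "degree (smult (det g ^ snd \<mu>) (sym_act (fst \<mu> - snd \<mu>) (transpose g) f)) \<le> fst \<mu> - snd \<mu>"
    using degree_sym_act order_trans[OF degree_smult_le] by blast
  with assms show ?thesis
    by (simp add: weyl_act weyl_generator_def coeff_0_sym_act) (simp add: transpose_def)
qed

lemma weyl_act_outside: "\<not> degree f \<le> fst \<mu> - snd \<mu> \<Longrightarrow> rep_act (weyl \<mu>) g \<phi> f = 0"
  by (simp add: weyl_def contravariant_dual_def dual_weyl_def)

lemma weyl_act_low:
  assumes "degree f \<le> fst \<mu> - snd \<mu>"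
  shows "rep_act (weyl \<mu>) (low t) (weyl_generator (fst \<mu> - snd \<mu>)) f = poly f t"
  using assms by (simp add: weyl_act_generator poly_altdef_le)

lemma weyl_act_up:
  "rep_act (weyl \<mu>) (up t) (weyl_generator (fst \<mu> - snd \<mu>)) = weyl_generator (fst \<mu> - snd \<mu>)"
proof
  fix f :: "'a poly"
  show "rep_act (weyl \<mu>) (up t) (weyl_generator (fst \<mu> - snd \<mu>)) f = weyl_generator (fst \<mu> - snd \<mu>) f"
    by (cases "degree f \<le> fst \<mu> - snd \<mu>")
       (simp_all add: weyl_act_generator weyl_act_outside weyl_generator_def power_0_left if_distrib cong: if_cong)
qed

lemma weyl_act_diag2:
  assumes "snd \<mu> \<le> fst \<mu>"
  shows "rep_act (weyl \<mu>) (diag2 s t) (weyl_generator (fst \<mu> - snd \<mu>)) =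
    (\<lambda>f. s ^ fst \<mu> * t ^ snd \<mu> * weyl_generator (fst \<mu> - snd \<mu>) f)"
proof
  fix f :: "'a poly"
  have "s ^ fst \<mu> = s ^ (fst \<mu> - snd \<mu>) * s ^ snd \<mu>" using assms by (simp flip: power_add)
  then show "rep_act (weyl \<mu>) (diag2 s t) (weyl_generator (fst \<mu> - snd \<mu>)) f =
     s ^ fst \<mu> * t ^ snd \<mu> * weyl_generator (fst \<mu> - snd \<mu>) f"
    by (cases "degree f \<le> fst \<mu> - snd \<mu>")
       (simp_all add: weyl_act_generator weyl_act_outside weyl_generator_def power_0_left diag2_mat2
          if_distrib power_mult_distrib cong: if_cong)
qed

lemma weyl_generator_in: "weyl_generator (fst \<mu> - snd \<mu>) \<in> rep_space (weyl \<mu>)"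
proof -
  have "degree (x + y) \<le> fst \<mu> - snd \<mu>" "degree (smult c x) \<le> fst \<mu> - snd \<mu>"
    if "degree x \<le> fst \<mu> - snd \<mu>" "degree y \<le> fst \<mu> - snd \<mu>" for x y :: "'a poly" and c
    using that degree_smult_le[of c x] by (auto intro: degree_add_le)
  thus ?thesis
    by (auto simp: weyl_def contravariant_dual_def dual_weyl_def linear_map_on_def weyl_generator_def)
qed

lemma weyl_eqI:
  assumes "\<phi> \<in> rep_space (weyl \<mu>)" "\<psi> \<in> rep_space (weyl \<mu>)"
    "\<And>j. j \<le> fst \<mu> - snd \<mu> \<Longrightarrow> \<phi> (monom 1 j) = \<psi> (monom 1 j)"
  shows "\<phi> = \<psi>"
proof
  fix f :: "'a poly"
  let ?n = "fst \<mu> - snd \<mu>"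
  have lin: "linear_map_on {f. degree f \<le> ?n} smult (*) \<phi>" "linear_map_on {f. degree f \<le> ?n} smult (*) \<psi>"
    using assms(1,2) by (auto simp: weyl_def contravariant_dual_def dual_weyl_def)
  have vs: "vector_space (smult :: 'a \<Rightarrow> _)" by unfold_locales (simp_all add: smult_add_right smult_add_left)
  interpret vector_space "smult :: 'a \<Rightarrow> _" by (fact vs)
  have sub: "subspace {f. degree f \<le> ?n}"
    by (auto simp: subspace_def intro: degree_add_le order_trans[OF degree_smult_le])
  show "\<phi> f = \<psi> f"
  proof (cases "degree f \<le> ?n")
    case True
    have f: "(\<Sum>i\<le>degree f. smult (coeff f i) (monom 1 i)) = f"
      using poly_as_sum_of_monoms[of f] by (simp add: smult_monom)
    have *: "\<theta> (\<Sum>i\<le>degree f. smult (coeff f i) (monom 1 i)) = (\<Sum>i\<le>degree f. coeff f i * \<theta> (monom 1 i))"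
      if "linear_map_on {f. degree f \<le> ?n} smult (*) \<theta>" for \<theta> :: "'a poly \<Rightarrow> 'a"
      by (rule linear_map_on_sum_scale[OF that vs sub]) (use True in \<open>auto simp: degree_monom_eq\<close>)
    have "\<phi> f = (\<Sum>i\<le>degree f. coeff f i * \<phi> (monom 1 i))" using *[OF lin(1)] by (simp only: f)
    also have "\<dots> = (\<Sum>i\<le>degree f. coeff f i * \<psi> (monom 1 i))"
      using True by (intro sum.cong refl arg_cong2[of _ _ _ _ "(*)"] assms(3)) auto
    also have "\<dots> = \<psi> f" using *[OF lin(2)] by (simp only: f)
    finally show ?thesis .
  next
    case False
    with assms(1,2) show ?thesis by (auto simp: weyl_def contravariant_dual_def dual_weyl_def)
  qed
qed

lemma linear_functional_coordinate:
  assumes "kg_hom M (weyl \<mu>) q"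
  shows "linear_map_on (rep_space M) (rep_scale M) (*) (\<lambda>v. q v f)"
  using assms by (auto simp: kg_hom_def linear_map_on_def weyl_def contravariant_dual_def)

lemma kg_homD:
  assumes "kg_hom M N f"
  shows "\<And>v. v \<in> rep_space M \<Longrightarrow> f v \<in> rep_space N"
    "linear_map_on (rep_space M) (rep_scale M) (rep_scale N) f"
    "\<And>g v. g \<in> GL2 \<Longrightarrow> v \<in> rep_space M \<Longrightarrow> f (rep_act M g v) = rep_act N g (f v)"
  using assms by (auto simp: kg_hom_def)

section \<open>Extending homomorphisms along a Weyl section\<close>

text \<open>
  Let \<open>x\<close> be a weight vector of \<open>B\<close> over the generator of the Weyl module \<open>B/A\<close>, and write \<open>z\<^sub>i\<close> for
  \<open>f\<^sup>i / i!\<close> applied to \<open>x\<close>, and \<open>y\<^sub>i\<close> for \<open>f\<^sup>i / i!\<close> applied to the prospective image \<open>n\<close>. The vectors \<open>z\<^sub>i\<close> with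
  \<open>i \<le> \<mu>\<^sub>1 - \<mu>\<^sub>2\<close> form a basis of \<open>B\<close> modulo \<open>A\<close>, so exactly one linear extension \<open>h\<close> of \<open>f\<close> sends these \<open>z\<^sub>i\<close> to
  \<open>y\<^sub>i\<close>. For it to be a homomorphism it must also send the other \<open>z\<^sub>i\<close>, which lie in \<open>A\<close>, to \<open>y\<^sub>i\<close>. The
  hypothesis on \<open>n\<close> makes the function \<open>h(g x) - g n\<close> of \<open>g\<close> semi-invariant under right multiplication by
  upper triangular matrices; being a polynomial in \<open>g\<close>, it has a bounded pole, which kills the terms in question.
\<close>
lemma extend_along_weyl_section:
  fixes M :: "('k::field, 'v::ab_group_add) rep" and N :: "('k, 'w::ab_group_add) rep"
  assumes inf: "infinite (UNIV :: 'k set)" and M: "poly_rep r M" and N: "poly_rep r N"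
    and \<mu>: "\<mu> \<in> two_part_partitions r"
    and A: "submodule A M" and B: "submodule B M" and AB: "A \<subseteq> B"
    and q: "kg_hom (M\<lparr>rep_space := B\<rparr>) (weyl \<mu>) q" and ker: "{v \<in> B. q v = 0} = A"
    and f: "kg_hom (M\<lparr>rep_space := A\<rparr>) N f"
    and x: "x \<in> weight_space M \<mu>" "x \<in> B" "q x = weyl_generator (fst \<mu> - snd \<mu>)"
    and n: "n \<in> weight_space N \<mu>" "\<And>t. rep_act N (up t) n - n = f (rep_act M (up t) x - x)"
  shows "\<exists>h. kg_hom (M\<lparr>rep_space := B\<rparr>) N h \<and> (\<forall>a\<in>A. h a = f a) \<and> h x = n"
proof -
  define d where "d = fst \<mu> - snd \<mu>"
  have \<mu>': "snd \<mu> \<le> fst \<mu>" "d \<le> r" "fst \<mu> = d + snd \<mu>" using \<mu> by (auto simp: two_part_partitions_def d_def)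
  interpret M: prep M r using M inf by (rule prepI)
  interpret N: prep N r using N inf by (rule prepI)
  have Bs: "M.vs.subspace B" "B \<subseteq> M.carr" "\<And>g b. g \<in> GL2 \<Longrightarrow> b \<in> B \<Longrightarrow> M.act g b \<in> B"
    using B by (auto simp: submodule_def)
  have As: "M.vs.subspace A" "\<And>g b. g \<in> GL2 \<Longrightarrow> b \<in> A \<Longrightarrow> M.act g b \<in> A"
    using A by (auto simp: submodule_def)
  note qD = kg_homD[OF q, simplified] and fD = kg_homD[OF f, simplified]
  have xc: "x \<in> M.carr" and nc: "n \<in> N.carr" using x(1) n(1) by (auto simp: weight_space_def)
  obtain z where z: "\<And>i. z i \<in> B" "\<And>t. M.act (low t) x = (\<Sum>i\<le>r. M.scal (t ^ i) (z i))"
    using M.low_curve[OF xc Bs(1)] Bs(3) x(2) by blast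
  obtain y where y: "\<And>i. y i \<in> N.carr" "\<And>t. N.act (low t) n = (\<Sum>i\<le>r. N.scal (t ^ i) (y i))"
    using N.low_curve[OF nc N.carr_subspace] nc by blast
  define L where "L j v = q v (monom 1 j)" for j v
  have L: "linear_map_on B M.scal (*) (L j)" for j
    unfolding L_def using linear_functional_coordinate[OF q] by simp
  note lB = M.vs.vector_space_axioms Bs(1)
  have Lz: "L j (z i) = (if i = j then 1 else 0)" if "i \<le> r" "j \<le> d" for i j
  proof (rule vector_space_over_itself.poly_curve_unique[OF inf _ that(1), where y = "\<lambda>i. L j (z i)"])
    fix t :: 'k
    have "(\<Sum>i\<le>r. t ^ i * L j (z i)) = L j (M.act (low t) x)"
      unfolding z(2) by (rule linear_map_on_sum_scale[OF L lB, symmetric]) (rule z(1))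
    also have "\<dots> = rep_act (weyl \<mu>) (low t) (q x) (monom 1 j)"
      by (simp add: L_def qD(3) x(2))
    also have "\<dots> = t ^ j"
      using that(2) unfolding x(3) d_def by (subst weyl_act_low) (auto simp: degree_monom_eq poly_monom)
    also have "\<dots> = (\<Sum>i\<le>r. t ^ i * (if i = j then 1 else 0))"
      using that(2) \<mu>'(2) by (simp add: if_distrib cong: if_cong)
    finally show "(\<Sum>i\<le>r. t ^ i * L j (z i)) = (\<Sum>i\<le>r. t ^ i * (if i = j then 1 else 0))" .
  qed
  have LA: "L j a = 0" if "a \<in> A" for a j using that ker by (auto simp: L_def)
  have kerL: "b \<in> A" if "b \<in> B" "\<And>j. j \<le> d \<Longrightarrow> L j b = 0" for b
  proof -
    have "q 0 = 0" using linear_map_on_zero[OF qD(2)] M.vs.subspace_0[OF Bs(1)]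
      by (simp add: zero_fun_def)
    moreover have "q b = q 0"
      using that M.vs.subspace_0[OF Bs(1)] \<open>q 0 = 0\<close> unfolding d_def L_def
      by (intro weyl_eqI[of _ \<mu>] qD(1)) auto
    ultimately show "b \<in> A" using that(1) ker by auto
  qed
  define pr where "pr b = b - (\<Sum>j\<le>d. M.scal (L j b) (z j))" for b
  have prA: "pr b \<in> A" if "b \<in> B" for b
  proof (rule kerL)
    have zB: "(\<Sum>j\<le>d. M.scal (L j b) (z j)) \<in> B"
      by (intro M.vs.subspace_sum M.vs.subspace_scale Bs z)
    thus "pr b \<in> B" unfolding pr_def using Bs that by (intro M.vs.subspace_diff)
    fix i assume i: "i \<le> d"
    have "L i (\<Sum>j\<le>d. M.scal (L j b) (z j)) = (\<Sum>j\<le>d. L j b * L i (z j))"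
      by (rule linear_map_on_sum_scale[OF L lB z(1)])
    also have "\<dots> = (\<Sum>j\<le>d. L j b * (if j = i then 1 else 0))"
      using i \<mu>'(2) by (intro sum.cong) (simp_all add: Lz)
    also have "\<dots> = L i b" using i by (simp add: if_distrib cong: if_cong)
    finally show "L i (pr b) = 0"
      unfolding pr_def using zB that by (subst linear_map_on_diff[OF L lB]) auto
  qed
  define h where "h b = f (pr b) + (\<Sum>j\<le>d. N.scal (L j b) (y j))" for b
  have hA: "h a = f a" if "a \<in> A" for a
    using that by (simp add: h_def pr_def LA)
  have hN: "h b \<in> N.carr" if "b \<in> B" for b
    unfolding h_def using fD(1)[OF prA[OF that]] y(1)
    by (intro N.vs.subspace_add N.vs.subspace_sum N.vs.subspace_scale N.carr_subspace)
  have h: "linear_map_on B M.scal N.scal h"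
    unfolding linear_map_on_def
  proof (intro conjI ballI allI)
    fix b b' assume b: "b \<in> B" "b' \<in> B"
    have "pr (b + b') = pr b + pr b'"
      by (simp add: pr_def linear_map_on_add[OF L b] M.vs.scale_left_distrib sum.distrib)
    thus "h (b + b') = h b + h b'"
      by (simp add: h_def linear_map_on_add[OF fD(2) prA[OF b(1)] prA[OF b(2)]]
          linear_map_on_add[OF L b] N.vs.scale_left_distrib sum.distrib)
  next
    fix c b assume b: "b \<in> B"
    have "pr (M.scal c b) = M.scal c (pr b)"
      by (simp add: pr_def linear_map_on_scale[OF L b] M.vs.scale_right_diff_distrib M.vs.scale_sum_right)
    thus "h (M.scal c b) = N.scal c (h b)"
      by (simp add: h_def linear_map_on_scale[OF fD(2) prA[OF b]]
          linear_map_on_scale[OF L b] N.vs.scale_right_distrib N.vs.scale_sum_right)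
  qed
  note hsum = linear_map_on_sum_scale[OF h lB]
  have hz: "h (z i) = y i" if i: "i \<le> d" for i
  proof -
    have Lz': "L j (z i) = (if i = j then 1 else 0)" if "j \<le> d" for j using Lz[of i j] i that \<mu>'(2) by simp
    have "(\<Sum>j\<le>d. M.scal (L j (z i)) (z j)) = (\<Sum>j\<le>d. if i = j then z j else 0)"
      by (intro sum.cong) (auto simp: Lz')
    moreover have "(\<Sum>j\<le>d. N.scal (L j (z i)) (y j)) = (\<Sum>j\<le>d. if i = j then y j else 0)"
      by (intro sum.cong) (auto simp: Lz')
    ultimately show ?thesis
      using i linear_map_on_zero[OF fD(2) M.vs.subspace_0[OF As(1)]] by (simp add: h_def pr_def)
  qed
  \<comment> \<open>On the big cell the defect \<open>h(g x) - g n\<close> is a character times its value at the lower unitriangular factor.\<close>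
  have defect: "h (M.act g x) - N.act g n =
      N.scal (s ^ fst \<mu> * s' ^ snd \<mu>) (h (M.act (low u) x) - N.act (low u) n)"
    if g: "g = low u ** (diag2 s s' ** up w)" and s: "s \<noteq> 0" "s' \<noteq> 0" for g u s s' w
  proof -
    define a where "a = M.act (up w) x - x"
    have "q a = 0"
      unfolding a_def using Bs x(2)
      by (subst linear_map_on_diff[OF qD(2)[simplified]])
         (auto simp: M.vs.vector_space_axioms qD(3) x(3) weyl_act_up)
    moreover have "a \<in> B" unfolding a_def using Bs x(2) by (intro M.vs.subspace_diff) auto
    ultimately have a: "a \<in> A" using ker by auto
    hence aM: "a \<in> M.carr" using \<open>a \<in> B\<close> Bs by auto
    let ?c = "s ^ fst \<mu> * s' ^ snd \<mu>"
    let ?ld = "low u ** diag2 s s'"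
    have g': "g = ?ld ** up w" by (simp add: g matrix_mul_assoc)
    have ld: "?ld \<in> GL2" using s by simp
    have "M.act g x = M.act ?ld (x + a)"
      using s xc by (simp add: g' M.act_mult a_def)
    also have "\<dots> = M.act ?ld x + M.act ?ld a"
      using ld xc aM by (intro linear_map_on_add[OF M.linear_act]) auto
    also have "M.act ?ld x = M.act (low u) (M.scal ?c x)"
      using s x(1) by (simp add: M.act_mult weight_space_def)
    also have "\<dots> = M.scal ?c (M.act (low u) x)"
      using xc by (intro linear_map_on_scale[OF M.linear_act]) auto
    finally have "h (M.act g x) = h (M.scal ?c (M.act (low u) x) + M.act ?ld a)" by simp
    also have "\<dots> = N.scal ?c (h (M.act (low u) x)) + h (M.act ?ld a)"
      using Bs x(2) \<open>a \<in> B\<close> ld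
      by (subst linear_map_on_add[OF h]) (auto simp: linear_map_on_scale[OF h] M.vs.subspace_scale)
    also have "h (M.act ?ld a) = N.act ?ld (f a)"
      using As(2)[OF ld a] by (simp add: hA fD(3) ld a)
    also have "f a = N.act (up w) n - n" using n(2) by (simp add: a_def)
    also have "N.act ?ld (N.act (up w) n - n) = N.act ?ld (N.act (up w) n) - N.act ?ld n"
      using nc by (intro linear_map_on_diff[OF N.linear_act[OF ld] N.vs.vector_space_axioms N.carr_subspace]) auto
    also have "N.act ?ld (N.act (up w) n) = N.act g n"
      using s nc by (simp add: g' N.act_mult)
    also have "N.act ?ld n = N.act (low u) (N.scal ?c n)"
      using s n(1) by (simp add: N.act_mult weight_space_def)
    also have "\<dots> = N.scal ?c (N.act (low u) n)"
      using nc by (intro linear_map_on_scale[OF N.linear_act]) auto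
    finally show ?thesis by (simp add: N.vs.scale_right_diff_distrib)
  qed
  have low_defect: "h (M.act (low u) x) - N.act (low u) n = (\<Sum>i\<le>r. N.scal (u ^ i) (h (z i) - y i))" for u
    by (simp add: z(2) y(2) hsum z(1) N.vs.scale_right_diff_distrib sum_subtractf)
  \<comment> \<open>The curve with first column \<open>(t, 1)\<close> meets the complement of the big cell at \<open>t = 0\<close>, so the
     defect is polynomial in \<open>t\<close> along it, while on the big cell it is expressed through \<open>1/t\<close>.\<close>
  obtain z' where z': "\<And>i. z' i \<in> B" "\<And>t. M.act (mat2 t 1 1 0) x = (\<Sum>i\<le>r. M.scal (t ^ i) (z' i))"
    using M.swap_curve[OF xc Bs(1)] Bs(3) x(2) by blast
  obtain y' where y': "\<And>i. y' i \<in> N.carr" "\<And>t. N.act (mat2 t 1 1 0) n = (\<Sum>i\<le>r. N.scal (t ^ i) (y' i))"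
    using N.swap_curve[OF nc N.carr_subspace] nc by blast
  have "h (z i) - y i = 0" if i: "d < i" "i \<le> r" for i
  proof (rule N.vs.poly_curve_pole_order[OF inf \<mu>'(2) _ _ i,
      where c = "(-1) ^ snd \<mu>" and y = "\<lambda>i. h (z' i) - y' i" and z = "\<lambda>i. h (z i) - y i"])
    fix t :: 'k assume t: "t \<noteq> 0"
    have "(\<Sum>j\<le>r. N.scal (t ^ j) (h (z' j) - y' j)) = h (M.act (mat2 t 1 1 0) x) - N.act (mat2 t 1 1 0) n"
      by (simp add: z'(2) y'(2) hsum z'(1) N.vs.scale_right_diff_distrib sum_subtractf)
    also have "\<dots> = N.scal (t ^ fst \<mu> * (- 1 / t) ^ snd \<mu>) (h (M.act (low (1 / t)) x) - N.act (low (1 / t)) n)"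
      by (rule defect[of _ _ _ _ "1 / t"]) (use t mat2_eq_low_diag_up[of t 1 1 0] in auto)
    also have "t ^ fst \<mu> * (- 1 / t) ^ snd \<mu> = (- 1) ^ snd \<mu> * t ^ d"
      using t power_mult_distrib[of t "- 1 / t" "snd \<mu>"] by (simp add: \<mu>'(3) power_add)
    finally show "(\<Sum>j\<le>r. N.scal (t ^ j) (h (z' j) - y' j)) =
       N.scal ((- 1) ^ snd \<mu> * t ^ d) (\<Sum>i\<le>r. N.scal ((1 / t) ^ i) (h (z i) - y i))"
      unfolding low_defect .
  qed auto
  with hz have hz': "h (z i) = y i" if "i \<le> r" for i using that by (cases "i \<le> d") auto
  hence low0: "h (M.act (low u) x) = N.act (low u) n" for u
    using low_defect[of u] by simp
  have hgz: "h (M.act g (z i)) = N.act g (y i)" if g: "g \<in> GL2" and i: "i \<le> r" for g i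
  proof (rule N.vs.poly_curve_unique[where S = "{t. g $ 1 $ 1 + g $ 1 $ 2 * t \<noteq> 0}" and d = r
        and y = "\<lambda>i. h (M.act g (z i))"])
    show "infinite {t. g $ 1 $ 1 + g $ 1 $ 2 * t \<noteq> 0}"
      using g by (intro infinite_affine_nonzero[OF inf]) (auto simp: GL2_iff det_2)
    fix t assume t: "t \<in> {t. g $ 1 $ 1 + g $ 1 $ 2 * t \<noteq> 0}"
    have "(\<Sum>j\<le>r. N.scal (t ^ j) (h (M.act g (z j)))) = h (M.act g (\<Sum>j\<le>r. M.scal (t ^ j) (z j)))"
      using g z(1) Bs
      by (subst linear_map_on_sum_scale[OF M.linear_act M.vs.vector_space_axioms M.carr_subspace])
         (auto simp: hsum)
    also have "\<dots> = h (M.act (g ** low t) x)" using g xc by (simp add: z(2)[symmetric] M.act_mult)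
    also have "\<dots> = N.act (g ** low t) n"
      using defect[OF GL2_mult_low[of g t]] t g by (simp add: GL2_iff low0)
    also have "\<dots> = N.act g (\<Sum>j\<le>r. N.scal (t ^ j) (y j))" using g nc by (simp add: y(2)[symmetric] N.act_mult)
    also have "\<dots> = (\<Sum>j\<le>r. N.scal (t ^ j) (N.act g (y j)))"
      using g y(1)
      by (intro linear_map_on_sum_scale[OF N.linear_act N.vs.vector_space_axioms N.carr_subspace]) auto
    finally show "(\<Sum>j\<le>r. N.scal (t ^ j) (h (M.act g (z j)))) = (\<Sum>j\<le>r. N.scal (t ^ j) (N.act g (y j)))" .
  qed (fact i)
  have equi: "h (M.act g b) = N.act g (h b)" if g: "g \<in> GL2" and b: "b \<in> B" for g b
  proof -
    let ?s = "\<Sum>j\<le>d. M.scal (L j b) (z j)" and ?s' = "\<Sum>j\<le>d. N.scal (L j b) (y j)"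
    have sB: "?s \<in> B" by (intro M.vs.subspace_sum M.vs.subspace_scale Bs z)
    have s'N: "?s' \<in> N.carr" by (intro N.vs.subspace_sum N.vs.subspace_scale N.carr_subspace y)
    have bb: "b = pr b + ?s" by (simp add: pr_def)
    have pb: "pr b \<in> A" "pr b \<in> B" using prA[OF b] AB by auto
    have "M.act g b = M.act g (pr b) + M.act g ?s"
      using g pb Bs(2) sB by (subst bb) (intro linear_map_on_add[OF M.linear_act], auto)
    also have "M.act g ?s = (\<Sum>j\<le>d. M.scal (L j b) (M.act g (z j)))"
      using g z(1) Bs(2)
      by (intro linear_map_on_sum_scale[OF M.linear_act M.vs.vector_space_axioms M.carr_subspace]) auto
    finally have "h (M.act g b) = h (M.act g (pr b)) + h (\<Sum>j\<le>d. M.scal (L j b) (M.act g (z j)))"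
      using g pb z(1) Bs by (simp add: linear_map_on_add[OF h] M.vs.subspace_sum M.vs.subspace_scale)
    also have "h (\<Sum>j\<le>d. M.scal (L j b) (M.act g (z j))) = (\<Sum>j\<le>d. N.scal (L j b) (N.act g (y j)))"
      using g z(1) Bs(3) \<mu>'(2) by (subst hsum) (auto simp: hgz)
    also have "\<dots> = N.act g ?s'"
      using g y(1) by (intro linear_map_on_sum_scale[OF N.linear_act N.vs.vector_space_axioms N.carr_subspace, symmetric]) auto
    also have "h (M.act g (pr b)) = N.act g (f (pr b))"
      using As(2)[OF g pb(1)] by (simp add: hA fD(3) g pb)
    also have "N.act g (f (pr b)) + N.act g ?s' = N.act g (h b)"
      unfolding h_def using g s'N fD(1)[OF pb(1)] by (intro linear_map_on_add[OF N.linear_act, symmetric]) auto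
    finally show ?thesis .
  qed
  have "h x = n"
    using low0[of 0] xc nc by (simp flip: mat_1_mat2)
  thus ?thesis using hN h equi hA by (intro exI[of _ h]) (auto simp: kg_hom_def)
qed

section \<open>Tensor powers\<close>

abbreviation tens :: "nat \<Rightarrow> ('k::field, 'k tensor) rep" where
  "tens r \<equiv> \<lparr>rep_space = tensor_power r, rep_scale = tensor_scale, rep_act = tensor_act\<rparr>"

lemma words_Suc: "{v :: 2 list. length v = Suc n} = (\<lambda>(b, v). b # v) ` (UNIV \<times> {v. length v = n})"
  by (auto simp: length_Suc_conv image_iff)

lemma tensor_act_Nil [simp]: "tensor_act g x [] = x []"
  by (simp add: tensor_act_def)

lemma tensor_act_Cons:
  "tensor_act g x (a # w) = (\<Sum>b\<in>UNIV. g $ a $ b * tensor_act g (\<lambda>v. x (b # v)) w)"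
proof -
  have inj: "inj_on (\<lambda>(b, v). b # v) (UNIV \<times> {v :: 2 list. length v = length w})" by (auto simp: inj_on_def)
  have "tensor_act g x (a # w) = (\<Sum>(b, v)\<in>UNIV \<times> {v. length v = length w}.
      (\<Prod>i<Suc (length w). g $ ((a # w) ! i) $ ((b # v) ! i)) * x (b # v))"
    unfolding tensor_act_def length_Cons words_Suc by (subst sum.reindex[OF inj]) (simp add: o_def case_prod_unfold)
  also have "\<dots> = (\<Sum>b\<in>UNIV. \<Sum>v | length v = length w. g $ a $ b * ((\<Prod>i<length w. g $ (w ! i) $ (v ! i)) * x (b # v)))"
    by (subst sum.cartesian_product[symmetric], simp only: prod.lessThan_Suc_shift) (simp add: mult.assoc)
  also have "\<dots> = (\<Sum>b\<in>UNIV. g $ a $ b * tensor_act g (\<lambda>v. x (b # v)) w)"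
    by (simp add: tensor_act_def sum_distrib_left)
  finally show ?thesis .
qed

lemma tensor_act_Cons_2:
  "tensor_act g x (a # w) =
     g $ a $ 1 * tensor_act g (\<lambda>v. x (1 # v)) w + g $ a $ 2 * tensor_act g (\<lambda>v. x (2 # v)) w"
  by (simp add: tensor_act_Cons sum_2)

lemma tensor_act_add: "tensor_act g (\<lambda>v. x v + y v) w = tensor_act g x w + tensor_act g y w"
  by (simp add: tensor_act_def ring_distribs sum.distrib)

lemma tensor_act_diff: "tensor_act g (\<lambda>v. x v - y v) w = tensor_act g x w - tensor_act g y w"
  by (simp add: tensor_act_def ring_distribs sum_subtractf)

lemma tensor_act_cmult: "tensor_act g (\<lambda>v. c * x v) w = c * tensor_act g x w"
  by (simp add: tensor_act_def sum_distrib_left mult.left_commute)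

lemma tensor_act_zero [simp]: "tensor_act g (\<lambda>v. 0) w = 0"
  by (simp add: tensor_act_def)

lemma tensor_act_mult: "tensor_act (g ** h) x w = tensor_act g (tensor_act h x) w"
proof (induction w arbitrary: x)
  case (Cons a w)
  show ?case
    by (simp add: tensor_act_Cons_2 Cons tensor_act_add tensor_act_cmult matrix_mult_nth algebra_simps)
qed simp

lemma tensor_act_one: "tensor_act (mat 1) x w = x w"
proof (induction w arbitrary: x)
  case (Cons a w)
  show ?case using exhaust_2[of a] Cons unfolding mat_1_mat2 by (auto simp: tensor_act_Cons_2)
qed simp

lemma tensor_act_in_tensor_power: "x \<in> tensor_power r \<Longrightarrow> tensor_act g x \<in> tensor_power r"
  by (auto simp: tensor_power_def tensor_act_def)

lemma vector_space_tensor: "vector_space (tensor_scale :: 'k::field \<Rightarrow> _)"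
  by unfold_locales (simp_all add: tensor_scale_def fun_eq_iff algebra_simps)

lemma subspace_tensor_power: "module.subspace tensor_scale (tensor_power r :: 'k::field tensor set)"
proof -
  interpret vector_space "tensor_scale :: 'k \<Rightarrow> _" by (rule vector_space_tensor)
  show ?thesis by (auto simp: subspace_def tensor_power_def tensor_scale_def)
qed

lemma sum_tensor_apply: "(\<Sum>i\<in>I. f i) w = (\<Sum>i\<in>I. f i w)" for f :: "_ \<Rightarrow> 'k::field tensor"
  by (induction I rule: infinite_finite_induct) auto

lemma kg_module_tens: "kg_module (tens r :: ('k::field, 'k tensor) rep)"
  unfolding kg_module_def
  using vector_space_tensor subspace_tensor_power tensor_act_in_tensor_power
  by (auto simp: linear_map_on_def fun_eq_iff tensor_act_mult tensor_act_one tensor_scale_def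
      tensor_act_cmult plus_fun_def tensor_act_add)

lemma matrix_monomial_entry:
  "g $ a $ b * matrix_monomial m g = matrix_monomial (m(a := (m a)(b := Suc (m a b)))) g"
  using exhaust_2[of a] exhaust_2[of b] by (auto simp: matrix_monomial_def UNIV_2 mult_ac)

lemma entry_exponents:
  "m \<in> exponents r \<Longrightarrow> m(a := (m a)(b := Suc (m a b))) \<in> exponents (Suc r)"
  using exhaust_2[of a] exhaust_2[of b] by (auto simp: exponents_def UNIV_2)

lemma tensor_act_polynomial:
  "\<exists>c. \<forall>g. tensor_act g x w = (\<Sum>m\<in>exponents (length w). matrix_monomial m g * c m)"
proof (induction w arbitrary: x)
  case Nil
  have "exponents 0 = {\<lambda>_ _. 0}" by (auto simp: exponents_def fun_eq_iff)
  then show ?case by (auto simp: matrix_monomial_def intro: exI[of _ "\<lambda>_. x []"])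
next
  case (Cons a w)
  let ?u = "\<lambda>b m. m(a := (m a)(b := Suc (m a b)))"
  have inj: "inj_on (?u b) (exponents (length w))" for b
    by (rule inj_onI) (metis (no_types, lifting) Suc_inject fun_upd_same fun_upd_triv fun_upd_upd)
  have *: "\<exists>c. \<forall>g. g $ a $ b * tensor_act g (\<lambda>v. x (b # v)) w = (\<Sum>m\<in>exponents (length (a # w)). matrix_monomial m g * c m)" for b
  proof -
    obtain c where c: "\<And>g. tensor_act g (\<lambda>v. x (b # v)) w = (\<Sum>m\<in>exponents (length w). matrix_monomial m g * c m)"
      using Cons by metis
    define c' where "c' m = (if m \<in> ?u b ` exponents (length w) then c (inv_into (exponents (length w)) (?u b) m) else 0)" for m
    have "g $ a $ b * tensor_act g (\<lambda>v. x (b # v)) w = (\<Sum>m\<in>exponents (length (a # w)). matrix_monomial m g * c' m)" for g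
    proof -
      have "g $ a $ b * tensor_act g (\<lambda>v. x (b # v)) w = (\<Sum>m\<in>exponents (length w). matrix_monomial (?u b m) g * c m)"
        by (simp add: c sum_distrib_left matrix_monomial_entry flip: mult.assoc)
      also have "\<dots> = (\<Sum>m\<in>?u b ` exponents (length w). matrix_monomial m g * c' m)"
        by (subst sum.reindex[OF inj]) (auto simp: c'_def inv_into_f_f[OF inj] intro!: sum.cong)
      also have "\<dots> = (\<Sum>m\<in>exponents (length (a # w)). matrix_monomial m g * c' m)"
        by (rule sum.mono_neutral_left) (auto simp: finite_exponents c'_def intro: entry_exponents)
      finally show ?thesis .
    qed
    thus ?thesis by blast
  qed
  obtain c1 c2 where "\<And>g. g $ a $ 1 * tensor_act g (\<lambda>v. x (1 # v)) w = (\<Sum>m\<in>exponents (length (a # w)). matrix_monomial m g * c1 m)"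
    "\<And>g. g $ a $ 2 * tensor_act g (\<lambda>v. x (2 # v)) w = (\<Sum>m\<in>exponents (length (a # w)). matrix_monomial m g * c2 m)"
    using *[of 1] *[of 2] by blast
  thus ?case
    by (intro exI[of _ "\<lambda>m. c1 m + c2 m"]) (simp add: tensor_act_Cons_2 sum.distrib ring_distribs)
qed

lemma poly_rep_tens: "poly_rep r (tens r :: ('k::field, 'k tensor) rep)"
  unfolding poly_rep_def
proof (intro conjI kg_module_tens ballI)
  fix x :: "'k tensor" assume x: "x \<in> rep_space (tens r)"
  obtain c where c: "\<And>w g. tensor_act g x w = (\<Sum>m\<in>exponents (length w). matrix_monomial m g * c w m)"
    using tensor_act_polynomial[of x] by metis
  have "tensor_act g x = (\<Sum>m\<in>exponents r. tensor_scale (matrix_monomial m g) (\<lambda>w. if length w = r then c w m else 0))" for g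
  proof
    fix w
    show "tensor_act g x w = (\<Sum>m\<in>exponents r. tensor_scale (matrix_monomial m g) (\<lambda>w. if length w = r then c w m else 0)) w"
      using tensor_act_in_tensor_power[of x r g] x
      by (cases "length w = r") (auto simp: sum_tensor_apply tensor_scale_def c tensor_power_def)
  qed
  thus "\<exists>c. \<forall>g\<in>GL2. rep_act (tens r) g x = (\<Sum>m\<in>exponents r. rep_scale (tens r) (matrix_monomial m g) (c m))"
    by (intro exI[of _ "\<lambda>m w. if length w = r then c w m else 0"]) simp
qed

section \<open>Divided powers on words\<close>

text \<open>
  The divided powers of the derivation that replaces the letter \<open>b\<close> by \<open>a\<close>, in coordinates: the value at a word sums
  the values at all words obtained by turning \<open>i\<close> of its letters \<open>a\<close> into \<open>b\<close>. The exponent is an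
  integer, with value \<open>0\<close> for negative exponents, so that the commutation formula below has no boundary cases.
\<close>
fun subst_op :: "2 \<Rightarrow> 2 \<Rightarrow> int \<Rightarrow> 'k::field tensor \<Rightarrow> 'k tensor" where
  "subst_op a b i x [] = (if i = 0 then x [] else 0)"
| "subst_op a b i x (c # w) = subst_op a b i (\<lambda>v. x (c # v)) w +
     (if c = a then subst_op a b (i - 1) (\<lambda>v. x (b # v)) w else 0)"

abbreviation eop :: "int \<Rightarrow> 'k::field tensor \<Rightarrow> 'k tensor" where "eop \<equiv> subst_op 1 2"
abbreviation fop :: "int \<Rightarrow> 'k::field tensor \<Rightarrow> 'k tensor" where "fop \<equiv> subst_op 2 1"

lemma subst_op_out_of_range: "i < 0 \<or> int (length w) < i \<Longrightarrow> subst_op a b i x w = 0"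
  by (induction w arbitrary: i x) auto

lemma subst_op_linear:
  "subst_op a b i (\<lambda>v. x v + y v) w = subst_op a b i x w + subst_op a b i y w"
  "subst_op a b i (\<lambda>v. x v - y v) w = subst_op a b i x w - subst_op a b i y w"
  "subst_op a b i (\<lambda>v. c * x v) w = c * subst_op a b i x w"
  "subst_op a b i (\<lambda>v. 0) w = 0"
  by (induction w arbitrary: i x y) (simp_all add: algebra_simps)

lemma subst_op_sum: "subst_op a b i (\<lambda>v. \<Sum>j\<in>J. x j v) w = (\<Sum>j\<in>J. subst_op a b i (x j) w)"
  by (induction J rule: infinite_finite_induct) (simp_all add: subst_op_linear)

lemma subst_op_zero [simp]: "subst_op a b 0 x w = x w"
  by (induction w arbitrary: x) (simp_all add: subst_op_out_of_range)

lemma subst_op_cong: "(\<And>v. length v = length w \<Longrightarrow> x v = y v) \<Longrightarrow> subst_op a b i x w = subst_op a b i y w"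
proof (induction w arbitrary: i x y)
  case (Cons c w)
  have "subst_op a b i (\<lambda>v. x (d # v)) w = subst_op a b i (\<lambda>v. y (d # v)) w" for d i
    by (rule Cons.IH) (simp add: Cons.prems)
  then show ?case by simp
qed simp

lemma tensor_act_unipotent:
  assumes g: "a \<noteq> b" "g $ a $ a = 1" "g $ a $ b = t" "g $ b $ a = 0" "g $ b $ b = 1"
  shows "tensor_act g x w = (\<Sum>i\<le>length w. t ^ i * subst_op a b (int i) x w)"
proof (induction w arbitrary: x)
  case (Cons c w)
  have "(\<Sum>i\<le>Suc (length w). t ^ i * subst_op a b (int i - 1) (\<lambda>v. x (b # v)) w) =
      t * tensor_act g (\<lambda>v. x (b # v)) w"
    by (subst sum.atMost_Suc_shift) (simp add: subst_op_out_of_range Cons sum_distrib_left mult.assoc)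
  moreover have "(\<Sum>i\<le>Suc (length w). t ^ i * subst_op a b (int i) (\<lambda>v. x (c # v)) w) =
      tensor_act g (\<lambda>v. x (c # v)) w"
    by (simp add: subst_op_out_of_range Cons)
  moreover have "a = 1 \<and> b = 2 \<or> a = 2 \<and> b = 1" using exhaust_2[of a] exhaust_2[of b] g(1) by auto
  ultimately show ?case
    using exhaust_2[of c] g
    by (elim disjE conjE; simp add: tensor_act_Cons_2 ring_distribs sum.distrib del: sum.atMost_Suc)
qed simp

lemma tensor_act_up: "tensor_act (up t) x w = (\<Sum>i\<le>length w. t ^ i * eop (int i) x w)"
  by (rule tensor_act_unipotent) simp_all

lemma tensor_act_low: "tensor_act (low t) x w = (\<Sum>i\<le>length w. t ^ i * fop (int i) x w)"
  by (rule tensor_act_unipotent) simp_all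

lemma subst_op_compose:
  assumes "a \<noteq> b"
  shows "subst_op a b (int i) (subst_op a b (int j) x) w = of_nat ((i + j) choose i) * subst_op a b (int (i + j)) x w"
proof (induction w arbitrary: i j x)
  case (Cons c w)
  consider "c \<noteq> a" | "c = a" "i = 0" | i' where "c = a" "i = Suc i'" "j = 0" | i' j' where "c = a" "i = Suc i'" "j = Suc j'"
    by (metis not0_implies_Suc)
  then show ?case
  proof cases
    case 1
    then show ?thesis using Cons[of i j "\<lambda>v. x (c # v)"] by simp
  next
    case 4
    have "subst_op a b (int i) (subst_op a b (int j) x) (c # w) =
       subst_op a b (int i) (subst_op a b (int j) (\<lambda>v. x (c # v))) w
       + subst_op a b (int i) (subst_op a b (int j') (\<lambda>v. x (b # v))) w
       + subst_op a b (int i') (subst_op a b (int j) (\<lambda>v. x (b # v))) w"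
      using 4 assms by (simp add: subst_op_linear)
    also have "\<dots> = of_nat ((i + j) choose i) * subst_op a b (int (i + j)) (\<lambda>v. x (c # v)) w
       + of_nat (((i + j') choose i) + ((i' + j) choose i')) * subst_op a b (int (i + j')) (\<lambda>v. x (b # v)) w"
      using 4 unfolding Cons by (simp add: algebra_simps)
    also have "((i + j') choose i) + ((i' + j) choose i') = (i + j) choose i" using 4 by simp
    finally show ?thesis using 4 by (simp add: algebra_simps)
  qed (auto simp: Cons subst_op_linear subst_op_out_of_range)
qed simp

text \<open>
  For tensors of fixed degree the weight \<open>(\<mu>\<^sub>1, \<mu>\<^sub>2)\<close> is determined by the difference \<open>\<mu>\<^sub>1 - \<mu>\<^sub>2\<close>, the weight for
  \<open>SL\<^sub>2\<close>. As an integer it changes by one, without side conditions, when a tensor factor is split off.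
\<close>

definition excess :: "2 list \<Rightarrow> int" where
  "excess w = int (count_list w 1) - int (count_list w 2)"

lemma excess_simps [simp]: "excess [] = 0" "excess (1 # w) = excess w + 1" "excess (2 # w) = excess w - 1"
  by (simp_all add: excess_def)

definition has_excess :: "int \<Rightarrow> 'k::field tensor \<Rightarrow> bool" where
  "has_excess m x \<longleftrightarrow> (\<forall>w. x w \<noteq> 0 \<longrightarrow> excess w = m)"

lemma has_excess_slice:
  assumes "has_excess m x"
  shows "has_excess (m - 1) (\<lambda>v. x (1 # v))" "has_excess (m + 1) (\<lambda>v. x (2 # v))"
proof -
  have "x (a # v) \<noteq> 0 \<Longrightarrow> excess (a # v) = m" for a v using assms by (simp add: has_excess_def)
  from this[of 1] this[of 2] show "has_excess (m - 1) (\<lambda>v. x (1 # v))" "has_excess (m + 1) (\<lambda>v. x (2 # v))"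
    by (force simp: has_excess_def)+
qed

text \<open>
  The binomial coefficient with an arbitrary integer as upper index, with integer values, so that it can be mapped to
  fields of positive characteristic.
\<close>
definition int_binomial :: "int \<Rightarrow> nat \<Rightarrow> int" where
  "int_binomial M k = (if M \<ge> 0 then int (nat M choose k) else (-1) ^ k * int (nat (int k - M - 1) choose k))"

lemma int_binomial_0 [simp]: "int_binomial M 0 = 1"
  by (simp add: int_binomial_def)

lemma int_binomial_Suc: "int_binomial (M + 1) (Suc k) = int_binomial M (Suc k) + int_binomial M k"
proof -
  consider "M \<ge> 0" | "M = -1" | "M < -1" by linarith
  then show ?thesis
  proof cases
    case 1
    then have "nat (M + 1) = Suc (nat M)" by simp
    with 1 show ?thesis by (simp add: int_binomial_def)
  next
    case 2
    then show ?thesis by (simp add: int_binomial_def nat_add_distrib)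
  next
    case 3
    define m where "m = nat (int k - M - 2)"
    have "nat (int (Suc k) - (M + 1) - 1) = m + 1 - 0" "nat (int (Suc k) - M - 1) = Suc (Suc m)" "nat (int k - M - 1) = Suc m"
      using 3 by (auto simp: m_def)
    with 3 show ?thesis by (simp add: int_binomial_def algebra_simps)
  qed
qed

lemma int_binomial_sum_Suc:
  fixes G :: "nat \<Rightarrow> 'k::field"
  assumes "G (Suc N) = 0"
  shows "(\<Sum>k\<le>N. of_int (int_binomial (M + 1) k) * G k) =
    (\<Sum>k\<le>N. of_int (int_binomial M k) * G k) + (\<Sum>k\<le>N. of_int (int_binomial M k) * G (Suc k))"
proof -
  have "(\<Sum>k\<le>N. of_int (int_binomial (M + 1) k) * G k) + of_int (int_binomial M N) * G (Suc N) =
    (\<Sum>k\<le>N. of_int (int_binomial M k) * G k) + (\<Sum>k\<le>N. of_int (int_binomial M k) * G (Suc k))"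
  proof (induction N)
    case (Suc N)
    then show ?case unfolding sum.atMost_Suc int_binomial_Suc by (simp add: algebra_simps)
  qed simp
  with assms show ?thesis by simp
qed

text \<open>
  Kostant's commutation formula for the divided powers of \<open>e\<close> and \<open>f\<close> on a vector of weight \<open>m\<close>. Splitting off the first
  letter of the word turns it into Pascal's rule.
\<close>
lemma eop_fop_commute:
  assumes "has_excess m x" "i \<le> int N"
  shows "eop i (fop j x) w =
     (\<Sum>k\<le>N. of_int (int_binomial (m + i - j) k) * fop (j - int k) (eop (i - int k) x) w)"
  using assms
proof (induction w arbitrary: m i j x)
  case Nil
  show ?case
  proof (cases "x [] = 0 \<or> i \<noteq> j")
    case True
    have "fop (j - int k) (eop (i - int k) x) [] = 0" for k using True by auto
    moreover have "eop i (fop j x) [] = 0" using True by auto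
    ultimately show ?thesis by (metis (no_types, lifting) mult_zero_right sum.neutral)
  next
    case False
    hence m: "m = 0" "i = j" using Nil by (auto simp: has_excess_def)
    have "of_int (int_binomial (m + i - j) k) * fop (j - int k) (eop (i - int k) x) [] = (if k = 0 then if i = 0 then x [] else 0 else 0)"
      if "k \<le> N" for k
      using that m by (cases k) (auto simp: int_binomial_def)
    hence "(\<Sum>k\<le>N. of_int (int_binomial (m + i - j) k) * fop (j - int k) (eop (i - int k) x) []) =
        (\<Sum>k\<le>N. if k = 0 then if i = 0 then x [] else 0 else 0)"
      by (intro sum.cong) auto
    then show ?thesis using m by simp
  qed
next
  case (Cons c w)
  define M where "M = m + i - j"
  let ?x1 = "\<lambda>v. x (1 # v)" and ?x2 = "\<lambda>v. x (2 # v)"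
  note ex = has_excess_slice[OF Cons.prems(1)]
  have e: "int_binomial (m + 1 + i - j) = int_binomial (M + 1)" "int_binomial (m - 1 + i - (j - 1)) = int_binomial M"
    "int_binomial (m - 1 + i - j) = int_binomial (M - 1)" "int_binomial (m + 1 + (i - 1) - j) = int_binomial M"
    "int_binomial (m - 1 + (i - 1) - (j - 1)) = int_binomial (M - 1)" "m + i - j = M"
    by (simp_all add: M_def algebra_simps)
  let ?b = "\<lambda>M k. of_int (int_binomial M k) :: 'a"
  consider "c = 1" | "c = 2" using exhaust_2[of c] by blast
  then show ?case
  proof cases
    case 1
    define G where "G k = fop (j - int k) (eop (i - int k) ?x1) w" for k
    have G: "G (Suc N) = 0"
      using Cons.prems(2) by (simp add: G_def subst_op_out_of_range subst_op_linear cong: subst_op_cong)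
    have "eop i (fop j x) (c # w) = eop i (fop j ?x1) w + eop (i - 1) (fop j ?x2) w + eop (i - 1) (fop (j - 1) ?x1) w"
      by (simp add: 1 subst_op_linear)
    also have "\<dots> = (\<Sum>k\<le>N. ?b (M - 1) k * G k) + (\<Sum>k\<le>N. ?b M k * fop (j - int k) (eop (i - 1 - int k) ?x2) w)
        + (\<Sum>k\<le>N. ?b (M - 1) k * G (Suc k))"
      using Cons.prems(2) Cons.IH[OF ex(1), of i j] Cons.IH[OF ex(2), of "i - 1" j] Cons.IH[OF ex(1), of "i - 1" "j - 1"]
      unfolding e G_def by (simp add: diff_diff_eq)
    also have "\<dots> = (\<Sum>k\<le>N. ?b M k * G k) + (\<Sum>k\<le>N. ?b M k * fop (j - int k) (eop (i - 1 - int k) ?x2) w)"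
      using int_binomial_sum_Suc[of G N "M - 1"] G by simp
    also have "\<dots> = (\<Sum>k\<le>N. ?b M k * fop (j - int k) (eop (i - int k) x) (c # w))"
      by (simp add: 1 G_def subst_op_linear sum.distrib ring_distribs algebra_simps)
    finally show ?thesis unfolding e .
  next
    case 2
    define G where "G k = fop (j - int k) (eop (i - int k) ?x2) w" for k
    have G: "G (Suc N) = 0"
      using Cons.prems(2) by (simp add: G_def subst_op_out_of_range subst_op_linear cong: subst_op_cong)
    have "eop i (fop j x) (c # w) = eop i (fop j ?x2) w + eop i (fop (j - 1) ?x1) w"
      by (simp add: 2 subst_op_linear)
    also have "\<dots> = (\<Sum>k\<le>N. ?b (M + 1) k * G k) + (\<Sum>k\<le>N. ?b M k * fop (j - 1 - int k) (eop (i - int k) ?x1) w)"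
      using Cons.prems(2) Cons.IH[OF ex(2), of i j] Cons.IH[OF ex(1), of i "j - 1"]
      unfolding e G_def by simp
    also have "\<dots> = (\<Sum>k\<le>N. ?b M k * G k) + (\<Sum>k\<le>N. ?b M k * G (Suc k))
        + (\<Sum>k\<le>N. ?b M k * fop (j - 1 - int k) (eop (i - int k) ?x1) w)"
      using int_binomial_sum_Suc[of G N "M"] G by simp
    also have "\<dots> = (\<Sum>k\<le>N. ?b M k * fop (j - int k) (eop (i - int k) x) (c # w))"
      by (simp add: 2 G_def subst_op_linear sum.distrib ring_distribs algebra_simps)
    finally show ?thesis unfolding e .
  qed
qed

section \<open>Cocycles of the Borel subgroup in tensor powers\<close>

text \<open>
  The \<open>n\<close>-th difference of a polynomial function of degree \<open>d < n\<close>.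
\<close>
lemma alternating_binomial_sum:
  "d < n \<Longrightarrow> (\<Sum>j\<le>n. (-1) ^ j * int (n choose j) * int ((q + j) choose d)) = 0"
proof (induction n arbitrary: q d)
  case (Suc n)
  let ?S = "\<lambda>q d. \<Sum>j\<le>n. (-1) ^ j * int (n choose j) * int ((q + j) choose d)"
  have "(\<Sum>j\<le>Suc n. (-1) ^ j * int (Suc n choose j) * int ((q + j) choose d)) =
      ?S q d - ?S (Suc q) d"
  proof -
    have "(\<Sum>j\<le>Suc n. (-1) ^ j * int (Suc n choose j) * int ((q + j) choose d)) =
       int (q choose d) + (\<Sum>j\<le>n. (-1) ^ Suc j * int (Suc n choose Suc j) * int ((q + Suc j) choose d))"
      by (subst sum.atMost_Suc_shift) simp
    also have "(\<Sum>j\<le>n. (-1) ^ Suc j * int (Suc n choose Suc j) * int ((q + Suc j) choose d)) =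
       (\<Sum>j\<le>n. (-1) ^ Suc j * int (n choose Suc j) * int ((q + Suc j) choose d)) - ?S (Suc q) d"
      by (simp add: algebra_simps sum.distrib sum_negf sum_subtractf)
    also have "int (q choose d) + ((\<Sum>j\<le>n. (-1) ^ Suc j * int (n choose Suc j) * int ((q + Suc j) choose d)) - ?S (Suc q) d)
      = (\<Sum>j\<le>Suc n. (-1) ^ j * int (n choose j) * int ((q + j) choose d)) - ?S (Suc q) d"
      unfolding sum.atMost_Suc_shift[of _ n] by simp
    finally show ?thesis by simp
  qed
  also have "\<dots> = 0"
  proof (cases d)
    case (Suc d')
    have "?S (Suc q) d - ?S q d = ?S q d'"
      unfolding Suc by (simp add: algebra_simps sum.distrib flip: sum_subtractf)
    moreover have "?S q d' = 0" using Suc.prems Suc by (intro Suc.IH) simp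
    ultimately show ?thesis by simp
  qed simp
  finally show ?case .
qed simp

text \<open>
  The coefficients of a polynomial cocycle \<open>c(s + t) = c(s) + u(s) c(t)\<close> of the upper unitriangular matrices, of
  weight \<open>m\<close> for the torus: \<open>c\<^sub>j\<close> behaves like \<open>e\<^sup>j / j!\<close> applied to a vector of weight \<open>m\<close>, except that this vector need
  not exist. It exists exactly if the cocycle is a coboundary.
\<close>

definition eop_cocycle :: "int \<Rightarrow> nat \<Rightarrow> (nat \<Rightarrow> 'k::field tensor) \<Rightarrow> bool" where
  "eop_cocycle m r c \<longleftrightarrow> (\<forall>j\<ge>1. c j \<in> tensor_power r \<and> has_excess (m + 2 * int j) (c j) \<and>
     (\<forall>i w. eop (int i) (c j) w = of_nat ((i + j) choose i) * c (i + j) w))"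

lemma excess_bounds: "\<bar>excess w\<bar> \<le> int (length w)"
proof (induction w)
  case (Cons a w)
  then show ?case using exhaust_2[of a] by auto
qed simp

lemma has_excess_subst_op:
  assumes "has_excess m x"
  shows "has_excess (m + 2 * i) (eop i x)" "has_excess (m - 2 * i) (fop i x)"
proof -
  have "(eop i x w \<noteq> 0 \<longrightarrow> excess w = m + 2 * i) \<and> (fop i x w \<noteq> 0 \<longrightarrow> excess w = m - 2 * i)" for w
    using assms
  proof (induction w arbitrary: m x i)
    case Nil
    then show ?case by (auto simp: has_excess_def)
  next
    case (Cons a w)
    let ?x1 = "\<lambda>v. x (1 # v)" and ?x2 = "\<lambda>v. x (2 # v)"
    note s = has_excess_slice[OF Cons.prems]
    have IH: "eop i ?x1 w = 0 \<or> excess w = m - 1 + 2 * i" "eop i ?x2 w = 0 \<or> excess w = m + 1 + 2 * i"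
      "eop (i - 1) ?x2 w = 0 \<or> excess w = m + 1 + 2 * (i - 1)"
      "fop i ?x1 w = 0 \<or> excess w = m - 1 - 2 * i" "fop i ?x2 w = 0 \<or> excess w = m + 1 - 2 * i"
      "fop (i - 1) ?x1 w = 0 \<or> excess w = m - 1 - 2 * (i - 1)"
      using Cons.IH[OF s(1), of i] Cons.IH[OF s(2), of i] Cons.IH[OF s(2), of "i - 1"] Cons.IH[OF s(1), of "i - 1"]
      by blast+
    consider "a = 1" | "a = 2" using exhaust_2[of a] by blast
    then show ?case
    proof cases
      case 1
      have "eop i ?x1 w + eop (i - 1) ?x2 w = 0 \<or> excess w = m - 1 + 2 * i" using IH(1,3) by fastforce
      with IH(4) 1 show ?thesis by auto
    next
      case 2
      have "fop i ?x2 w + fop (i - 1) ?x1 w = 0 \<or> excess w = m + 1 - 2 * i" using IH(5,6) by fastforce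
      with IH(2) 2 show ?thesis by auto
    qed
  qed
  thus "has_excess (m + 2 * i) (eop i x)" "has_excess (m - 2 * i) (fop i x)"
    by (auto simp: has_excess_def)
qed

lemma subst_op_in_tensor_power: "x \<in> tensor_power r \<Longrightarrow> subst_op a b i x \<in> tensor_power r"
proof -
  assume x: "x \<in> tensor_power r"
  have "subst_op a b i x w = 0" if "length w \<noteq> r" for w
    using subst_op_cong[of w x "\<lambda>_. 0" a b i] x that by (simp add: tensor_power_def subst_op_linear)
  thus ?thesis by (simp add: tensor_power_def)
qed

text \<open>
  On vectors of weight \<open>-1\<close> the alternating sum over \<open>j \<ge> 0\<close> of the products of the divided powers of exponent \<open>j\<close> of \<open>f\<close> and \<open>e\<close> is zero.
  If \<open>c\<^sub>j\<close> comes from a vector \<open>n\<close>, this recovers \<open>n\<close> from the \<open>c\<^sub>j\<close> with \<open>j \<ge> 1\<close>. The same formula defines \<open>n\<close> in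
  general, and the commutation formula confirms it by an alternating binomial sum. It reflects the vanishing of
  the cohomology of the line bundle of degree \<open>-1\<close> on the projective line.
\<close>
lemma eop_cocycle_singular:
  assumes c: "eop_cocycle (-1) r c"
  shows "\<exists>n. n \<in> tensor_power r \<and> has_excess (-1) n \<and> (\<forall>i\<ge>1. \<forall>w. eop (int i) n w = c i w)"
proof -
  define n where "n w = - (\<Sum>j=1..r. (-1) ^ j * fop (int j) (c j) w)" for w
  have cD: "c j \<in> tensor_power r" "has_excess (2 * int j - 1) (c j)"
    "eop (int i) (c j) w = of_nat ((i + j) choose i) * c (i + j) w" if "j \<ge> 1" for i j w
    using c that by (auto simp: eop_cocycle_def)
  have "excess w = -1" if "n w \<noteq> 0" for w
  proof -
    have "\<exists>j\<in>{1..r}. fop (int j) (c j) w \<noteq> 0"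
    proof (rule ccontr)
      assume "\<not> (\<exists>j\<in>{1..r}. fop (int j) (c j) w \<noteq> 0)"
      hence "n w = 0" unfolding n_def by simp
      with that show False by simp
    qed
    then obtain j where j: "j \<ge> 1" "fop (int j) (c j) w \<noteq> 0" by auto
    from has_excess_subst_op(2)[OF cD(2)[OF j(1)], of "int j"] j(2) have "excess w = 2 * int j - 1 - 2 * int j"
      unfolding has_excess_def by blast
    thus ?thesis by simp
  qed
  moreover have "n w = 0" if "length w \<noteq> r" for w
  proof -
    have "fop (int j) (c j) w = 0" if "j \<in> {1..r}" for j
      using subst_op_in_tensor_power[OF cD(1)[of j], of 2 1 "int j"] that \<open>length w \<noteq> r\<close> by (auto simp: tensor_power_def)
    thus ?thesis by (simp add: n_def)
  qed
  moreover have "eop (int i) n w = c i w" if i: "i \<ge> 1" for i w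
  proof (cases "length w = r")
    case False
    moreover have "n \<in> tensor_power r" by (simp add: tensor_power_def \<open>\<And>w. length w \<noteq> r \<Longrightarrow> n w = 0\<close>)
    ultimately show ?thesis using cD(1)[OF i] subst_op_in_tensor_power[of n r 1 2 "int i"]
      by (auto simp: tensor_power_def)
  next
    case True
    have c0: "c j v = 0" if "r < j" "length v = r" for j v
    proof (rule ccontr)
      assume "c j v \<noteq> 0"
      hence "excess v = 2 * int j - 1" using cD(2)[of j] that by (simp add: has_excess_def)
      thus False using excess_bounds[of v] that by simp
    qed
    let ?u = "\<lambda>j a. of_int (int ((i + j - 1) choose (j - a)) * int ((i + a) choose j)) :: 'a"
    define g where "g a = fop (int a) (c (i + a)) w" for a
    \<comment> \<open>Commute \<open>e\<close> past \<open>f\<close> and apply the cocycle relation; only the tensors \<open>c (i + a)\<close> survive.\<close>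
    have step: "eop (int i) (fop (int j) (c j)) w = (\<Sum>a\<le>r. if a \<le> j then ?u j a * g a else 0)"
      if j: "j \<in> {1..r}" for j
    proof -
      let ?t = "\<lambda>k. of_int (int_binomial (2 * int j - 1 + int i - int j) k) * fop (int j - int k) (eop (int i - int k) (c j)) w"
      have "eop (int i) (fop (int j) (c j)) w = (\<Sum>k\<le>i + j. ?t k)"
        by (rule eop_fop_commute[OF cD(2)]) (use j in auto)
      also have "\<dots> = (\<Sum>k\<le>j. ?t k)"
        by (rule sum.mono_neutral_right) (auto simp: subst_op_out_of_range)
      also have "\<dots> = (\<Sum>k\<le>j. of_int (int ((i + j - 1) choose k) * int ((i + (j - k)) choose j)) * g (j - k))"
      proof (rule sum.cong[OF refl])
        fix k assume k: "k \<in> {..j}"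
        have b: "int_binomial (2 * int j - 1 + int i - int j) k = int ((i + j - 1) choose k)"
        proof -
          have "2 * int j - 1 + int i - int j = int (i + j - 1)" using i j by (simp add: of_nat_diff)
          moreover have "int_binomial (int l) k = int (l choose k)" for l by (simp add: int_binomial_def)
          ultimately show ?thesis by (simp only:)
        qed
        show "?t k = of_int (int ((i + j - 1) choose k) * int ((i + (j - k)) choose j)) * g (j - k)"
        proof (cases "k \<le> i")
          case True
          have "eop (int i - int k) (c j) = (\<lambda>w. of_nat ((i + (j - k)) choose j) * c (i + (j - k)) w)"
          proof
            fix w
            have "i - k + j choose (i - k) = (i + (j - k)) choose j"
              using True k binomial_symmetric[of j "i - k + j"] by simp
            then show "eop (int i - int k) (c j) w = of_nat ((i + (j - k)) choose j) * c (i + (j - k)) w"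
              using cD(3)[of j "i - k" w] True j k by (simp add: of_nat_diff)
          qed
          thus ?thesis using k unfolding b g_def by (simp add: subst_op_linear of_nat_diff)
        next
          case False
          then have "eop (int i - int k) (c j) = (\<lambda>w. 0)" by (auto simp: subst_op_out_of_range)
          moreover have b0: "(i + (j - k)) choose j = 0" by (rule binomial_eq_0) (use False k in auto)
          ultimately show ?thesis unfolding b0 by (simp add: subst_op_linear)
        qed
      qed
      also have "\<dots> = (\<Sum>a\<le>j. ?u j a * g a)"
        by (rule sum.reindex_bij_witness[of _ "\<lambda>a. j - a" "\<lambda>k. j - k"]) auto
      also have "\<dots> = (\<Sum>a\<le>r. if a \<le> j then ?u j a * g a else 0)"
        using j by (intro sum.mono_neutral_cong_left) auto
      finally show ?thesis .
    qed
    \<comment> \<open>The coefficient of \<open>g a\<close>. The sum from \<open>j = 0\<close> is a difference of too high order, so it is zero;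
       the missing term \<open>j = 0\<close> contributes only for \<open>a = 0\<close>.\<close>
    have id: "(\<Sum>j=1..r. (-1) ^ j * (if a \<le> j then ?u j a else 0)) = (if a = 0 then -1 else 0)"
      if a: "i + a \<le> r" for a
    proof -
      let ?v = "\<lambda>j. (-1) ^ j * int ((i + a) choose j) * int ((i - 1 + j) choose (i + a - 1))"
      have "(\<Sum>j\<le>i + a. ?v j) = 0"
        by (rule alternating_binomial_sum) (use i in simp)
      also have "(\<Sum>j\<le>i + a. ?v j) = ?v 0 + (\<Sum>j=1..i + a. ?v j)"
        unfolding atMost_atLeast0 by (subst sum.atLeast_Suc_atMost) (simp_all only: One_nat_def le0)
      also have "(\<Sum>j=1..i + a. ?v j) = (\<Sum>j=1..r. ?v j)"
        using a by (intro sum.mono_neutral_left) auto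
      also have "(\<Sum>j=1..r. ?v j) = (\<Sum>j=1..r. (-1) ^ j * (if a \<le> j then int ((i + j - 1) choose (j - a)) * int ((i + a) choose j) else 0))"
      proof (rule sum.cong[OF refl])
        fix j assume "j \<in> {1..r}"
        show "?v j = (-1) ^ j * (if a \<le> j then int ((i + j - 1) choose (j - a)) * int ((i + a) choose j) else 0)"
        proof (cases "a \<le> j")
          case True
          have "(i - 1 + j) choose (i + a - 1) = (i + j - 1) choose (j - a)"
            using i True binomial_symmetric[of "i + a - 1" "i + j - 1"] by (simp add: add.commute)
          then show ?thesis using True by simp
        qed (use i in auto)
      qed
      finally have "of_int (?v 0 + (\<Sum>j=1..r. (-1) ^ j * (if a \<le> j then int ((i + j - 1) choose (j - a)) * int ((i + a) choose j) else 0))) = (0::'a)"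
        by simp
      moreover have "(\<Sum>j=1..r. (-1) ^ j * (if a \<le> j then ?u j a else 0)) =
          of_int (\<Sum>j=1..r. (-1) ^ j * (if a \<le> j then int ((i + j - 1) choose (j - a)) * int ((i + a) choose j) else 0))"
        unfolding of_int_sum by (intro sum.cong refl) simp
      ultimately have "(\<Sum>j=1..r. (-1) ^ j * (if a \<le> j then ?u j a else 0)) = - of_int (?v 0)"
        by (simp only: of_int_add) (simp only: eq_neg_iff_add_eq_0 add.commute)
      also have "?v 0 = (if a = 0 then 1 else 0)" using i by (cases "a = 0") auto
      finally show ?thesis by simp
    qed
    have "eop (int i) n w = - (\<Sum>j=1..r. (-1) ^ j * eop (int i) (fop (int j) (c j)) w)"
      unfolding n_def
      using subst_op_linear(3)[of 1 2 "int i" "-1" "\<lambda>w. \<Sum>j=1..r. (-1) ^ j * fop (int j) (c j) w" w]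
      by (simp add: subst_op_sum subst_op_linear)
    also have "\<dots> = - (\<Sum>j=1..r. \<Sum>a\<le>r. (-1) ^ j * (if a \<le> j then ?u j a else 0) * g a)"
    proof (intro arg_cong[of _ _ uminus] sum.cong refl)
      fix j assume "j \<in> {1..r}"
      show "(-1) ^ j * eop (int i) (fop (int j) (c j)) w = (\<Sum>a\<le>r. (-1) ^ j * (if a \<le> j then ?u j a else 0) * g a)"
        unfolding step[OF \<open>j \<in> {1..r}\<close>] sum_distrib_left by (intro sum.cong refl) simp
    qed
    also have "\<dots> = - (\<Sum>a\<le>r. (\<Sum>j=1..r. (-1) ^ j * (if a \<le> j then ?u j a else 0)) * g a)"
      by (subst sum.swap) (simp add: sum_distrib_right)
    also have "\<dots> = - (\<Sum>a\<le>r. (if a = 0 then - c i w else 0))"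
    proof (intro arg_cong[of _ _ uminus] sum.cong refl)
      fix a assume "a \<in> {..r}"
      show "(\<Sum>j=1..r. (-1) ^ j * (if a \<le> j then ?u j a else 0)) * g a = (if a = 0 then - c i w else 0)"
      proof (cases "i + a \<le> r")
        case True
        show ?thesis unfolding id[OF True] by (simp add: g_def)
      next
        case False
        have "g a = fop (int a) (\<lambda>_. 0) w"
          unfolding g_def by (rule subst_op_cong) (use c0 False True in auto)
        hence "g a = 0" by (simp add: subst_op_linear)
        moreover have "a = 0 \<Longrightarrow> c i w = 0" using c0 False True by auto
        ultimately show ?thesis by simp
      qed
    qed
    also have "\<dots> = c i w" by simp
    finally show ?thesis .
  qed
  ultimately show ?thesis by (intro exI[of _ n]) (auto simp: tensor_power_def has_excess_def)
qed

text \<open>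
  Induction on the degree along \<open>E \<otimes> E\<^sup>\<otimes>\<^sup>r\<close>. The slices at the first letter \<open>y\<close> form a cocycle of weight \<open>m + 1\<close>;
  after subtracting a coboundary these slices vanish, and those at \<open>x\<close> form a cocycle of weight \<open>m - 1\<close>.
  For \<open>m = -1\<close> the latter weight would be too small, and the explicit solution takes over.
\<close>
lemma eop_cocycle_trivial:
  assumes "m \<ge> -1" "eop_cocycle m r c"
  shows "\<exists>n. n \<in> tensor_power r \<and> has_excess m n \<and> (\<forall>i\<ge>1. \<forall>w. eop (int i) n w = c i w)"
  using assms
proof (induction r arbitrary: m c)
  case 0
  have "c i w = 0" if i: "i \<ge> 1" for i w
  proof (rule ccontr)
    assume "c i w \<noteq> 0"
    moreover have "c i \<in> tensor_power 0" "has_excess (m + 2 * int i) (c i)" using 0 i by (auto simp: eop_cocycle_def)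
    ultimately have "excess w = m + 2 * int i" "w = []" by (auto simp: has_excess_def tensor_power_def)
    with 0 i show False by simp
  qed
  thus ?case by (intro exI[of _ "\<lambda>_. 0"]) (simp add: tensor_power_def has_excess_def subst_op_linear)
next
  case (Suc r)
  show ?case
  proof (cases "m = -1")
    case True
    with Suc.prems show ?thesis using eop_cocycle_singular by blast
  next
    case False
    with Suc.prems have m: "m \<ge> 0" by simp
    have cD: "c j \<in> tensor_power (Suc r)" "has_excess (m + 2 * int j) (c j)"
      "eop (int i) (c j) w = of_nat ((i + j) choose i) * c (i + j) w" if "j \<ge> 1" for i j w
      using Suc.prems that by (auto simp: eop_cocycle_def)
    define c2 where "c2 j v = c j (2 # v)" for j v
    have "eop_cocycle (m + 1) r c2"
      unfolding eop_cocycle_def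
    proof (intro allI impI conjI)
      fix j :: nat assume j: "1 \<le> j"
      show "c2 j \<in> tensor_power r" using cD(1)[OF j] by (simp add: tensor_power_def c2_def)
      show "has_excess (m + 1 + 2 * int j) (c2 j)"
        using has_excess_slice(2)[OF cD(2)[OF j]] by (simp add: c2_def[abs_def] algebra_simps)
      show "eop (int i) (c2 j) w = of_nat ((i + j) choose i) * c2 (i + j) w" for i w
        using cD(3)[OF j, of i "2 # w"] by (simp add: c2_def[abs_def])
    qed
    then obtain n2 where n2: "n2 \<in> tensor_power r" "has_excess (m + 1) n2" "\<And>i w. i \<ge> 1 \<Longrightarrow> eop (int i) n2 w = c2 i w"
      using Suc.IH[of "m + 1" c2] m by auto
    define c1 where "c1 j v = c j (1 # v) - eop (int j - 1) n2 v" for j v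
    have "eop_cocycle (m - 1) r c1"
      unfolding eop_cocycle_def
    proof (intro allI impI conjI)
      fix j :: nat assume j: "1 \<le> j"
      show "c1 j \<in> tensor_power r" using cD(1)[OF j] subst_op_in_tensor_power[OF n2(1), of 1 2 "int j - 1"]
        by (simp add: tensor_power_def c1_def)
      have "has_excess (m - 1 + 2 * int j) (\<lambda>v. c j (1 # v))" "has_excess (m - 1 + 2 * int j) (eop (int j - 1) n2)"
        using has_excess_slice(1)[OF cD(2)[OF j]] has_excess_subst_op(1)[OF n2(2), of "int j - 1"]
        by (simp_all add: algebra_simps)
      thus "has_excess (m - 1 + 2 * int j) (c1 j)" unfolding has_excess_def c1_def by (metis diff_0_right)
      show "eop (int i) (c1 j) w = of_nat ((i + j) choose i) * c1 (i + j) w" for i w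
      proof (cases i)
        case (Suc i')
        obtain j' where j': "j = Suc j'" using j by (cases j) auto
        have "eop (int i) (\<lambda>v. c j (1 # v)) w = of_nat ((i + j) choose i) * c (i + j) (1 # w) - eop (int i') (c2 j) w"
          using cD(3)[OF j, of i "1 # w"] by (simp add: Suc c2_def[abs_def] algebra_simps)
        also have "eop (int i') (c2 j) w = of_nat ((i' + j) choose i') * eop (int (i' + j)) n2 w"
          using \<open>eop_cocycle (m + 1) r c2\<close> j n2(3)[of "i' + j"] by (simp add: eop_cocycle_def)
        finally have "eop (int i) (c1 j) w = of_nat ((i + j) choose i) * c (i + j) (1 # w)
            - of_nat ((i' + j) choose i') * eop (int (i' + j)) n2 w - eop (int i) (eop (int j') n2) w"
          by (simp add: c1_def[abs_def] subst_op_linear j')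
        also have "eop (int i) (eop (int j') n2) w = of_nat ((i + j') choose i) * eop (int (i' + j)) n2 w"
          by (subst subst_op_compose) (auto simp: Suc j')
        also have "of_nat ((i + j) choose i) * c (i + j) (1 # w)
            - of_nat ((i' + j) choose i') * eop (int (i' + j)) n2 w - of_nat ((i + j') choose i) * eop (int (i' + j)) n2 w
          = of_nat ((i + j) choose i) * c (i + j) (1 # w) - of_nat (((i' + j) choose i') + ((i + j') choose i)) * eop (int (i' + j)) n2 w"
          by (simp add: algebra_simps)
        also have "((i' + j) choose i') + ((i + j') choose i) = (i + j) choose i" by (simp add: Suc j')
        finally have "eop (int i) (c1 j) w = of_nat ((i + j) choose i) * c (i + j) (1 # w)
            - of_nat ((i + j) choose i) * eop (int (i' + j)) n2 w" .
        moreover have "c1 (i + j) w = c (i + j) (1 # w) - eop (int (i' + j)) n2 w" by (simp add: c1_def Suc)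
        ultimately show ?thesis by (simp only: right_diff_distrib)
      qed simp
    qed
    then obtain n1 where n1: "n1 \<in> tensor_power r" "has_excess (m - 1) n1" "\<And>i w. i \<ge> 1 \<Longrightarrow> eop (int i) n1 w = c1 i w"
      using Suc.IH[of "m - 1" c1] m by auto
    define n where "n w = (case w of [] \<Rightarrow> 0 | a # v \<Rightarrow> if a = 1 then n1 v else n2 v)" for w
    have n12: "(\<lambda>v. n (1 # v)) = n1" "(\<lambda>v. n (2 # v)) = n2" by (simp_all add: n_def fun_eq_iff)
    have "n \<in> tensor_power (Suc r)"
      using n1(1) n2(1) by (auto simp: tensor_power_def n_def split: list.splits)
    moreover have "has_excess m n"
      unfolding has_excess_def
    proof (intro allI impI)
      fix w assume "n w \<noteq> 0"
      then show "excess w = m"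
        using n1(2) n2(2) exhaust_2[of "hd w"] by (cases w) (auto simp: n_def has_excess_def)
    qed
    moreover have "eop (int i) n w = c i w" if i: "i \<ge> 1" for i w
    proof (cases w)
      case Nil
      then show ?thesis using cD(1)[OF i] i by (simp add: tensor_power_def)
    next
      case (Cons a v)
      then show ?thesis using exhaust_2[of a] i by (auto simp: n12 n1(3) n2(3) c1_def c2_def)
    qed
    ultimately show ?thesis by blast
  qed
qed

section \<open>Homomorphisms from modules with a Weyl filtration to tensor powers\<close>
lemma power_exponent_eq:
  fixes i j :: nat
  assumes "infinite (UNIV :: 'k::field set)" "\<And>s::'k. s \<noteq> 0 \<Longrightarrow> s ^ i = s ^ j"
  shows "i = j"
proof (rule ccontr)
  assume "i \<noteq> j"
  hence "monom (1::'k) i - monom 1 j \<noteq> 0" by (simp add: monom_eq_iff')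
  hence "finite {s. poly (monom (1::'k) i - monom 1 j) s = 0}" by (rule poly_roots_finite)
  moreover have "- {0} \<subseteq> {s. poly (monom (1::'k) i - monom 1 j) s = 0}" using assms(2) by (auto simp: poly_monom)
  ultimately have "finite (- {0::'k})" by (rule rev_finite_subset)
  with assms(1) show False by (simp add: Compl_eq_Diff_UNIV)
qed

lemma tensor_act_diag2:
  "tensor_act (diag2 s t) x w = s ^ count_list w 1 * t ^ count_list w 2 * x w"
proof (induction w arbitrary: x)
  case (Cons a w)
  then show ?case using exhaust_2[of a] unfolding diag2_mat2 by (auto simp: tensor_act_Cons_2)
qed simp

lemma count_list_2: "count_list w 1 + count_list w 2 = length w" for w :: "2 list"
proof (induction w)
  case (Cons a w)
  then show ?case using exhaust_2[of a] by auto
qed simp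

lemma tens_weight_spaceI:
  assumes "x \<in> tensor_power r" "has_excess (int a - int b) x" "a + b = r"
  shows "x \<in> weight_space (tens r) (a, b)"
proof -
  have "s ^ count_list w 1 * t ^ count_list w 2 * x w = s ^ a * t ^ b * x w" for s t w
  proof (cases "x w = 0")
    case False
    hence "length w = r" "excess w = int a - int b" using assms by (auto simp: tensor_power_def has_excess_def)
    hence "count_list w 1 = a" "count_list w 2 = b" using count_list_2[of w] assms(3) by (auto simp: excess_def)
    thus ?thesis by simp
  qed simp
  thus ?thesis using assms(1) by (auto simp: weight_space_def tensor_scale_def tensor_act_diag2 fun_eq_iff)
qed

lemma tens_weight_count:
  fixes x :: "'k::field tensor"
  assumes "infinite (UNIV :: 'k set)" "\<And>s. s \<noteq> 0 \<Longrightarrow> tensor_act (diag2 s 1) x = tensor_scale (s ^ a) x" "x w \<noteq> 0"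
  shows "count_list w 1 = a"
proof (rule power_exponent_eq[OF assms(1)])
  fix s :: 'k assume "s \<noteq> 0"
  from fun_cong[OF assms(2)[OF this], of w] show "s ^ count_list w 1 = s ^ a"
    using assms(3) by (simp add: tensor_act_diag2 tensor_scale_def)
qed

context prep
begin

lemma up_curve_relations:
  assumes v: "v \<in> carr" and z: "\<And>i. z i \<in> carr" "\<And>i. r < i \<Longrightarrow> z i = 0"
    "\<And>t. act (up t) v = (\<Sum>i\<le>r. scal (t ^ i) (z i))" and j: "j \<le> r"
  shows "act (up s) (z j) = (\<Sum>i\<le>r. scal (s ^ i) (scal (of_nat ((i + j) choose i)) (z (i + j))))"
    and "v \<in> weight_space M (a, b) \<Longrightarrow> s \<noteq> 0 \<Longrightarrow> act (diag2 s 1) (z j) = scal (s ^ (a + j)) (z j)"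
proof -
  have sum: "act g (\<Sum>j\<le>r. scal (t ^ j) (z j)) = (\<Sum>j\<le>r. scal (t ^ j) (act g (z j)))" if "g \<in> GL2" for g t
    by (rule linear_map_on_sum_scale[OF linear_act[OF that] vs.vector_space_axioms carr_subspace z(1)])
  have "act (up s) (z j) = (\<Sum>k\<le>r. scal (of_nat (k choose j) * s ^ (k - j)) (z k))"
  proof (rule vs.poly_curve_unique[OF inf _ j, where y = "\<lambda>j. act (up s) (z j)"])
    fix t :: 'k
    have "(\<Sum>j\<le>r. scal (t ^ j) (act (up s) (z j))) = act (up s) (act (up t) v)"
      by (simp add: sum z(3))
    also have "\<dots> = act (up (t + s)) v"
      using v by (simp add: add.commute flip: act_mult up_add)
    also have "\<dots> = (\<Sum>k\<le>r. \<Sum>j\<le>r. scal (of_nat (k choose j) * t ^ j * s ^ (k - j)) (z k))"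
      unfolding z(3) binomial_ring vs.scale_sum_left
      by (rule sum.cong[OF refl], rule sum.mono_neutral_left) (auto simp: binomial_eq_0 not_le)
    also have "\<dots> = (\<Sum>j\<le>r. scal (t ^ j) (\<Sum>k\<le>r. scal (of_nat (k choose j) * s ^ (k - j)) (z k)))"
      by (subst sum.swap) (simp add: vs.scale_sum_right mult_ac)
    finally show "(\<Sum>j\<le>r. scal (t ^ j) (act (up s) (z j))) =
      (\<Sum>j\<le>r. scal (t ^ j) (\<Sum>k\<le>r. scal (of_nat (k choose j) * s ^ (k - j)) (z k)))" .
  qed
  also have "\<dots> = (\<Sum>k\<in>{j..r}. scal (of_nat (k choose j) * s ^ (k - j)) (z k))"
    by (intro sum.mono_neutral_right) (auto simp: binomial_eq_0 not_le)
  also have "\<dots> = (\<Sum>i\<le>r - j. scal (s ^ i) (scal (of_nat ((i + j) choose i)) (z (i + j))))"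
  proof (rule sum.reindex_bij_witness[of _ "\<lambda>i. i + j" "\<lambda>k. k - j"])
    fix k assume "k \<in> {j..r}"
    moreover from this have "k choose (k - j) = k choose j" using binomial_symmetric[of j k] by simp
    ultimately show "scal (s ^ (k - j)) (scal (of_nat (k - j + j choose (k - j))) (z (k - j + j))) = scal (of_nat (k choose j) * s ^ (k - j)) (z k)"
      by (simp add: mult.commute)
  qed (use j in auto)
  also have "\<dots> = (\<Sum>i\<le>r. scal (s ^ i) (scal (of_nat ((i + j) choose i)) (z (i + j))))"
    by (intro sum.mono_neutral_left) (auto simp: z(2))
  finally show "act (up s) (z j) = (\<Sum>i\<le>r. scal (s ^ i) (scal (of_nat ((i + j) choose i)) (z (i + j))))" .
next
  assume w: "v \<in> weight_space M (a, b)" and s: "s \<noteq> 0"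
  show "act (diag2 s 1) (z j) = scal (s ^ (a + j)) (z j)"
  proof (rule vs.poly_curve_unique[OF inf _ j, where y = "\<lambda>j. act (diag2 s 1) (z j)"])
    fix t :: 'k
    have "(\<Sum>j\<le>r. scal (t ^ j) (act (diag2 s 1) (z j))) = act (diag2 s 1) (act (up t) v)"
      unfolding z(3) using s
      by (intro linear_map_on_sum_scale[OF linear_act vs.vector_space_axioms carr_subspace z(1), symmetric]) simp
    also have "\<dots> = act (diag2 s 1 ** up t) v" using v s by (simp add: act_mult)
    also have "diag2 s 1 ** up t = up (s * t) ** diag2 s 1" by (simp add: diag2_mat2 mat2_mult)
    also have "act \<dots> v = act (up (s * t)) (scal (s ^ a) v)"
      using v s w by (simp add: act_mult weight_space_def)
    also have "\<dots> = scal (s ^ a) (act (up (s * t)) v)"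
      using v by (intro linear_map_on_scale[OF linear_act]) auto
    also have "\<dots> = (\<Sum>j\<le>r. scal (t ^ j) (scal (s ^ (a + j)) (z j)))"
      by (simp add: z(3) vs.scale_sum_right power_mult_distrib power_add mult_ac)
    finally show "(\<Sum>j\<le>r. scal (t ^ j) (act (diag2 s 1) (z j))) = (\<Sum>j\<le>r. scal (t ^ j) (scal (s ^ (a + j)) (z j)))" .
  qed
qed

end

text \<open>
  A preimage of the generator can be replaced by its component of weight \<open>\<mu>\<close>, which has the same image.
\<close>
lemma weyl_section_generator:
  fixes M :: "('k::field, 'v::ab_group_add) rep"
  assumes inf: "infinite (UNIV :: 'k set)" and M: "poly_rep r M" and \<mu>: "\<mu> \<in> two_part_partitions r"
    and B: "submodule B M" and q: "kg_hom (M\<lparr>rep_space := B\<rparr>) (weyl \<mu>) q" "q ` B = rep_space (weyl \<mu>)"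
  shows "\<exists>x\<in>B. x \<in> weight_space M \<mu> \<and> q x = weyl_generator (fst \<mu> - snd \<mu>)"
proof -
  interpret M: prep M r using M inf by (rule prepI)
  note qD = kg_homD[OF q(1), simplified]
  have Bs: "M.vs.subspace B" "B \<subseteq> M.carr" "\<And>g b. g \<in> GL2 \<Longrightarrow> b \<in> B \<Longrightarrow> M.act g b \<in> B"
    using B by (auto simp: submodule_def)
  have \<mu>': "snd \<mu> \<le> fst \<mu>" "fst \<mu> \<le> r" "r - fst \<mu> = snd \<mu>" using \<mu> by (auto simp: two_part_partitions_def)
  have inf': "infinite (- {0::'k})" using inf by (simp add: Compl_eq_Diff_UNIV)
  have "weyl_generator (fst \<mu> - snd \<mu>) \<in> q ` B" by (simp only: q(2) weyl_generator_in)
  then obtain x where x: "x \<in> B" "q x = weyl_generator (fst \<mu> - snd \<mu>)" by (elim imageE) simp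
  have xc: "x \<in> M.carr" using x Bs by auto
  obtain z where z: "\<And>i. z i \<in> B" "\<And>i. i \<le> r \<Longrightarrow> z i \<in> weight_space M (i, r - i)"
    "\<And>s t. s \<noteq> 0 \<Longrightarrow> t \<noteq> 0 \<Longrightarrow> M.act (diag2 s t) x = (\<Sum>i\<le>r. M.scal (s ^ i * t ^ (r - i)) (z i))"
    by (rule M.weight_components[OF xc Bs(1) Bs(3)[OF _ x(1)] Bs(2)]) (assumption | rule that)+
  have "q (z (fst \<mu>)) f = weyl_generator (fst \<mu> - snd \<mu>) f" for f
  proof -
    have lin: "linear_map_on B M.scal (*) (\<lambda>b. q b f)" using linear_functional_coordinate[OF q(1)] by simp
    have "q (z (fst \<mu>)) f = (if fst \<mu> = fst \<mu> then weyl_generator (fst \<mu> - snd \<mu>) f else 0)"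
    proof (rule vector_space_over_itself.poly_curve_unique[OF inf' _ \<mu>'(2), where y = "\<lambda>i. q (z i) f"
          and z = "\<lambda>i. if i = fst \<mu> then weyl_generator (fst \<mu> - snd \<mu>) f else 0"])
      fix s :: 'k assume s: "s \<in> - {0}"
      have "(\<Sum>j\<le>r. s ^ j * q (z j) f) = q (M.act (diag2 s 1) x) f"
        using s by (simp add: z(3)) (rule linear_map_on_sum_scale[OF lin M.vs.vector_space_axioms Bs(1) z(1), symmetric])
      also have "\<dots> = s ^ fst \<mu> * weyl_generator (fst \<mu> - snd \<mu>) f"
        using s x \<mu>'(1) by (simp add: qD(3) weyl_act_diag2)
      also have "\<dots> = (\<Sum>j\<le>r. if j = fst \<mu> then s ^ j * weyl_generator (fst \<mu> - snd \<mu>) f else 0)"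
        using \<mu>'(2) by simp
      also have "\<dots> = (\<Sum>j\<le>r. s ^ j * (if j = fst \<mu> then weyl_generator (fst \<mu> - snd \<mu>) f else 0))"
        by (intro sum.cong) auto
      finally show "(\<Sum>j\<le>r. s ^ j * q (z j) f) = (\<Sum>j\<le>r. s ^ j * (if j = fst \<mu> then weyl_generator (fst \<mu> - snd \<mu>) f else 0))" .
    qed
    thus ?thesis by simp
  qed
  moreover have "z (fst \<mu>) \<in> weight_space M \<mu>" using z(2)[OF \<mu>'(2)] \<mu>'(3) by simp
  ultimately show ?thesis using z(1) by (intro bexI[of _ "z (fst \<mu>)"]) (simp_all add: fun_eq_iff)
qed

text \<open>
  Extensions of a Weyl module by \<open>E\<^sup>\<otimes>\<^sup>r\<close> split. With \<open>x\<close> over the generator of \<open>B/A\<close>, the function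
  \<open>f (u x - x)\<close> of the upper unitriangular \<open>u\<close> is a cocycle of weight \<open>\<mu>\<^sub>1 - \<mu>\<^sub>2 \<ge> 0\<close>, and a tensor whose coboundary
  it is serves as the image of \<open>x\<close>.
\<close>
lemma extend_to_tensor_power:
  fixes M :: "('k::field, 'v::ab_group_add) rep"
  assumes inf: "infinite (UNIV :: 'k set)" and M: "poly_rep r M" and \<mu>: "\<mu> \<in> two_part_partitions r"
    and A: "submodule A M" and B: "submodule B M" and AB: "A \<subseteq> B" and q: "section_iso M A B (weyl \<mu>)"
    and f: "kg_hom (M\<lparr>rep_space := A\<rparr>) (tens r) f"
  shows "\<exists>h. kg_hom (M\<lparr>rep_space := B\<rparr>) (tens r) h \<and> (\<forall>a\<in>A. h a = f a)"
proof -
  obtain q where q: "kg_hom (M\<lparr>rep_space := B\<rparr>) (weyl \<mu>) q" "q ` B = rep_space (weyl \<mu>)" "{v \<in> B. q v = 0} = A"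
    using q unfolding section_iso_def by blast
  obtain x where x: "x \<in> B" "x \<in> weight_space M \<mu>" "q x = weyl_generator (fst \<mu> - snd \<mu>)"
    using weyl_section_generator[OF inf M \<mu> B q(1,2)] by blast
  interpret M: prep M r using M inf by (rule prepI)
  have \<mu>': "snd \<mu> \<le> fst \<mu>" "fst \<mu> + snd \<mu> = r" using \<mu> by (auto simp: two_part_partitions_def)
  note qD = kg_homD[OF q(1), simplified] and fD = kg_homD[OF f, simplified]
  have Bs: "M.vs.subspace B" "B \<subseteq> M.carr" "\<And>g b. g \<in> GL2 \<Longrightarrow> b \<in> B \<Longrightarrow> M.act g b \<in> B"
    using B by (auto simp: submodule_def)
  have As: "M.vs.subspace A" "\<And>g b. g \<in> GL2 \<Longrightarrow> b \<in> A \<Longrightarrow> M.act g b \<in> A"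
    using A by (auto simp: submodule_def)
  have xc: "x \<in> M.carr" using x Bs by auto
  obtain z' where z': "\<And>i. z' i \<in> B" "\<And>t. M.act (up t) x = (\<Sum>i\<le>r. M.scal (t ^ i) (z' i))"
    using M.up_curve[OF xc Bs(1)] Bs(3) x(1) by blast
  define z where "z i = (if i \<le> r then z' i else 0)" for i
  have z: "z i \<in> B" "z i \<in> M.carr" "r < i \<Longrightarrow> z i = 0" "M.act (up t) x = (\<Sum>i\<le>r. M.scal (t ^ i) (z i))" for i t
    using z' M.vs.subspace_0[OF Bs(1)] Bs(2) by (auto simp: z_def)
  have z0: "z 0 = x"
    using z(4)[of 0] xc by (simp add: power_0_left if_distrib[of "\<lambda>c. M.scal c _"] flip: mat_1_mat2 cong: if_cong)
  have upA: "M.act (up t) x - x \<in> A" for t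
  proof -
    have "q (M.act (up t) x - x) = 0"
      using x Bs by (subst linear_map_on_diff[OF qD(2)]) (auto simp: M.vs.vector_space_axioms qD(3) weyl_act_up)
    thus ?thesis using q(3) x Bs by (auto intro!: M.vs.subspace_diff)
  qed
  have zA: "z i \<in> A" if "i \<ge> 1" for i
  proof (cases "i \<le> r")
    case True
    have "(if i = 0 then 0 else z i) \<in> A"
    proof (rule M.vs.poly_curve_coeff_in[OF inf As(1) _ True])
      fix t :: 'k
      have "(\<Sum>j\<le>r. M.scal (t ^ j) (if j = 0 then 0 else z j)) = (\<Sum>j\<le>r. M.scal (t ^ j) (z j) - (if j = 0 then z 0 else 0))"
        by (intro sum.cong) auto
      also have "\<dots> = M.act (up t) x - x" by (simp add: sum_subtractf z(4) z0)
      finally show "(\<Sum>j\<le>r. M.scal (t ^ j) (if j = 0 then 0 else z j)) \<in> A" using upA by simp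
    qed
    with that show ?thesis by simp
  qed (simp add: z(3) M.vs.subspace_0[OF As(1)])
  define c where "c j = (if j \<ge> 1 then f (z j) else 0)" for j
  have c: "c j \<in> tensor_power r" for j
    using fD(1)[OF zA] by (auto simp: c_def tensor_power_def)
  have f0: "f 0 = 0" using linear_map_on_zero[OF fD(2) M.vs.subspace_0[OF As(1)]] .
  have "eop_cocycle (int (fst \<mu>) - int (snd \<mu>)) r c"
    unfolding eop_cocycle_def
  proof (intro allI impI conjI c)
    fix j :: nat assume j: "1 \<le> j"
    show "has_excess (int (fst \<mu>) - int (snd \<mu>) + 2 * int j) (c j)"
      unfolding has_excess_def
    proof (intro allI impI)
      fix w assume w: "c j w \<noteq> 0"
      hence "z j \<noteq> 0" using f0 j by (auto simp: c_def)
      hence jr: "j \<le> r" using z(3)[of j] by force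
      have "count_list w 1 = fst \<mu> + j"
      proof (rule tens_weight_count[where x = "c j" and w = w and a = "fst \<mu> + j", OF inf _ w])
        fix s :: 'k assume s: "s \<noteq> 0"
        have "M.act (diag2 s 1) (z j) = M.scal (s ^ (fst \<mu> + j)) (z j)"
          by (rule M.up_curve_relations(2)[OF xc z(2,3,4) jr _ s, of _ "snd \<mu>"]) (use x in auto)
        with fD(3)[OF _ zA[OF j], of "diag2 s 1"] linear_map_on_scale[OF fD(2) zA[OF j]] s j
        show "tensor_act (diag2 s 1) (c j) = tensor_scale (s ^ (fst \<mu> + j)) (c j)" by (simp add: c_def)
      qed
      moreover have "length w = r" using c[of j] w by (auto simp: tensor_power_def)
      ultimately show "excess w = int (fst \<mu>) - int (snd \<mu>) + 2 * int j"
        using count_list_2[of w] \<mu>'(2) by (simp add: excess_def)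
    qed
    fix i w
    show "eop (int i) (c j) w = of_nat ((i + j) choose i) * c (i + j) w"
    proof (cases "length w = r \<and> i \<le> r \<and> j \<le> r")
      case True
      show ?thesis
      proof (rule vector_space_over_itself.poly_curve_unique[OF inf, where d = r and y = "\<lambda>i. eop (int i) (c j) w"])
        fix s :: 'k
        have "(\<Sum>i\<le>r. s ^ i * eop (int i) (c j) w) = tensor_act (up s) (c j) w" using True by (simp add: tensor_act_up)
        also have "tensor_act (up s) (c j) = f (M.act (up s) (z j))" using j by (simp add: c_def fD(3) zA)
        also have "M.act (up s) (z j) = (\<Sum>i\<le>r. M.scal (s ^ i * of_nat ((i + j) choose i)) (z (i + j)))"
          using M.up_curve_relations(1)[OF xc z(2,3,4)] True by simp
        also have "f \<dots> = (\<Sum>i\<le>r. tensor_scale (s ^ i * of_nat ((i + j) choose i)) (f (z (i + j))))"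
          by (rule linear_map_on_sum_scale[OF fD(2) M.vs.vector_space_axioms As(1)]) (use zA j in auto)
        finally show "(\<Sum>i\<le>r. s ^ i * eop (int i) (c j) w) = (\<Sum>i\<le>r. s ^ i * (of_nat ((i + j) choose i) * c (i + j) w))"
          using j by (simp add: sum_tensor_apply tensor_scale_def c_def mult.assoc)
      qed (use True in auto)
    next
      case False
      have "c (i + j) w = 0"
        using False c[of "i + j"] j z(3)[of "i + j"] f0 by (auto simp: c_def tensor_power_def)
      moreover have "eop (int i) (c j) w = 0"
      proof (cases "j \<le> r")
        case True
        then show ?thesis using False subst_op_in_tensor_power[OF c[of j], of 1 2 "int i"] subst_op_out_of_range[of "int i" w 1 2 "c j"]
          by (cases "length w = r") (auto simp: tensor_power_def)
      next
        case False
        hence "c j = (\<lambda>_. 0)" using z(3)[of j] f0 by (auto simp: c_def zero_fun_def)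
        thus ?thesis by (simp add: subst_op_linear)
      qed
      ultimately show ?thesis by simp
    qed
  qed
  then obtain n where n: "n \<in> tensor_power r" "has_excess (int (fst \<mu>) - int (snd \<mu>)) n" "\<And>i w. i \<ge> 1 \<Longrightarrow> eop (int i) n w = c i w"
    using eop_cocycle_trivial[of "int (fst \<mu>) - int (snd \<mu>)" r c] \<mu>'(1) by auto
  have nw: "n \<in> weight_space (tens r) \<mu>" using tens_weight_spaceI[OF n(1,2) \<mu>'(2)] by simp
  have "tensor_act (up t) n - n = f (M.act (up t) x - x)" for t
  proof
    fix w
    have "M.act (up t) x - x = (\<Sum>j\<in>{1..r}. M.scal (t ^ j) (z j))"
      by (simp add: z(4) z0 atMost_atLeast0 sum.atLeast_Suc_atMost[of 0])
    also have "f \<dots> = (\<Sum>j\<in>{1..r}. tensor_scale (t ^ j) (f (z j)))"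
      by (rule linear_map_on_sum_scale[OF fD(2) M.vs.vector_space_axioms As(1)]) (use zA in auto)
    finally have f_eq: "f (M.act (up t) x - x) w = (\<Sum>j\<in>{1..r}. t ^ j * c j w)"
      by (simp add: sum_tensor_apply tensor_scale_def c_def)
    show "(tensor_act (up t) n - n) w = f (M.act (up t) x - x) w"
    proof (cases "length w = r")
      case True
      hence "tensor_act (up t) n w = n w + (\<Sum>j\<in>{1..r}. t ^ j * c j w)"
        by (simp add: tensor_act_up atMost_atLeast0 sum.atLeast_Suc_atMost[of 0] n(3))
      thus ?thesis by (simp add: f_eq)
    next
      case False
      thus ?thesis using n(1) tensor_act_in_tensor_power[OF n(1), of "up t"] c
        by (simp add: f_eq tensor_power_def)
    qed
  qed
  then obtain h where "kg_hom (M\<lparr>rep_space := B\<rparr>) (tens r) h" "\<forall>a\<in>A. h a = f a"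
    using extend_along_weyl_section[OF inf M poly_rep_tens \<mu> A B AB q(1,3) f x(2,1,3) nw] by auto
  thus ?thesis by blast
qed

lemma extend_along_weyl_filtration:
  fixes M :: "('k::field, 'v::ab_group_add) rep"
  assumes inf: "infinite (UNIV :: 'k set)" and M: "poly_rep r M"
    and W: "\<And>i. i \<le> n \<Longrightarrow> submodule (W i) M" "\<And>i. i < n \<Longrightarrow> W i \<subseteq> W (Suc i)"
      "\<And>i. i < n \<Longrightarrow> \<exists>N\<in>weyl ` two_part_partitions r. section_iso M (W i) (W (Suc i)) N"
    and k: "k \<le> n" and f: "kg_hom (M\<lparr>rep_space := W k\<rparr>) (tens r) f"
  shows "\<exists>h. kg_hom (M\<lparr>rep_space := W n\<rparr>) (tens r) h \<and> (\<forall>a\<in>W k. h a = f a)"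
proof -
  have "W k \<subseteq> W j \<and> (\<exists>h. kg_hom (M\<lparr>rep_space := W j\<rparr>) (tens r) h \<and> (\<forall>a\<in>W k. h a = f a))"
    if "k \<le> j" "j \<le> n" for j
    using that
  proof (induction j rule: dec_induct)
    case base
    then show ?case using f by blast
  next
    case (step j)
    then obtain h where h: "W k \<subseteq> W j" "kg_hom (M\<lparr>rep_space := W j\<rparr>) (tens r) h" "\<forall>a\<in>W k. h a = f a"
      by auto
    obtain \<mu> where \<mu>: "\<mu> \<in> two_part_partitions r" "section_iso M (W j) (W (Suc j)) (weyl \<mu>)"
      using W(3)[of j] step by auto
    have "submodule (W j) M" "submodule (W (Suc j)) M" "W j \<subseteq> W (Suc j)" using W step by auto
    from extend_to_tensor_power[OF inf M \<mu>(1) this \<mu>(2) h(2)]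
    obtain h' where "kg_hom (M\<lparr>rep_space := W (Suc j)\<rparr>) (tens r) h'" "\<forall>a\<in>W j. h' a = h a" by blast
    with h \<open>W j \<subseteq> W (Suc j)\<close> show ?case by (intro conjI exI[of _ h']) auto
  qed
  with k show ?thesis by blast
qed

lemma weyl_generator_nonzero: "weyl_generator n \<noteq> (0 :: 'a::field poly \<Rightarrow> 'a)"
proof
  assume "weyl_generator n = (0 :: 'a poly \<Rightarrow> 'a)"
  from fun_cong[OF this, of 1] show False by (simp add: weyl_generator_def)
qed

lemma weyl_act_diag2_monom:
  assumes "\<phi> \<in> rep_space (weyl \<mu>)" "snd \<mu> \<le> fst \<mu>" "i \<le> fst \<mu> - snd \<mu>"
  shows "rep_act (weyl \<mu>) (diag2 s 1) \<phi> (monom 1 i) = s ^ (fst \<mu> - i) * \<phi> (monom 1 i)"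
proof -
  let ?n = "fst \<mu> - snd \<mu>"
  have tr: "transpose (diag2 s 1) = diag2 s 1" by (simp add: diag2_mat2 transpose_mat2)
  have "sym_act ?n (diag2 s 1) (monom 1 i) = smult (s ^ (?n - i)) (monom 1 i)"
  proof -
    have "sym_act ?n (diag2 s 1) (monom 1 i) =
       (\<Sum>j\<le>?n. if j = i then [:s:] ^ (?n - i) * [:0, 1:] ^ i else 0)"
      unfolding sym_act_def by (intro sum.cong) (auto simp: diag2_mat2)
    also have "\<dots> = [:s:] ^ (?n - i) * [:0, 1:] ^ i" using assms(3) by simp
    also have "[:s:] ^ (?n - i) = [:s ^ (?n - i):]" by (simp add: poly_const_pow)
    finally show ?thesis by (simp add: monom_altdef)
  qed
  hence "rep_act (weyl \<mu>) (diag2 s 1) \<phi> (monom 1 i) = \<phi> (smult (s ^ snd \<mu> * s ^ (?n - i)) (monom 1 i))"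
    using assms(3) by (simp add: weyl_act degree_monom_eq tr) (simp add: diag2_mat2)
  also have "s ^ snd \<mu> * s ^ (?n - i) = s ^ (fst \<mu> - i)" using assms(2,3) by (simp flip: power_add)
  also have "\<phi> (smult (s ^ (fst \<mu> - i)) (monom 1 i)) = s ^ (fst \<mu> - i) * \<phi> (monom 1 i)"
    using assms(1,3) by (auto simp: weyl_def contravariant_dual_def dual_weyl_def linear_map_on_def degree_monom_eq)
  finally show ?thesis .
qed

text \<open>
  A nonzero vector of weight \<open>(r - 1, 1)\<close> appears first in some section. Its image is nonzero, so the section is the Weyl
  module of \<open>(r, 0)\<close> or of \<open>(r - 1, 1)\<close>; the former would produce a vector of weight \<open>(r, 0)\<close>. In the
  latter it is a multiple of the generator, and the projection is rescaled to make it equal.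
\<close>
lemma highest_weight_section:
  fixes M :: "('k::field, 'v::ab_group_add) rep"
  assumes inf: "infinite (UNIV :: 'k set)" and M: "poly_rep r M" and r: "r \<ge> 2"
    and W: "W 0 = {0}" "W n = rep_space M" "\<And>i. i \<le> n \<Longrightarrow> submodule (W i) M"
      "\<And>i. i < n \<Longrightarrow> \<exists>N\<in>weyl ` two_part_partitions r. section_iso M (W i) (W (Suc i)) N"
    and v: "v \<in> weight_space M (r - 1, 1)" "v \<noteq> 0" and no: "\<not> is_weight M (r, 0)"
  shows "\<exists>k<n. v \<in> W (Suc k) \<and> (\<exists>q. kg_hom (M\<lparr>rep_space := W (Suc k)\<rparr>) (weyl (r - 1, 1)) q \<and>
    {x \<in> W (Suc k). q x = 0} = W k \<and> q v = weyl_generator (r - 2))"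
proof -
  interpret M: prep M r using M inf by (rule prepI)
  have vc: "v \<in> M.carr" using v by (simp add: weight_space_def)
  have "v \<in> W n" "v \<notin> W 0" using vc W(1,2) v(2) by simp_all
  then obtain k where "k < n" "\<forall>i\<le>k. v \<notin> W i" "v \<in> W (Suc k)"
    using ex_least_nat_less[of "\<lambda>k. v \<in> W k" n] by blast
  hence k: "v \<in> W (Suc k)" "k < n" "v \<notin> W k" by simp_all
  obtain \<mu> q where \<mu>: "\<mu> \<in> two_part_partitions r" and q: "kg_hom (M\<lparr>rep_space := W (Suc k)\<rparr>) (weyl \<mu>) q"
    "q ` W (Suc k) = rep_space (weyl \<mu>)" "{x \<in> W (Suc k). q x = 0} = W k"
    using W(4)[OF k(2)] unfolding section_iso_def by auto
  have B: "submodule (W (Suc k)) M" using W(3) k(2) by auto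
  have \<mu>': "snd \<mu> \<le> fst \<mu>" "fst \<mu> + snd \<mu> = r" using \<mu> by (auto simp: two_part_partitions_def)
  note qD = kg_homD[OF q(1), simplified]
  have qv: "q v \<in> rep_space (weyl \<mu>)" "q v \<noteq> 0" using qD(1) k q(3) by auto
  have wt: "fst \<mu> - i = r - 1" if "q v (monom 1 i) \<noteq> 0" "i \<le> fst \<mu> - snd \<mu>" for i
  proof (rule power_exponent_eq[OF inf])
    fix s :: 'k assume s: "s \<noteq> 0"
    have "s ^ (fst \<mu> - i) * q v (monom 1 i) = q (M.act (diag2 s 1) v) (monom 1 i)"
      using weyl_act_diag2_monom[OF qv(1) \<mu>'(1) that(2), of s] s k by (simp add: qD(3))
    also have "M.act (diag2 s 1) v = M.scal (s ^ (r - 1)) v" using v(1) s by (simp add: weight_space_def)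
    also have "q (M.scal (s ^ (r - 1)) v) (monom 1 i) = s ^ (r - 1) * q v (monom 1 i)"
      using linear_map_on_scale[OF linear_functional_coordinate[OF q(1)]] k by simp
    finally show "s ^ (fst \<mu> - i) = s ^ (r - 1)" using that by simp
  qed
  have "\<exists>i\<le>fst \<mu> - snd \<mu>. q v (monom 1 i) \<noteq> 0"
  proof (rule ccontr)
    assume "\<not> (\<exists>i\<le>fst \<mu> - snd \<mu>. q v (monom 1 i) \<noteq> 0)"
    hence "q v = 0"
      using qv(1) by (intro weyl_eqI[of _ \<mu>])
        (auto simp: weyl_def contravariant_dual_def dual_weyl_def linear_map_on_def)
    with qv(2) show False by simp
  qed
  then obtain i where i: "i \<le> fst \<mu> - snd \<mu>" "q v (monom 1 i) \<noteq> 0" by auto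
  have "\<mu> \<noteq> (r, 0)"
  proof
    assume "\<mu> = (r, 0)"
    moreover obtain x where "x \<in> weight_space M \<mu>" "q x = weyl_generator (fst \<mu> - snd \<mu>)" "x \<in> W (Suc k)"
      using weyl_section_generator[OF inf M \<mu> B q(1,2)] by blast
    moreover from this have "x \<noteq> 0"
      using linear_map_on_zero[OF qD(2)] weyl_generator_nonzero[of "fst \<mu> - snd \<mu>", where 'a = 'k] by auto
    ultimately show False using no unfolding is_weight_def by blast
  qed
  with \<mu>' wt[OF i(2,1)] have \<mu>eq: "\<mu> = (r - 1, 1)" by (cases \<mu>) auto
  define c where "c = q v (monom 1 0)"
  have zero: "q v (monom 1 j) = 0" if "j \<le> r - 2" "j \<noteq> 0" for j
    using wt[of j] that r unfolding \<mu>eq by (cases "q v (monom 1 j) = 0") (auto simp: numeral_2_eq_2)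
  have c0: "c \<noteq> 0" using i zero[of i] unfolding \<mu>eq c_def by (cases i) (auto simp: numeral_2_eq_2)
  define q' where "q' x = (\<lambda>f. inverse c * q x f)" for x
  have "kg_hom (M\<lparr>rep_space := W (Suc k)\<rparr>) (weyl (r - 1, 1)) q'"
    unfolding kg_hom_def
  proof (intro conjI ballI)
    note qD' = qD[unfolded \<mu>eq]
    show "q' ` rep_space (M\<lparr>rep_space := W (Suc k)\<rparr>) \<subseteq> rep_space (weyl (r - 1, 1))"
    proof (rule image_subsetI)
      fix x assume "x \<in> rep_space (M\<lparr>rep_space := W (Suc k)\<rparr>)"
      hence "q x \<in> rep_space (weyl (r - 1, 1))" using qD'(1) by simp
      thus "q' x \<in> rep_space (weyl (r - 1, 1))"
        by (simp add: q'_def weyl_def contravariant_dual_def dual_weyl_def linear_map_on_def distrib_left mult.left_commute)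
    qed
    have add: "q' (x + y) = q' x + q' y" if "x \<in> W (Suc k)" "y \<in> W (Suc k)" for x y
      using linear_map_on_add[OF qD'(2) that] by (simp add: q'_def fun_eq_iff distrib_left)
    have scale: "q' (M.scal a x) = rep_scale (weyl (r - 1, 1)) a (q' x)" if "x \<in> W (Suc k)" for a x
      using linear_map_on_scale[OF qD'(2) that] by (simp add: q'_def fun_eq_iff weyl_def contravariant_dual_def mult.left_commute)
    show "linear_map_on (rep_space (M\<lparr>rep_space := W (Suc k)\<rparr>)) (rep_scale (M\<lparr>rep_space := W (Suc k)\<rparr>))
        (rep_scale (weyl (r - 1, 1))) q'"
      unfolding linear_map_on_def using add scale by simp
    show "q' (rep_act (M\<lparr>rep_space := W (Suc k)\<rparr>) g x) = rep_act (weyl (r - 1, 1)) g (q' x)"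
      if "g \<in> GL2" "x \<in> rep_space (M\<lparr>rep_space := W (Suc k)\<rparr>)" for g x
    proof -
      have "q (M.act g x) = rep_act (weyl (r - 1, 1)) g (q x)" using qD'(3) that by simp
      thus ?thesis by (simp add: q'_def fun_eq_iff weyl_def contravariant_dual_def)
    qed
  qed
  moreover have "{x \<in> W (Suc k). q' x = 0} = W k"
    using c0 unfolding q(3)[symmetric] by (auto simp: q'_def fun_eq_iff)
  moreover have "q' v = weyl_generator (r - 2)"
  proof (rule weyl_eqI[of _ "(r - 1, 1)"])
    show "q' v \<in> rep_space (weyl (r - 1, 1))" using kg_homD(1)[OF calculation(1)] k by simp
    show "weyl_generator (r - 2) \<in> rep_space (weyl (r - 1, 1))"
      using weyl_generator_in[of "(r - 1, 1)"] by (simp add: numeral_2_eq_2)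
    fix j assume "j \<le> fst (r - 1, 1) - snd (r - 1, 1)"
    thus "q' v (monom 1 j) = weyl_generator (r - 2) (monom 1 j)"
      using zero[of j] c0 by (cases "j = 0") (auto simp: q'_def weyl_generator_def c_def degree_monom_eq numeral_2_eq_2)
  qed
  ultimately show ?thesis using k by blast
qed

text \<open>
  Start with zero below the section in which \<open>v\<close> appears and send \<open>v\<close> to \<open>w\<close> there; no further obstruction exists
  above.
\<close>
lemma highest_weight_hom_to_tensor_power:
  fixes M :: "('k::field, 'v::ab_group_add) rep"
  assumes inf: "infinite (UNIV :: 'k set)" and M: "poly_rep r M" and r: "r \<ge> 2"
    and filt: "has_filtration M (weyl ` two_part_partitions r)"
    and v: "v \<in> weight_space M (r - 1, 1)" "v \<noteq> 0" and no: "\<not> is_weight M (r, 0)"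
    and w: "w \<in> weight_space (tens r) (r - 1, 1)" "\<And>t. tensor_act (up t) w = w"
  shows "\<exists>h. kg_hom M (tens r) h \<and> h v = w"
proof -
  obtain n W where filt': "W 0 = {0} \<and> W n = rep_space M \<and> (\<forall>i\<le>n. submodule (W i) M) \<and>
      (\<forall>i<n. W i \<subseteq> W (Suc i) \<and> (\<exists>N\<in>weyl ` two_part_partitions r. section_iso M (W i) (W (Suc i)) N))"
    using filt unfolding has_filtration_def by (elim exE) (rule that)
  hence W: "W 0 = {0}" "W n = rep_space M" "\<And>i. i \<le> n \<Longrightarrow> submodule (W i) M"
      "\<And>i. i < n \<Longrightarrow> W i \<subseteq> W (Suc i)"
      "\<And>i. i < n \<Longrightarrow> \<exists>N\<in>weyl ` two_part_partitions r. section_iso M (W i) (W (Suc i)) N"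
    by simp_all
  have "\<exists>k<n. v \<in> W (Suc k) \<and> (\<exists>q. kg_hom (M\<lparr>rep_space := W (Suc k)\<rparr>) (weyl (r - 1, 1)) q \<and>
      {x \<in> W (Suc k). q x = 0} = W k \<and> q v = weyl_generator (r - 2))"
    by (rule highest_weight_section[OF inf M r W(1,2,3,5) v no])
  then obtain k q where k: "k < n" "v \<in> W (Suc k)" and q: "kg_hom (M\<lparr>rep_space := W (Suc k)\<rparr>) (weyl (r - 1, 1)) q"
    "{x \<in> W (Suc k). q x = 0} = W k" "q v = weyl_generator (r - 2)"
    by (elim exE conjE) (rule that)
  have zero: "kg_hom (M\<lparr>rep_space := W k\<rparr>) (tens r) (\<lambda>_. 0)"
    by (auto simp: kg_hom_def linear_map_on_def tensor_power_def tensor_scale_def fun_eq_iff zero_fun_def)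
  have part: "(r - 1, 1) \<in> two_part_partitions r" using r by (auto simp: two_part_partitions_def)
  have qv: "q v = weyl_generator (fst (r - 1, 1) - snd (r - 1, 1::nat))" using q(3) by (simp add: numeral_2_eq_2)
  have sub: "submodule (W k) M" "submodule (W (Suc k)) M" "W k \<subseteq> W (Suc k)" using W(3,4) k by simp_all
  have w': "rep_act (tens r) (up t) w - w = 0" for t using w(2) by simp
  obtain h where h: "kg_hom (M\<lparr>rep_space := W (Suc k)\<rparr>) (tens r) h" "h v = w"
    using extend_along_weyl_section[OF inf M poly_rep_tens part sub q(1,2) zero v(1) k(2) qv w(1) w'] by blast
  obtain h' where "kg_hom (M\<lparr>rep_space := W n\<rparr>) (tens r) h'" "\<forall>a\<in>W (Suc k). h' a = h a"
    using extend_along_weyl_filtration[of r M n W "Suc k" h, OF inf M W(3,4,5) Suc_leI[OF k(1)] h(1)] by blast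
  thus ?thesis using h(2) k(2) W(2) by (intro exI[of _ h']) simp
qed

section \<open>Finite-dimensional modules and contravariant duals\<close>

locale fin_prep = prep M r for M :: "('k::field, 'v::ab_group_add) rep" and r +
  fixes B :: "'v set"
  assumes finite_basis: "finite B" and independent_basis: "vs.independent B" and span_basis: "vs.span B = carr"
begin

abbreviation "D \<equiv> contravariant_dual M"

definition coord :: "'v \<Rightarrow> 'v \<Rightarrow> 'k" where
  "coord b v = vs.representation B v b"

lemma basis_in: "B \<subseteq> carr"
  using vs.span_superset[of B] by (simp add: span_basis)

lemma dual_space: "\<phi> \<in> rep_space D \<longleftrightarrow> linear_map_on carr scal (*) \<phi> \<and> (\<forall>v. v \<notin> carr \<longrightarrow> \<phi> v = 0)"
  by (simp add: contravariant_dual_def)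

lemma dual_act: "rep_act D g \<phi> v = (if v \<in> carr then \<phi> (act (transpose g) v) else 0)"
  by (simp add: contravariant_dual_def)

lemma dual_scale: "rep_scale D c \<phi> = (\<lambda>v. c * \<phi> v)"
  by (simp add: contravariant_dual_def)

lemma coord_in_dual: "coord b \<in> rep_space D"
  unfolding dual_space linear_map_on_def coord_def
proof (intro conjI ballI allI impI)
  fix x y c
  assume x: "x \<in> carr"
  show "vs.representation B (scal c x) b = c * vs.representation B x b"
    by (subst vs.representation_scale[OF independent_basis]) (use x span_basis in auto)
  assume y: "y \<in> carr"
  show "vs.representation B (x + y) b = vs.representation B x b + vs.representation B y b"
    by (subst vs.representation_add[OF independent_basis]) (use x y span_basis in auto)
next
  fix v assume "v \<notin> carr"
  thus "vs.representation B v b = 0" unfolding vs.representation_def span_basis by simp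
qed

lemma coord_sum: "v \<in> carr \<Longrightarrow> (\<Sum>b\<in>B. scal (coord b v) b) = v"
  unfolding coord_def by (rule vs.sum_representation_eq) (auto simp: finite_basis independent_basis span_basis)

lemma dual_apply:
  assumes "\<phi> \<in> rep_space D" "v \<in> carr"
  shows "\<phi> v = (\<Sum>b\<in>B. coord b v * \<phi> b)"
proof -
  have lin: "linear_map_on carr scal (*) \<phi>" using assms(1) unfolding dual_space by blast
  have "\<phi> v = \<phi> (\<Sum>b\<in>B. scal (coord b v) b)" by (simp only: coord_sum[OF assms(2)])
  also have "\<dots> = (\<Sum>b\<in>B. coord b v * \<phi> b)"
    by (rule linear_map_on_sum_scale[OF lin vs.vector_space_axioms carr_subspace]) (rule subsetD[OF basis_in])
  finally show ?thesis .
qed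

lemma dual_separates:
  assumes "v \<in> carr" "w \<in> carr" "\<And>\<phi>. \<phi> \<in> rep_space D \<Longrightarrow> \<phi> v = \<phi> w"
  shows "v = w"
proof -
  have "coord b v = coord b w" for b by (rule assms(3)[OF coord_in_dual])
  hence "(\<Sum>b\<in>B. scal (coord b v) b) = (\<Sum>b\<in>B. scal (coord b w) b)" by simp
  thus ?thesis unfolding coord_sum[OF assms(1)] coord_sum[OF assms(2)] .
qed

lemma extend_functional:
  assumes W: "vs.subspace W" "W \<subseteq> carr" and l: "linear_map_on W scal (*) l"
  shows "\<exists>\<phi>\<in>rep_space D. \<forall>x\<in>W. \<phi> x = l x"
proof -
  obtain B1 where B1: "B1 \<subseteq> W" "vs.independent B1" "W \<subseteq> vs.span B1"
    by (rule vs.basis_exists[of W])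
  have sB1: "vs.span B1 = W" using B1(1,3) W(1) vs.span_minimal by blast
  obtain B2 where B2: "B1 \<subseteq> B2" "B2 \<subseteq> carr" "vs.independent B2" "carr \<subseteq> vs.span B2"
    by (rule vs.maximal_independent_subset_extend[of B1 carr]) (use B1 W(2) in auto)
  have sB2: "vs.span B2 = carr" using B2(2,4) carr_subspace vs.span_minimal by blast
  have fin1: "finite B1"
    using vs.independent_span_bound[OF finite_basis B1(2)] B1(1) W(2) by (auto simp: span_basis)
  define \<phi> where "\<phi> v = (\<Sum>b\<in>B1. vs.representation B2 v b * l b)" for v
  have "\<phi> \<in> rep_space D"
    unfolding dual_space linear_map_on_def
  proof (intro conjI ballI allI impI)
    fix x y c
    assume x: "x \<in> carr"
    have "vs.representation B2 (scal c x) b = c * vs.representation B2 x b" for b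
      by (subst vs.representation_scale[OF B2(3)]) (use x sB2 in auto)
    thus "\<phi> (scal c x) = c * \<phi> x" by (simp add: \<phi>_def sum_distrib_left mult.assoc)
    assume y: "y \<in> carr"
    have "vs.representation B2 (x + y) b = vs.representation B2 x b + vs.representation B2 y b" for b
      by (subst vs.representation_add[OF B2(3)]) (use x y sB2 in auto)
    thus "\<phi> (x + y) = \<phi> x + \<phi> y" by (simp add: \<phi>_def distrib_right sum.distrib)
  next
    fix v assume "v \<notin> carr"
    thus "\<phi> v = 0" unfolding \<phi>_def vs.representation_def sB2 by simp
  qed
  moreover have "\<phi> x = l x" if x: "x \<in> W" for x
  proof -
    have "vs.representation B2 x = vs.representation B1 x"
      by (rule vs.representation_extend) (use B2 x sB1 in auto)
    hence "\<phi> x = (\<Sum>b\<in>B1. vs.representation B1 x b * l b)" by (simp add: \<phi>_def)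
    also have "\<dots> = l (\<Sum>b\<in>B1. scal (vs.representation B1 x b) b)"
      using B1(1) by (intro linear_map_on_sum_scale[OF l vs.vector_space_axioms W(1), symmetric]) auto
    also have "(\<Sum>b\<in>B1. scal (vs.representation B1 x b) b) = x"
      by (rule vs.sum_representation_eq) (use B1(2) x sB1 fin1 in auto)
    finally show ?thesis .
  qed
  ultimately show ?thesis by blast
qed

lemma vector_space_dual: "vector_space (rep_scale D)"
  by unfold_locales (simp_all add: dual_scale fun_eq_iff algebra_simps)

lemma subspace_annihilator:
  "module.subspace (rep_scale D) {\<phi> \<in> rep_space D. \<forall>x\<in>X. \<phi> x = 0}"
proof -
  interpret d: vector_space "rep_scale D" by (rule vector_space_dual)
  show ?thesis
    unfolding d.subspace_def dual_scale
    by (auto simp: dual_space linear_map_on_def algebra_simps)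
qed

lemma kg_module_dual: "kg_module D"
  unfolding kg_module_def
proof (intro conjI ballI vector_space_dual)
  show "module.subspace (rep_scale D) (rep_space D)" using subspace_annihilator[of "{}"] by simp
next
  fix g :: "'k^2^2" assume g: "g \<in> GL2"
  show "rep_act D g ` rep_space D \<subseteq> rep_space D"
    using g linear_act[of "transpose g"] carr_subspace
    by (auto simp: dual_space dual_act linear_map_on_def vs.subspace_add vs.subspace_scale)
  show "linear_map_on (rep_space D) (rep_scale D) (rep_scale D) (rep_act D g)"
    by (auto simp: linear_map_on_def dual_scale fun_eq_iff dual_act)
next
  fix \<phi> assume \<phi>: "\<phi> \<in> rep_space D"
  show "rep_act D (mat 1) \<phi> = \<phi>"
    using \<phi> by (auto simp: fun_eq_iff dual_act dual_space)
  fix g h :: "'k^2^2" assume gh: "g \<in> GL2" "h \<in> GL2"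
  show "rep_act D (g ** h) \<phi> = rep_act D g (rep_act D h \<phi>)"
    using gh by (auto simp: fun_eq_iff dual_act matrix_transpose_mul act_mult)
qed

end

definition transpose_exponent :: "(2 \<Rightarrow> 2 \<Rightarrow> nat) \<Rightarrow> 2 \<Rightarrow> 2 \<Rightarrow> nat" where
  "transpose_exponent m i j = m j i"

lemma transpose_exponent_involution: "transpose_exponent (transpose_exponent m) = m"
  by (simp add: transpose_exponent_def fun_eq_iff)

lemma matrix_monomial_transpose: "matrix_monomial (transpose_exponent m) g = matrix_monomial m (transpose g)"
  unfolding matrix_monomial_def transpose_def transpose_exponent_def by (simp add: UNIV_2 mult_ac)

lemma exponents_transpose: "transpose_exponent m \<in> exponents r \<longleftrightarrow> m \<in> exponents r"
  unfolding exponents_def transpose_exponent_def by (simp add: UNIV_2 add_ac)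

locale polynomial_rep = fin_prep M r B for M :: "('k::field, 'v::ab_group_add) rep" and r B +
  assumes coeffs_in: "\<And>v. v \<in> rep_space M \<Longrightarrow> \<exists>c. (\<forall>m. c m \<in> rep_space M) \<and> (\<forall>g\<in>GL2.
        rep_act M g v = (\<Sum>m\<in>exponents r. rep_scale M (matrix_monomial m g) (c m)))"
begin

lemma poly_rep_dual: "poly_rep r D"
  unfolding poly_rep_def
proof (intro conjI kg_module_dual ballI)
  fix \<phi> assume \<phi>: "\<phi> \<in> rep_space D"
  hence lin: "linear_map_on carr scal (*) \<phi>" unfolding dual_space by blast
  have "\<forall>v\<in>carr. \<exists>c. (\<forall>m. c m \<in> carr) \<and>
      (\<forall>g\<in>GL2. act g v = (\<Sum>m\<in>exponents r. scal (matrix_monomial m g) (c m)))"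
    by (rule ballI) (rule coeffs_in)
  from bchoice[OF this] obtain c where "\<forall>v\<in>carr. (\<forall>m. c v m \<in> carr) \<and>
      (\<forall>g\<in>GL2. act g v = (\<Sum>m\<in>exponents r. scal (matrix_monomial m g) (c v m)))"
    by (elim exE) (rule that)
  hence c: "\<And>v m. v \<in> carr \<Longrightarrow> c v m \<in> carr"
    "\<And>v g. v \<in> carr \<Longrightarrow> g \<in> GL2 \<Longrightarrow> act g v = (\<Sum>m\<in>exponents r. scal (matrix_monomial m g) (c v m))"
    by simp_all
  define C where "C m v = (if v \<in> carr then \<phi> (c v (transpose_exponent m)) else 0)" for m v
  have "rep_act D g \<phi> = (\<Sum>m\<in>exponents r. rep_scale D (matrix_monomial m g) (C m))" if g: "g \<in> GL2" for g
  proof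
    fix v
    have apply_sum: "(\<Sum>m\<in>I. F m) v = (\<Sum>m\<in>I. F m v)" for I and F :: "_ \<Rightarrow> 'v \<Rightarrow> 'k"
      by (induction I rule: infinite_finite_induct) auto
    show "rep_act D g \<phi> v = (\<Sum>m\<in>exponents r. rep_scale D (matrix_monomial m g) (C m)) v"
    proof (cases "v \<in> carr")
      case True
      have "rep_act D g \<phi> v = \<phi> (act (transpose g) v)" using True by (simp add: dual_act)
      also have "act (transpose g) v = (\<Sum>m\<in>exponents r. scal (matrix_monomial m (transpose g)) (c v m))"
        using c(2) True g by simp
      also have "\<phi> \<dots> = (\<Sum>m\<in>exponents r. matrix_monomial m (transpose g) * \<phi> (c v m))"
        by (rule linear_map_on_sum_scale[OF lin vs.vector_space_axioms carr_subspace]) (rule c(1)[OF True])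
      also have "\<dots> = (\<Sum>m\<in>exponents r. matrix_monomial m g * C m v)"
        by (rule sum.reindex_bij_witness[of _ transpose_exponent transpose_exponent])
           (simp_all add: exponents_transpose matrix_monomial_transpose C_def True transpose_exponent_involution)
      finally show ?thesis by (simp add: apply_sum dual_scale)
    next
      case False
      then show ?thesis by (simp add: dual_act apply_sum dual_scale C_def)
    qed
  qed
  thus "\<exists>C. \<forall>g\<in>GL2. rep_act D g \<phi> = (\<Sum>m\<in>exponents r. rep_scale D (matrix_monomial m g) (C m))"
    by (intro exI[of _ C]) simp
qed

lemma dual_weight:
  assumes no: "\<not> is_weight M (r, 0)"
  shows "\<not> is_weight D (r, 0)"
proof
  assume "is_weight D (r, 0)"
  moreover have "0 \<in> weight_space D (r, 0)"
    by (auto simp: weight_space_def dual_space dual_act dual_scale linear_map_on_def fun_eq_iff)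
  ultimately obtain \<phi> where \<phi>: "\<phi> \<in> weight_space D (r, 0)" "\<phi> \<noteq> 0" unfolding is_weight_def by blast
  hence \<phi>D: "\<phi> \<in> rep_space D" by (simp add: weight_space_def)
  hence lin: "linear_map_on carr scal (*) \<phi>" unfolding dual_space by blast
  obtain x where x: "\<phi> x \<noteq> 0" using \<phi>(2) by (auto simp: fun_eq_iff)
  hence xc: "x \<in> carr" using \<phi>D by (auto simp: dual_space)
  obtain z where z: "\<And>i. z i \<in> carr" "\<And>i. i \<le> r \<Longrightarrow> z i \<in> weight_space M (i, r - i)"
    "\<And>s t. s \<noteq> 0 \<Longrightarrow> t \<noteq> 0 \<Longrightarrow> act (diag2 s t) x = (\<Sum>i\<le>r. scal (s ^ i * t ^ (r - i)) (z i))"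
    by (rule weight_components[OF xc carr_subspace _ order_refl]) (use xc in auto)
  have inf': "infinite (- {0::'k})" using inf by (simp add: Compl_eq_Diff_UNIV)
  have "\<phi> (z r) = (if r = r then \<phi> x else 0)"
  proof (rule vector_space_over_itself.poly_curve_unique[OF inf' _ order_refl, where y = "\<lambda>i. \<phi> (z i)"
        and z = "\<lambda>i. if i = r then \<phi> x else 0"])
    fix s :: 'k assume s: "s \<in> - {0}"
    have "(\<Sum>j\<le>r. s ^ j * \<phi> (z j)) = \<phi> (\<Sum>j\<le>r. scal (s ^ j) (z j))"
      by (rule linear_map_on_sum_scale[OF lin vs.vector_space_axioms carr_subspace z(1), symmetric])
    also have "\<dots> = rep_act D (diag2 s 1) \<phi> x"
      using s xc z(3)[of s 1] by (simp add: dual_act diag2_mat2 transpose_mat2)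
    also have "\<dots> = s ^ r * \<phi> x"
      using \<phi>(1) s by (simp add: weight_space_def dual_scale)
    also have "\<dots> = (\<Sum>j\<le>r. if j = r then s ^ j * \<phi> x else 0)" by simp
    also have "\<dots> = (\<Sum>j\<le>r. s ^ j * (if j = r then \<phi> x else 0))" by (intro sum.cong) auto
    finally show "(\<Sum>j\<le>r. s ^ j * \<phi> (z j)) = (\<Sum>j\<le>r. s ^ j * (if j = r then \<phi> x else 0))" .
  qed
  with x have "\<phi> (z r) \<noteq> 0" by simp
  hence "z r \<noteq> 0" using linear_map_on_zero[OF lin vs.subspace_0[OF carr_subspace]] by auto
  with z(2)[of r] have "weight_space M (r, 0) \<noteq> {0}" by auto
  with no show False unfolding is_weight_def by simp
qed

text \<open>
  A functional with value \<open>1\<close> at \<open>v\<close> keeps this value when it is replaced by its component of the weight of \<open>v\<close>.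
\<close>
lemma dual_weight_vector:
  assumes v: "v \<in> weight_space M (r - 1, 1)" "v \<noteq> 0"
    and r: "r \<ge> 2"
  shows "\<exists>\<phi>\<in>weight_space D (r - 1, 1). \<phi> v = 1"
proof -
  have vc: "v \<in> carr" using v(1) by (simp add: weight_space_def)
  have 0: "0 \<in> carr" using carr_subspace by (rule vs.subspace_0)
  have "\<not> (\<forall>\<phi>\<in>rep_space D. \<phi> v = \<phi> 0)" using dual_separates[OF vc 0] v(2) by blast
  then obtain \<psi> where \<psi>: "\<psi> \<in> rep_space D" "\<psi> v \<noteq> \<psi> 0" by blast
  moreover have "\<psi> 0 = 0" using \<psi>(1) linear_map_on_zero[OF _ 0] unfolding dual_space by blast
  ultimately have c: "\<psi> v \<noteq> 0" by simp
  interpret d: prep D r by (rule prepI[OF poly_rep_dual inf])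
  define \<phi> where "\<phi> = rep_scale D (inverse (\<psi> v)) \<psi>"
  have \<phi>: "\<phi> \<in> rep_space D" unfolding \<phi>_def using \<psi>(1) by (rule d.vs.subspace_scale[OF d.carr_subspace])
  have \<phi>v: "\<phi> v = 1" using c by (simp add: \<phi>_def dual_scale)
  obtain z where z: "\<And>i. z i \<in> rep_space D" "\<And>i. i \<le> r \<Longrightarrow> z i \<in> weight_space D (i, r - i)"
    "\<And>s t. s \<noteq> 0 \<Longrightarrow> t \<noteq> 0 \<Longrightarrow> rep_act D (diag2 s t) \<phi> = (\<Sum>i\<le>r. rep_scale D (s ^ i * t ^ (r - i)) (z i))"
    by (rule d.weight_components[OF \<phi> d.carr_subspace _ order_refl]) (use \<phi> in auto)
  have inf': "infinite (- {0::'k})" using inf by (simp add: Compl_eq_Diff_UNIV)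
  have "z (r - 1) v = (if r - 1 = r - 1 then 1 else 0)"
  proof (rule vector_space_over_itself.poly_curve_unique[OF inf' _ diff_le_self[of r 1], where y = "\<lambda>i. z i v"
        and z = "\<lambda>i. if i = r - 1 then 1 else 0"])
    fix s :: 'k assume s: "s \<in> - {0}"
    have apply_sum: "(\<Sum>i\<in>I. F i) v = (\<Sum>i\<in>I. F i v)" for I and F :: "nat \<Rightarrow> 'v \<Rightarrow> 'k"
      by (induction I rule: infinite_finite_induct) auto
    have "(\<Sum>j\<le>r. s ^ j * z j v) = rep_act D (diag2 s 1) \<phi> v"
      using s by (simp add: z(3) apply_sum) (simp add: dual_scale)
    also have "\<dots> = \<phi> (act (diag2 s 1) v)" using vc by (simp add: dual_act diag2_mat2 transpose_mat2)
    also have "act (diag2 s 1) v = scal (s ^ (r - 1)) v" using v(1) s by (simp add: weight_space_def)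
    also have "\<phi> (scal (s ^ (r - 1)) v) = s ^ (r - 1)"
      using \<phi> linear_map_on_scale[OF _ vc, of scal "(*)" \<phi>] \<phi>v unfolding dual_space by simp
    also have "\<dots> = (\<Sum>j\<le>r. if j = r - 1 then s ^ j else 0)" by simp
    also have "\<dots> = (\<Sum>j\<le>r. s ^ j * (if j = r - 1 then 1 else 0))" by (intro sum.cong) auto
    finally show "(\<Sum>j\<le>r. s ^ j * z j v) = (\<Sum>j\<le>r. s ^ j * (if j = r - 1 then 1 else 0))" .
  qed
  moreover have "z (r - 1) \<in> weight_space D (r - 1, 1)" using z(2)[of "r - 1"] r by simp
  ultimately show ?thesis by (intro bexI[of _ "z (r - 1)"]) simp_all
qed

end

lemma polynomial_module_imp_polynomial_rep:
  fixes M :: "('k::field, 'v::ab_group_add) rep"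
  assumes inf: "infinite (UNIV :: 'k set)" and M: "polynomial_module r M"
  shows "\<exists>B. polynomial_rep M r B"
proof -
  have kgM: "kg_module M" using M by (simp add: polynomial_module_def)
  interpret kg M by unfold_locales (rule kgM)
  obtain B0 where B0: "finite B0" "vs.span B0 = carr" using M unfolding polynomial_module_def by blast
  obtain B where B: "B \<subseteq> carr" "vs.independent B" "carr \<subseteq> vs.span B"
    by (rule vs.basis_exists[of carr])
  have span: "vs.span B = carr" using B(1,3) carr_subspace vs.span_minimal by blast
  have fin: "finite B" using vs.independent_span_bound[OF B0(1) B(2)] B(1) B0(2) by simp
  have coeffs: "\<exists>c. (\<forall>m. c m \<in> carr) \<and> (\<forall>g\<in>GL2. act g v = (\<Sum>m\<in>exponents r. scal (matrix_monomial m g) (c m)))"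
    if v: "v \<in> carr" for v
  proof -
    have "linear_map_on carr scal (*) (\<lambda>x. vs.representation B x b)" for b
      unfolding linear_map_on_def
    proof (intro conjI ballI allI)
      fix x y c assume x: "x \<in> carr"
      show "vs.representation B (scal c x) b = c * vs.representation B x b"
        by (subst vs.representation_scale[OF B(2)]) (use x span in auto)
      assume y: "y \<in> carr"
      show "vs.representation B (x + y) b = vs.representation B x b + vs.representation B y b"
        by (subst vs.representation_add[OF B(2)]) (use x y span in auto)
    qed
    hence "homogeneous_poly_fun r (\<lambda>g. vs.representation B (act g v) b)" for b
      using M v unfolding polynomial_module_def by blast
    hence "\<forall>b. \<exists>c. \<forall>g\<in>GL2. vs.representation B (act g v) b = (\<Sum>m\<in>exponents r. c m * matrix_monomial m g)"
      unfolding homogeneous_poly_fun_def exponents_def matrix_monomial_def by simp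
    from choice[OF this] obtain c where c: "\<forall>b. \<forall>g\<in>GL2. vs.representation B (act g v) b = (\<Sum>m\<in>exponents r. c b m * matrix_monomial m g)"
      by (elim exE) (rule that)
    define C where "C m = (\<Sum>b\<in>B. scal (c b m) b)" for m
    have "act g v = (\<Sum>m\<in>exponents r. scal (matrix_monomial m g) (C m))" if g: "g \<in> GL2" for g
    proof -
      have "act g v = (\<Sum>b\<in>B. scal (vs.representation B (act g v) b) b)"
        by (rule vs.sum_representation_eq[symmetric]) (use fin B(2) g v span in auto)
      also have "\<dots> = (\<Sum>b\<in>B. \<Sum>m\<in>exponents r. scal (c b m * matrix_monomial m g) b)"
        using c g by (simp add: vs.scale_sum_left)
      also have "\<dots> = (\<Sum>m\<in>exponents r. \<Sum>b\<in>B. scal (c b m * matrix_monomial m g) b)" by (rule sum.swap)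
      also have "\<dots> = (\<Sum>m\<in>exponents r. scal (matrix_monomial m g) (C m))"
        by (simp add: C_def vs.scale_sum_right mult.commute)
      finally show ?thesis .
    qed
    moreover have "C m \<in> carr" for m
      unfolding C_def by (intro vs.subspace_sum vs.subspace_scale carr_subspace) (use B(1) in auto)
    ultimately show ?thesis by (intro exI[of _ C]) simp
  qed
  have "poly_rep r M"
    unfolding poly_rep_def
  proof (intro conjI kgM ballI)
    fix v assume "v \<in> carr"
    from coeffs[OF this] show "\<exists>c. \<forall>g\<in>GL2. act g v = (\<Sum>m\<in>exponents r. scal (matrix_monomial m g) (c m))"
      by (elim exE conjE) (rule exI)
  qed
  then interpret prep M r by (rule prepI[OF _ inf])
  have "polynomial_rep M r B"
    by unfold_locales (fact fin B(2) span coeffs)+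
  thus ?thesis by (rule exI)
qed

context polynomial_rep
begin

definition annihilator :: "'v set \<Rightarrow> ('v \<Rightarrow> 'k) set" where
  "annihilator X = {\<phi> \<in> rep_space D. \<forall>x\<in>X. \<phi> x = 0}"

lemma submodule_annihilator:
  assumes "submodule X M"
  shows "submodule (annihilator X) D"
  unfolding submodule_def
proof (intro conjI ballI)
  show "module.subspace (rep_scale D) (annihilator X)" unfolding annihilator_def by (rule subspace_annihilator)
  show "annihilator X \<subseteq> rep_space D" by (auto simp: annihilator_def)
  fix g :: "'k^2^2" assume g: "g \<in> GL2"
  show "rep_act D g ` annihilator X \<subseteq> annihilator X"
  proof (rule image_subsetI)
    fix \<phi> assume \<phi>: "\<phi> \<in> annihilator X"
    have "rep_act D g \<phi> \<in> rep_space D" using \<phi> g kg_moduleD(3)[OF kg_module_dual] by (simp add: annihilator_def)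
    moreover have "rep_act D g \<phi> x = 0" if "x \<in> X" for x
    proof -
      have "act (transpose g) x \<in> X" using assms g that by (simp add: submodule_def image_subset_iff)
      thus ?thesis using \<phi> by (simp add: annihilator_def dual_act)
    qed
    ultimately show "rep_act D g \<phi> \<in> annihilator X" by (simp add: annihilator_def)
  qed
qed

text \<open>
  A functional on \<open>Y\<close> that vanishes on \<open>X\<close> is a functional on \<open>Y/X\<close>, hence on the dual Weyl module. This map is onto because
  functionals on \<open>Y\<close> extend to the whole module.
\<close>
lemma section_iso_annihilator:
  assumes X: "submodule X M" "submodule Y M" and XY: "section_iso M X Y (dual_weyl \<mu>)"
  shows "section_iso D (annihilator Y) (annihilator X) (weyl \<mu>)"
proof -
  obtain q where q: "kg_hom (M\<lparr>rep_space := Y\<rparr>) (dual_weyl \<mu>) q" "q ` Y = rep_space (dual_weyl \<mu>)" "{v \<in> Y. q v = 0} = X"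
    using XY unfolding section_iso_def by (elim exE conjE) (rule that)
  note qD = kg_homD[OF q(1), simplified]
  have Y: "vs.subspace Y" "Y \<subseteq> carr" "\<And>g x. g \<in> GL2 \<Longrightarrow> x \<in> Y \<Longrightarrow> act g x \<in> Y"
    using X(2) by (auto simp: submodule_def)
  define n where "n = fst \<mu> - snd \<mu>"
  have qY: "q ` Y = {f. degree f \<le> n}" using q(2) by (simp add: dual_weyl_def n_def)
  define pick where "pick = inv_into Y q"
  have pick: "pick f \<in> Y" "q (pick f) = f" if "degree f \<le> n" for f
    using that qY inv_into_into[of f q Y] f_inv_into_f[of f q Y] by (auto simp: pick_def)
  have qdeg: "degree (q x) \<le> n" if "x \<in> Y" for x using that qY by auto
  define F where "F \<phi> f = (if degree f \<le> n then \<phi> (pick f) else 0)" for \<phi> :: "'v \<Rightarrow> 'k" and f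
  have lin: "linear_map_on carr scal (*) \<phi>" if "\<phi> \<in> annihilator X" for \<phi>
    using that unfolding annihilator_def dual_space by simp
  have Fq: "F \<phi> (q x) = \<phi> x" if \<phi>: "\<phi> \<in> annihilator X" and x: "x \<in> Y" for \<phi> x
  proof -
    let ?y = "pick (q x)"
    have y: "?y \<in> Y" "q ?y = q x" using pick[OF qdeg[OF x]] by simp_all
    have "q (x - ?y) = 0" using linear_map_on_diff[OF qD(2) vs.vector_space_axioms Y(1) x y(1)] y(2) by simp
    moreover have "x - ?y \<in> Y" using Y(1) x y(1) by (rule vs.subspace_diff)
    ultimately have "x - ?y \<in> X" unfolding q(3)[symmetric] by simp
    hence "\<phi> (x - ?y) = 0" using \<phi> by (simp add: annihilator_def)
    moreover have "\<phi> (x - ?y) = \<phi> x - \<phi> ?y"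
      by (rule linear_map_on_diff[OF lin[OF \<phi>] vs.vector_space_axioms carr_subspace]) (use x y Y(2) in auto)
    ultimately show ?thesis using qdeg[OF x] by (simp add: F_def)
  qed
  have F_add: "F \<phi> (f + g) = F \<phi> f + F \<phi> g" and F_scale: "F \<phi> (smult c f) = c * F \<phi> f"
    if \<phi>: "\<phi> \<in> annihilator X" and fg: "degree f \<le> n" "degree g \<le> n" for \<phi> f g c
  proof -
    note pf = pick[OF fg(1)] and pg = pick[OF fg(2)]
    have c: "pick f \<in> carr" "pick g \<in> carr" using pf(1) pg(1) Y(2) by auto
    have "q (pick f + pick g) = f + g" using linear_map_on_add[OF qD(2) pf(1) pg(1)] pf(2) pg(2)
      by (simp add: dual_weyl_def)
    hence "F \<phi> (f + g) = \<phi> (pick f + pick g)" using Fq[OF \<phi> vs.subspace_add[OF Y(1) pf(1) pg(1)]] by simp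
    also have "\<dots> = \<phi> (pick f) + \<phi> (pick g)" by (rule linear_map_on_add[OF lin[OF \<phi>] c])
    finally show "F \<phi> (f + g) = F \<phi> f + F \<phi> g" using fg by (simp add: F_def)
    have "q (scal c (pick f)) = smult c f" using linear_map_on_scale[OF qD(2) pf(1)] pf(2)
      by (simp add: dual_weyl_def)
    hence "F \<phi> (smult c f) = \<phi> (scal c (pick f))" using Fq[OF \<phi> vs.subspace_scale[OF Y(1) pf(1)]] by metis
    also have "\<dots> = c * \<phi> (pick f)" by (rule linear_map_on_scale[OF lin[OF \<phi>] c(1)])
    finally show "F \<phi> (smult c f) = c * F \<phi> f" using fg by (simp add: F_def)
  qed
  have F_in: "F \<phi> \<in> rep_space (weyl \<mu>)" if "\<phi> \<in> annihilator X" for \<phi>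
    using F_add[OF that] F_scale[OF that]
    unfolding weyl_def contravariant_dual_def dual_weyl_def linear_map_on_def n_def[symmetric]
    by (simp add: F_def)
  have F_act: "F (rep_act D g \<phi>) = rep_act (weyl \<mu>) g (F \<phi>)" if \<phi>: "\<phi> \<in> annihilator X" and g: "g \<in> GL2" for \<phi> g
  proof
    fix f :: "'k poly"
    show "F (rep_act D g \<phi>) f = rep_act (weyl \<mu>) g (F \<phi>) f"
    proof (cases "degree f \<le> n")
      case True
      note pf = pick[OF True]
      have tg: "transpose g \<in> GL2" using g by simp
      have "rep_act (weyl \<mu>) g (F \<phi>) f = F \<phi> (rep_act (dual_weyl \<mu>) (transpose g) f)"
        using True by (simp add: weyl_def contravariant_dual_def dual_weyl_def n_def)
      also have "rep_act (dual_weyl \<mu>) (transpose g) f = q (act (transpose g) (pick f))"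
        using qD(3)[OF tg pf(1)] pf(2) by simp
      also have "F \<phi> \<dots> = \<phi> (act (transpose g) (pick f))" by (rule Fq[OF \<phi> Y(3)[OF tg pf(1)]])
      also have "\<dots> = rep_act D g \<phi> (pick f)" using pf(1) Y(2) by (auto simp: dual_act)
      finally have "rep_act (weyl \<mu>) g (F \<phi>) f = rep_act D g \<phi> (pick f)" .
      moreover have "F (rep_act D g \<phi>) f = rep_act D g \<phi> (pick f)" using True by (simp only: F_def if_True)
      ultimately show ?thesis by (simp only:)
    next
      case False
      then show ?thesis by (simp add: F_def weyl_act_outside n_def)
    qed
  qed
  have F_hom: "kg_hom (D\<lparr>rep_space := annihilator X\<rparr>) (weyl \<mu>) F"
    unfolding kg_hom_def
  proof (intro conjI ballI)
    show "F ` rep_space (D\<lparr>rep_space := annihilator X\<rparr>) \<subseteq> rep_space (weyl \<mu>)" using F_in by auto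
    show "linear_map_on (rep_space (D\<lparr>rep_space := annihilator X\<rparr>)) (rep_scale (D\<lparr>rep_space := annihilator X\<rparr>)) (rep_scale (weyl \<mu>)) F"
      unfolding linear_map_on_def by (simp add: F_def fun_eq_iff dual_scale) (simp add: weyl_def contravariant_dual_def F_def)
  qed (use F_act in auto)
  moreover have "{\<phi> \<in> annihilator X. F \<phi> = 0} = annihilator Y"
  proof (intro equalityI subsetI)
    fix \<phi> assume "\<phi> \<in> {\<phi> \<in> annihilator X. F \<phi> = 0}"
    hence \<phi>: "\<phi> \<in> annihilator X" "F \<phi> = 0" by simp_all
    have "\<phi> x = 0" if "x \<in> Y" for x using Fq[OF \<phi>(1) that] \<phi>(2) by simp
    thus "\<phi> \<in> annihilator Y" using \<phi>(1) by (simp add: annihilator_def)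
  next
    fix \<phi> assume \<phi>: "\<phi> \<in> annihilator Y"
    hence "\<phi> \<in> annihilator X" using q(3) by (auto simp: annihilator_def)
    moreover have "F \<phi> = 0" using \<phi> pick(1) by (auto simp: F_def annihilator_def fun_eq_iff)
    ultimately show "\<phi> \<in> {\<phi> \<in> annihilator X. F \<phi> = 0}" by simp
  qed
  moreover have "F ` annihilator X = rep_space (weyl \<mu>)"
  proof (intro equalityI subsetI)
    fix \<psi> :: "'k poly \<Rightarrow> 'k" assume \<psi>: "\<psi> \<in> rep_space (weyl \<mu>)"
    hence lin\<psi>: "linear_map_on {f. degree f \<le> n} smult (*) \<psi>" and out: "\<And>f. \<not> degree f \<le> n \<Longrightarrow> \<psi> f = 0"
      by (simp_all add: weyl_def contravariant_dual_def dual_weyl_def n_def)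
    have "linear_map_on Y scal smult q" using qD(2) by (simp add: dual_weyl_def)
    hence "linear_map_on Y scal (*) (\<lambda>x. \<psi> (q x))"
      by (rule linear_map_on_compose[OF _ lin\<psi>]) (simp add: qY)
    from extend_functional[OF Y(1,2) this] obtain \<phi> where \<phi>: "\<phi> \<in> rep_space D" "\<forall>x\<in>Y. \<phi> x = \<psi> (q x)"
      by (elim bexE) (rule that)
    have "\<psi> 0 = 0" by (rule linear_map_on_zero[OF lin\<psi>]) simp
    hence "\<phi> x = 0" if "x \<in> X" for x using that \<phi>(2) q(3) by auto
    hence "\<phi> \<in> annihilator X" using \<phi>(1) by (simp add: annihilator_def)
    moreover have "F \<phi> = \<psi>"
    proof
      fix f show "F \<phi> f = \<psi> f" using pick[of f] \<phi>(2) out[of f] by (cases "degree f \<le> n") (simp_all add: F_def)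
    qed
    ultimately show "\<psi> \<in> F ` annihilator X" by auto
  qed (use F_in in auto)
  ultimately show ?thesis unfolding section_iso_def by (intro exI[of _ F]) simp
qed

lemma dual_filtration:
  assumes "has_filtration M (dual_weyl ` S)"
  shows "has_filtration D (weyl ` S)"
proof -
  obtain n W where W: "W 0 = {0} \<and> W n = carr \<and> (\<forall>i\<le>n. submodule (W i) M) \<and>
      (\<forall>i<n. W i \<subseteq> W (Suc i) \<and> (\<exists>N\<in>dual_weyl ` S. section_iso M (W i) (W (Suc i)) N))"
    using assms unfolding has_filtration_def by (elim exE) (rule that)
  define U where "U i = annihilator (W (n - i))" for i
  have "U 0 = {0}"
  proof -
    have "\<phi> = 0" if "\<phi> \<in> U 0" for \<phi>
      using that W by (auto simp: U_def annihilator_def dual_space fun_eq_iff)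
    moreover have "0 \<in> U 0" by (auto simp: U_def annihilator_def dual_space linear_map_on_def)
    ultimately show ?thesis by blast
  qed
  moreover have "U n = rep_space D"
    using W linear_map_on_zero[OF _ vs.subspace_0[OF carr_subspace]]
    by (auto simp: U_def annihilator_def dual_space)
  moreover have "submodule (U i) D" if "i \<le> n" for i
    unfolding U_def by (rule submodule_annihilator) (use W in simp)
  moreover have "U i \<subseteq> U (Suc i) \<and> (\<exists>N\<in>weyl ` S. section_iso D (U i) (U (Suc i)) N)" if i: "i < n" for i
  proof -
    let ?j = "n - Suc i"
    have j: "Suc ?j = n - i" "?j < n" using i by auto
    hence WW: "W ?j \<subseteq> W (n - i)" "\<exists>N\<in>dual_weyl ` S. section_iso M (W ?j) (W (n - i)) N"
      using W by (metis j)+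
    then obtain \<mu> where \<mu>: "\<mu> \<in> S" "section_iso M (W ?j) (W (n - i)) (dual_weyl \<mu>)" by (elim bexE imageE) (simp add: that)
    have "section_iso D (U i) (U (Suc i)) (weyl \<mu>)"
      unfolding U_def by (rule section_iso_annihilator[OF _ _ \<mu>(2)]) (use W in simp_all)
    moreover have "U i \<subseteq> U (Suc i)" using WW(1) by (auto simp: U_def annihilator_def)
    ultimately show ?thesis using \<mu>(1) by blast
  qed
  ultimately show ?thesis unfolding has_filtration_def by (intro exI[of _ n] exI[of _ U]) simp
qed

end

text \<open>
  The form for which the words are orthonormal. It is contravariant, so it identifies \<open>E\<^sup>\<otimes>\<^sup>r\<close> with its contravariant dual.
\<close>
definition word_pairing :: "nat \<Rightarrow> 'k::field tensor \<Rightarrow> 'k tensor \<Rightarrow> 'k" where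
  "word_pairing r x y = (\<Sum>w | length w = r. x w * y w)"

lemma word_pairing_adjoint:
  "word_pairing r x (tensor_act g y) = word_pairing r (tensor_act (transpose g) x) y"
proof -
  have "word_pairing r x (tensor_act g y) =
     (\<Sum>w | length w = r. \<Sum>v | length v = r. (\<Prod>i<r. g $ (w ! i) $ (v ! i)) * x w * y v)"
    by (simp add: word_pairing_def tensor_act_def sum_distrib_left mult_ac)
  also have "\<dots> = (\<Sum>v | length v = r. \<Sum>w | length w = r. (\<Prod>i<r. g $ (w ! i) $ (v ! i)) * x w * y v)"
    by (rule sum.swap)
  also have "\<dots> = word_pairing r (tensor_act (transpose g) x) y"
    by (simp add: word_pairing_def tensor_act_def sum_distrib_right transpose_def)
  finally show ?thesis .
qed

lemma word_pairing_linear: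
  "word_pairing r (x + x') y = word_pairing r x y + word_pairing r x' y"
  "word_pairing r x (y + y') = word_pairing r x y + word_pairing r x y'"
  "word_pairing r (tensor_scale c x) y = c * word_pairing r x y"
  "word_pairing r x (tensor_scale c y) = c * word_pairing r x y"
  by (simp_all add: word_pairing_def tensor_scale_def algebra_simps sum.distrib sum_distrib_left)

text \<open>
  The transpose of \<open>a\<close>, where the double dual of \<open>M\<close> is identified with \<open>M\<close> through a basis.
\<close>
lemma (in polynomial_rep) transposed_hom:
  assumes a: "kg_hom D (tens r) a"
  shows "\<exists>b. kg_hom (tens r) M b \<and> (\<forall>\<phi>\<in>rep_space D. \<forall>y. \<phi> (b y) = word_pairing r (a \<phi>) y)"
proof -
  note aD = kg_homD[OF a, simplified]
  define b where "b y = (\<Sum>\<beta>\<in>B. scal (word_pairing r (a (coord \<beta>)) y) \<beta>)" for y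
  have b_in: "b y \<in> carr" for y
    unfolding b_def by (intro vs.subspace_sum vs.subspace_scale carr_subspace) (use basis_in in auto)
  have lin_pair: "linear_map_on (rep_space D) (rep_scale D) (*) (\<lambda>\<phi>. word_pairing r (a \<phi>) y)" for y
    using linear_map_on_add[OF aD(2)] linear_map_on_scale[OF aD(2)]
    unfolding linear_map_on_def by (simp add: word_pairing_linear)
  have apply_sum: "(\<Sum>m\<in>I. F m) v = (\<Sum>m\<in>I. F m v)" for I v and F :: "'v \<Rightarrow> 'v \<Rightarrow> 'k"
    by (induction I rule: infinite_finite_induct) auto
  have b: "\<phi> (b y) = word_pairing r (a \<phi>) y" if \<phi>: "\<phi> \<in> rep_space D" for \<phi> y
  proof -
    have lin: "linear_map_on carr scal (*) \<phi>" using \<phi> unfolding dual_space by simp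
    have "\<phi> = (\<Sum>\<beta>\<in>B. rep_scale D (\<phi> \<beta>) (coord \<beta>))"
    proof
      fix v
      show "\<phi> v = (\<Sum>\<beta>\<in>B. rep_scale D (\<phi> \<beta>) (coord \<beta>)) v"
      proof (cases "v \<in> carr")
        case True
        then show ?thesis using dual_apply[OF \<phi> True] by (simp add: apply_sum) (simp add: dual_scale mult.commute)
      next
        case False
        moreover have "coord \<beta> v = 0" for \<beta> using coord_in_dual False unfolding dual_space by simp
        ultimately show ?thesis using \<phi> unfolding dual_space by (simp add: apply_sum) (simp add: dual_scale)
      qed
    qed
    hence "word_pairing r (a \<phi>) y = word_pairing r (a (\<Sum>\<beta>\<in>B. rep_scale D (\<phi> \<beta>) (coord \<beta>))) y" by simp
    also have "\<dots> = (\<Sum>\<beta>\<in>B. \<phi> \<beta> * word_pairing r (a (coord \<beta>)) y)"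
      by (rule linear_map_on_sum_scale[OF lin_pair vector_space_dual kg_moduleD(2)[OF kg_module_dual] coord_in_dual])
    also have "\<dots> = \<phi> (b y)"
      unfolding b_def
      by (subst linear_map_on_sum_scale[OF lin vs.vector_space_axioms carr_subspace])
         (use basis_in in \<open>auto simp: mult.commute\<close>)
    finally show ?thesis by simp
  qed
  have "kg_hom (tens r) M b"
    unfolding kg_hom_def
  proof (intro conjI ballI)
    show "b ` rep_space (tens r) \<subseteq> carr" using b_in by auto
    show "linear_map_on (rep_space (tens r)) (rep_scale (tens r)) scal b"
      unfolding linear_map_on_def b_def
      by (simp add: word_pairing_linear vs.scale_left_distrib sum.distrib vs.scale_sum_right)
    fix g :: "'k^2^2" and y assume g: "g \<in> GL2"
    show "b (rep_act (tens r) g y) = act g (b y)"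
    proof (rule dual_separates)
      show "b (rep_act (tens r) g y) \<in> carr" "act g (b y) \<in> carr" using b_in g by simp_all
      fix \<phi> assume \<phi>: "\<phi> \<in> rep_space D"
      have tg: "transpose g \<in> GL2" using g by simp
      have "\<phi> (b (rep_act (tens r) g y)) = word_pairing r (tensor_act (transpose g) (a \<phi>)) y"
        by (simp add: b[OF \<phi>] word_pairing_adjoint)
      also have "tensor_act (transpose g) (a \<phi>) = a (rep_act D (transpose g) \<phi>)" using aD(3)[OF tg \<phi>] by simp
      also have "word_pairing r \<dots> y = rep_act D (transpose g) \<phi> (b y)"
        by (rule b[symmetric]) (rule kg_moduleD(3)[OF kg_module_dual tg \<phi>])
      also have "\<dots> = \<phi> (act g (b y))" using b_in by (simp add: dual_act)
      finally show "\<phi> (b (rep_act (tens r) g y)) = \<phi> (act g (b y))" .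
    qed
  qed
  thus ?thesis using b by (intro exI[of _ b]) simp
qed

section \<open>The free Lie algebra\<close>

definition lie_bracket :: "'k::field tensor \<Rightarrow> 'k tensor \<Rightarrow> 'k tensor" where
  "lie_bracket x y = tensor_mult x y - tensor_mult y x"

definition word_tensor :: "2 list \<Rightarrow> 'k::field tensor" where
  "word_tensor v = (\<lambda>w. if w = v then 1 else 0)"

lemma tensor_mult_Nil [simp]: "tensor_mult x y [] = x [] * y []"
  by (simp add: tensor_mult_def)

lemma tensor_mult_Cons:
  "tensor_mult x y (a # w) = x [] * y (a # w) + tensor_mult (\<lambda>v. x (a # v)) y w"
  unfolding tensor_mult_def length_Cons by (subst sum.atMost_Suc_shift) simp

lemma tensor_mult_left_linear:
  "tensor_mult (\<lambda>v. x v + x' v) y w = tensor_mult x y w + tensor_mult x' y w"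
  "tensor_mult (\<lambda>v. c * x v) y w = c * tensor_mult x y w"
  "tensor_mult (\<lambda>v. 0) y w = 0"
  by (simp_all add: tensor_mult_def algebra_simps sum.distrib sum_distrib_left)

lemma tensor_mult_linear:
  "tensor_mult (x + x') y = tensor_mult x y + tensor_mult x' y"
  "tensor_mult x (y + y') = tensor_mult x y + tensor_mult x y'"
  "tensor_mult (tensor_scale c x) y = tensor_scale c (tensor_mult x y)"
  "tensor_mult x (tensor_scale c y) = tensor_scale c (tensor_mult x y)"
  by (simp_all add: fun_eq_iff tensor_mult_def tensor_scale_def algebra_simps sum.distrib sum_distrib_left)

lemma lie_bracket_linear:
  "lie_bracket (x + x') y = lie_bracket x y + lie_bracket x' y"
  "lie_bracket x (y + y') = lie_bracket x y + lie_bracket x y'"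
  "lie_bracket (tensor_scale c x) y = tensor_scale c (lie_bracket x y)"
  "lie_bracket x (tensor_scale c y) = tensor_scale c (lie_bracket x y)"
  by (simp_all add: lie_bracket_def tensor_mult_linear) (simp_all add: fun_eq_iff tensor_scale_def algebra_simps)

lemma tensor_act_linear:
  "tensor_act g (x + y) = tensor_act g x + tensor_act g y"
  "tensor_act g (x - y) = tensor_act g x - tensor_act g y"
  "tensor_act g (tensor_scale c x) = tensor_scale c (tensor_act g x)"
  by (simp_all add: fun_eq_iff plus_fun_def fun_diff_def tensor_scale_def tensor_act_add tensor_act_diff tensor_act_cmult)

lemma tensor_act_tensor_mult: "tensor_act g (tensor_mult x y) = tensor_mult (tensor_act g x) (tensor_act g y)"
proof
  fix w
  show "tensor_act g (tensor_mult x y) w = tensor_mult (tensor_act g x) (tensor_act g y) w"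
  proof (induction w arbitrary: x)
    case (Cons a w)
    have "tensor_act g (tensor_mult x y) (a # w) =
        g $ a $ 1 * tensor_act g (\<lambda>v. x [] * y (1 # v) + tensor_mult (\<lambda>v. x (1 # v)) y v) w +
        g $ a $ 2 * tensor_act g (\<lambda>v. x [] * y (2 # v) + tensor_mult (\<lambda>v. x (2 # v)) y v) w"
      unfolding tensor_act_Cons_2 tensor_mult_Cons ..
    also have "\<dots> = x [] * tensor_act g y (a # w) +
        (g $ a $ 1 * tensor_mult (tensor_act g (\<lambda>v. x (1 # v))) (tensor_act g y) w +
         g $ a $ 2 * tensor_mult (tensor_act g (\<lambda>v. x (2 # v))) (tensor_act g y) w)"
      by (simp add: tensor_act_add tensor_act_cmult tensor_act_Cons_2 Cons algebra_simps)
    also have "\<dots> = tensor_mult (tensor_act g x) (tensor_act g y) (a # w)"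
      unfolding tensor_mult_Cons tensor_act_Cons_2[of g x] tensor_mult_left_linear by simp
    finally show ?case .
  qed simp
qed

lemma tensor_act_lie_bracket: "tensor_act g (lie_bracket x y) = lie_bracket (tensor_act g x) (tensor_act g y)"
  by (simp add: lie_bracket_def tensor_act_linear tensor_act_tensor_mult)

lemma tensor_of_vec_eq: "tensor_of_vec e = tensor_scale (e $ 1) (word_tensor [1]) + tensor_scale (e $ 2) (word_tensor [2])"
proof
  fix w :: "2 list"
  show "tensor_of_vec e w = (tensor_scale (e $ 1) (word_tensor [1]) + tensor_scale (e $ 2) (word_tensor [2])) w"
  proof (cases w)
    case (Cons a v)
    then show ?thesis using exhaust_2[of a] by (cases v) (auto simp: tensor_of_vec_def tensor_scale_def word_tensor_def)
  qed (simp add: tensor_of_vec_def tensor_scale_def word_tensor_def)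
qed

lemma word_tensor_singleton: "word_tensor [a] = tensor_of_vec (axis a 1)"
  using exhaust_2[of a] unfolding tensor_of_vec_eq
  by (auto simp: axis_def tensor_scale_def word_tensor_def fun_eq_iff)

lemma word_tensor_Cons: "(\<lambda>v. word_tensor (b # u) (c # v)) = (if b = c then word_tensor u else (\<lambda>_. 0))"
  by (auto simp: word_tensor_def fun_eq_iff)

lemma tensor_act_word_singleton:
  "tensor_act g (word_tensor [b]) = tensor_scale (g $ 1 $ b) (word_tensor [1]) + tensor_scale (g $ 2 $ b) (word_tensor [2])"
proof
  fix w :: "2 list"
  have nil: "tensor_act g (word_tensor []) v = word_tensor [] v" for v
    by (cases v) (simp_all add: tensor_act_Cons_2 word_tensor_def)
  show "tensor_act g (word_tensor [b]) w = (tensor_scale (g $ 1 $ b) (word_tensor [1]) + tensor_scale (g $ 2 $ b) (word_tensor [2])) w"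
  proof (cases w)
    case (Cons a v)
    then show ?thesis using exhaust_2[of a] exhaust_2[of b]
      by (auto simp: tensor_act_Cons_2 word_tensor_Cons nil) (auto simp: tensor_scale_def word_tensor_def)
  qed (simp add: tensor_scale_def word_tensor_def)
qed

lemma tensor_act_tensor_of_vec_in: "tensor_act g (tensor_of_vec e) \<in> free_lie"
proof -
  have "word_tensor [a] \<in> free_lie" for a unfolding word_tensor_singleton by (rule free_lie.gen)
  thus ?thesis
    unfolding tensor_of_vec_eq tensor_act_linear tensor_act_word_singleton
    by (intro free_lie.add free_lie.scale)
qed

lemma free_lie_act: "x \<in> free_lie \<Longrightarrow> tensor_act g x \<in> free_lie"
proof (induction rule: free_lie.induct)
  case zero
  have 0: "tensor_act g 0 = (0 :: 'a tensor)" by (simp add: fun_eq_iff zero_fun_def)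
  show ?case unfolding 0 by (rule free_lie.zero)
next
  case (add x y)
  show ?case unfolding tensor_act_linear by (rule free_lie.add) (rule add.IH)+
next
  case (bracket x y)
  show ?case
    unfolding tensor_act_lie_bracket[unfolded lie_bracket_def]
    by (rule free_lie.bracket) (rule bracket.IH)+
qed (auto simp: tensor_act_linear tensor_act_tensor_of_vec_in intro: free_lie.intros)

lemma submodule_free_lie: "submodule (free_lie \<inter> tensor_power r) (tens r :: ('k::field, 'k tensor) rep)"
proof -
  interpret vector_space "tensor_scale :: 'k \<Rightarrow> _" by (rule vector_space_tensor)
  have "subspace (free_lie :: 'k tensor set)" unfolding subspace_def by (auto intro: free_lie.intros)
  thus ?thesis
    unfolding submodule_def using subspace_tensor_power
    by (auto intro: subspace_inter free_lie_act tensor_act_in_tensor_power)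
qed

lemma lie_power_eq: "lie_power r = (tens r)\<lparr>rep_space := free_lie \<inter> tensor_power r\<rparr>"
  by (simp add: lie_power_def)

lemma poly_rep_lie_power: "poly_rep r (lie_power r)"
  unfolding lie_power_eq by (rule poly_rep_submodule[OF poly_rep_tens submodule_free_lie])

section \<open>The Dynkin operator\<close>

text \<open>
  The linear operator that replaces a word by the corresponding right-normed commutator, defined by splitting off the
  first letter.
\<close>
fun dynkin :: "nat \<Rightarrow> 'k::field tensor \<Rightarrow> 'k tensor" where
  "dynkin 0 z = 0"
| "dynkin (Suc 0) z = z"
| "dynkin (Suc (Suc r)) z =
     lie_bracket (word_tensor [1]) (dynkin (Suc r) (\<lambda>v. z (1 # v))) +
     lie_bracket (word_tensor [2]) (dynkin (Suc r) (\<lambda>v. z (2 # v)))"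

lemma tensor_zero: "(\<lambda>_. 0) = (0 :: 'k::field tensor)"
  by (simp add: zero_fun_def)

lemma dynkin_linear:
  "dynkin r (x + y) = dynkin r x + dynkin r y"
  "dynkin r (tensor_scale c x) = tensor_scale c (dynkin r x)"
proof (induction r arbitrary: x y rule: induct_nat_012)
  case (ge2 r)
  {
    case 1
    have slice: "(\<lambda>v. (x + y) (a # v)) = (\<lambda>v. x (a # v)) + (\<lambda>v. y (a # v))" for a by (simp add: fun_eq_iff)
    show ?case unfolding dynkin.simps slice ge2 lie_bracket_linear by (simp only: add_ac)
  next
    case 2
    have slice: "(\<lambda>v. tensor_scale c x (a # v)) = tensor_scale c (\<lambda>v. x (a # v))" for a by (simp add: tensor_scale_def fun_eq_iff)
    show ?case unfolding dynkin.simps slice ge2 lie_bracket_linear by (simp add: tensor_scale_def fun_eq_iff distrib_left)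
  }
qed (simp_all add: tensor_scale_def fun_eq_iff)

lemma dynkin_act: "dynkin r (tensor_act g z) = tensor_act g (dynkin r z)"
proof (induction r arbitrary: z rule: induct_nat_012)
  case 0
  show ?case by (simp add: fun_eq_iff zero_fun_def)
next
  case (ge2 r)
  let ?z = "\<lambda>a v. z (a # v)" and ?e = "\<lambda>a. word_tensor [a] :: 'a tensor"
  have slice: "(\<lambda>v. tensor_act g z (a # v)) =
      tensor_scale (g $ a $ 1) (tensor_act g (?z 1)) + tensor_scale (g $ a $ 2) (tensor_act g (?z 2))" for a
    by (simp add: fun_eq_iff tensor_act_Cons_2 tensor_scale_def)
  let ?d = "\<lambda>b. tensor_act g (dynkin (Suc r) (?z b))"
  have "dynkin (Suc (Suc r)) (tensor_act g z) =
      (tensor_scale (g $ 1 $ 1) (lie_bracket (?e 1) (?d 1)) + tensor_scale (g $ 1 $ 2) (lie_bracket (?e 1) (?d 2))) +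
      (tensor_scale (g $ 2 $ 1) (lie_bracket (?e 2) (?d 1)) + tensor_scale (g $ 2 $ 2) (lie_bracket (?e 2) (?d 2)))"
    by (simp add: slice dynkin_linear ge2 lie_bracket_linear)
  also have "\<dots> = tensor_act g (dynkin (Suc (Suc r)) z)"
    by (simp add: tensor_act_linear tensor_act_lie_bracket tensor_act_word_singleton lie_bracket_linear)
  finally show ?case .
qed simp

lemma tensor_mult_in_tensor_power:
  assumes "x \<in> tensor_power r" "y \<in> tensor_power s"
  shows "tensor_mult x y \<in> tensor_power (r + s)"
proof -
  have "x (take i w) * y (drop i w) = 0" if "length w \<noteq> r + s" "i \<le> length w" for w i
    using assms that by (cases "i = r") (auto simp: tensor_power_def)
  hence "tensor_mult x y w = 0" if "length w \<noteq> r + s" for w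
    unfolding tensor_mult_def using that by (intro sum.neutral) blast
  thus ?thesis by (simp add: tensor_power_def)
qed

lemma word_tensor_in_tensor_power: "word_tensor v \<in> tensor_power (length v)"
  by (auto simp: tensor_power_def word_tensor_def)

lemma dynkin_in_lie_power:
  assumes "z \<in> tensor_power r"
  shows "dynkin r z \<in> free_lie \<inter> tensor_power r"
  using assms
proof (induction r arbitrary: z rule: induct_nat_012)
  case 0
  show ?case unfolding dynkin.simps by (intro IntI free_lie.zero) (simp add: tensor_power_def)
next
  case 1
  have "z = tensor_of_vec (\<chi> i. z [i])"
  proof
    fix w
    show "z w = tensor_of_vec (\<chi> i. z [i]) w"
      using 1 by (cases w; cases "tl w") (auto simp: tensor_of_vec_def tensor_power_def)
  qed
  then have "z \<in> free_lie" by (metis free_lie.gen)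
  with 1 show ?case by simp
next
  case (ge2 r)
  have "(\<lambda>v. z (a # v)) \<in> tensor_power (Suc r)" for a using ge2.prems by (simp add: tensor_power_def)
  hence d: "dynkin (Suc r) (\<lambda>v. z (a # v)) \<in> free_lie" "dynkin (Suc r) (\<lambda>v. z (a # v)) \<in> tensor_power (Suc r)" for a
    using ge2.IH by blast+
  have w: "word_tensor [a] \<in> free_lie" "word_tensor [a] \<in> tensor_power 1" for a
    using free_lie.gen[of "axis a 1"] word_tensor_in_tensor_power[of "[a]"] by (simp_all add: word_tensor_singleton)
  have "lie_bracket (word_tensor [a]) (dynkin (Suc r) (\<lambda>v. z (a # v))) \<in> free_lie" for a
    unfolding lie_bracket_def by (intro free_lie.bracket w d)
  moreover have *: "lie_bracket (word_tensor [a]) (dynkin (Suc r) (\<lambda>v. z (a # v))) \<in> tensor_power (Suc (Suc r))" for a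
    using tensor_mult_in_tensor_power[OF w(2) d(2), of a a] tensor_mult_in_tensor_power[OF d(2) w(2), of a a]
    by (simp add: lie_bracket_def tensor_power_def)
  ultimately show ?case
    unfolding dynkin.simps by (intro IntI free_lie.add) (use * in \<open>simp_all add: tensor_power_def\<close>)
qed

lemma kg_hom_dynkin: "kg_hom (tens r) (lie_power r) (dynkin r)"
  unfolding kg_hom_def lie_power_def
  using dynkin_in_lie_power by (auto simp: linear_map_on_def dynkin_linear dynkin_act)

section \<open>Coordinates of Lie elements linear in the second generator\<close>

abbreviation ones :: "nat \<Rightarrow> 2 list" where "ones n \<equiv> replicate n 1"

lemma tensor_mult_ones: "tensor_mult x y (ones n) = (\<Sum>k\<le>n. x (ones k) * y (ones (n - k)))"
  unfolding tensor_mult_def by (intro sum.cong) (auto simp: min_def)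

lemma tensor_mult_one_two:
  "tensor_mult x y (ones i @ 2 # ones j) =
     (\<Sum>k\<le>i. x (ones k) * y (ones (i - k) @ 2 # ones j)) + (\<Sum>l\<le>j. x (ones i @ 2 # ones (j - l)) * y (ones l))"
proof -
  let ?w = "ones i @ 2 # ones j" and ?f = "\<lambda>k. x (take k (ones i @ 2 # ones j)) * y (drop k (ones i @ 2 # ones j))"
  have "tensor_mult x y ?w = (\<Sum>k\<in>{..i} \<union> {Suc i..Suc (i + j)}. ?f k)"
    unfolding tensor_mult_def by (intro sum.cong) auto
  also have "\<dots> = (\<Sum>k\<le>i. ?f k) + (\<Sum>k\<in>{Suc i..Suc (i + j)}. ?f k)"
    by (rule sum.union_disjoint) auto
  also have "(\<Sum>k\<le>i. ?f k) = (\<Sum>k\<le>i. x (ones k) * y (ones (i - k) @ 2 # ones j))"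
    by (intro sum.cong) (auto simp: min_def)
  also have "(\<Sum>k\<in>{Suc i..Suc (i + j)}. ?f k) = (\<Sum>l\<le>j. x (ones i @ 2 # ones (j - l)) * y (ones l))"
  proof (rule sum.reindex_bij_witness[of _ "\<lambda>l. Suc (i + j) - l" "\<lambda>k. Suc (i + j) - k"])
    fix k assume k: "k \<in> {Suc i..Suc (i + j)}"
    define k' where "k' = k - Suc i"
    have "k = Suc (i + k')" "k' \<le> j" using k by (auto simp: k'_def)
    thus "x (ones i @ 2 # ones (j - (Suc (i + j) - k))) * y (ones (Suc (i + j) - k)) = ?f k"
      by (simp add: min_def)
  qed auto
  finally show ?thesis .
qed

text \<open>
  The Lie elements that are linear in \<open>y\<close> are spanned by the elements \<open>ad(x)\<^sup>n(y)\<close>, and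
  \<open>ad(x)\<^sup>n = (l\<^sub>x - r\<^sub>x)\<^sup>n\<close> with commuting left and right multiplications gives the alternating binomial
  coefficients. The induction also needs the part of a Lie element that is free of \<open>y\<close>, a multiple of \<open>x\<close>,
  because the linear part of a bracket arises from this part of one factor and the linear part of the other.
\<close>
lemma free_lie_coordinates:
  assumes "z \<in> (free_lie :: 'k::field tensor set)"
  shows "\<exists>c d. (\<forall>n. z (ones n) = (if n = 1 then c else 0)) \<and>
    (\<forall>i j. z (ones i @ 2 # ones j) = (-1) ^ j * of_nat ((i + j) choose j) * d (i + j))"
  using assms
proof (induction rule: free_lie.induct)
  case (gen e)
  have "tensor_of_vec e (ones n) = (if n = 1 then e $ 1 else 0)" for n
    by (auto simp: tensor_of_vec_def)
  moreover have "tensor_of_vec e (ones i @ 2 # ones j) = (-1) ^ j * of_nat ((i + j) choose j) * (if i + j = 0 then e $ 2 else 0)" for i j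
    by (auto simp: tensor_of_vec_def)
  ultimately show ?case by (intro exI[of _ "e $ 1"] exI[of _ "\<lambda>k. if k = 0 then e $ 2 else 0"]) simp
next
  case zero
  show ?case by (intro exI[of _ 0] exI[of _ "\<lambda>_. 0"]) simp
next
  case (add x y)
  then obtain c d c' d' where "\<forall>n. x (ones n) = (if n = 1 then c else 0)" "\<forall>n. y (ones n) = (if n = 1 then c' else 0)"
    "\<forall>i j. x (ones i @ 2 # ones j) = (-1) ^ j * of_nat ((i + j) choose j) * d (i + j)"
    "\<forall>i j. y (ones i @ 2 # ones j) = (-1) ^ j * of_nat ((i + j) choose j) * d' (i + j)"
    by (elim exE conjE) (rule that)
  then show ?case
    by (intro exI[of _ "c + c'"] exI[of _ "\<lambda>k. d k + d' k"]) (simp add: distrib_left)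
next
  case (scale x a)
  then obtain c d where "\<forall>n. x (ones n) = (if n = 1 then c else 0)"
    "\<forall>i j. x (ones i @ 2 # ones j) = (-1) ^ j * of_nat ((i + j) choose j) * d (i + j)"
    by (elim exE conjE) (rule that)
  then show ?case
    by (intro exI[of _ "a * c"] exI[of _ "\<lambda>k. a * d k"]) (simp add: tensor_scale_def mult_ac)
next
  case (bracket x y)
  then obtain c d c' d' where x1: "\<forall>n. x (ones n) = (if n = 1 then c else 0)" and y1: "\<forall>n. y (ones n) = (if n = 1 then c' else 0)"
    and x2: "\<forall>i j. x (ones i @ 2 # ones j) = (-1) ^ j * of_nat ((i + j) choose j) * d (i + j)"
    and y2: "\<forall>i j. y (ones i @ 2 # ones j) = (-1) ^ j * of_nat ((i + j) choose j) * d' (i + j)"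
    by (elim exE conjE) (rule that)
  have sel: "(\<Sum>k\<le>n. (if k = 1 then a else 0) * f k) = (if n = 0 then 0 else a * f 1)"
    "(\<Sum>k\<le>n. f k * (if k = 1 then a else 0)) = (if n = 0 then 0 else f 1 * a)"
    for n a and f :: "nat \<Rightarrow> 'k"
  proof -
    have "(\<Sum>k\<le>n. (if k = 1 then a else 0) * f k) = (\<Sum>k\<le>n. if k = 1 then a * f k else 0)"
      "(\<Sum>k\<le>n. f k * (if k = 1 then a else 0)) = (\<Sum>k\<le>n. if k = 1 then f k * a else 0)"
      by (intro sum.cong; simp)+
    thus "(\<Sum>k\<le>n. (if k = 1 then a else 0) * f k) = (if n = 0 then 0 else a * f 1)"
      "(\<Sum>k\<le>n. f k * (if k = 1 then a else 0)) = (if n = 0 then 0 else f 1 * a)"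
      by (auto simp: Suc_le_eq)
  qed
  have "tensor_mult x y (ones n) = tensor_mult y x (ones n)" for n
  proof -
    have "tensor_mult x y (ones n) = (\<Sum>k\<le>n. y (ones k) * x (ones (n - k)))"
      unfolding tensor_mult_ones by (rule sum.reindex_bij_witness[of _ "\<lambda>k. n - k" "\<lambda>k. n - k"]) auto
    thus ?thesis by (simp add: tensor_mult_ones)
  qed
  moreover have "(tensor_mult x y - tensor_mult y x) (ones i @ 2 # ones j) =
      (-1) ^ j * of_nat ((i + j) choose j) * (if i + j = 0 then 0 else c * d' (i + j - 1) - c' * d (i + j - 1))" for i j
  proof -
    have 1: "tensor_mult x y (ones i @ 2 # ones j) =
       (if i = 0 then 0 else c * y (ones (i - 1) @ 2 # ones j)) + (if j = 0 then 0 else x (ones i @ 2 # ones (j - 1)) * c')"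
      unfolding tensor_mult_one_two x1[rule_format] y1[rule_format] sel by simp
    have 2: "tensor_mult y x (ones i @ 2 # ones j) =
       (if i = 0 then 0 else c' * x (ones (i - 1) @ 2 # ones j)) + (if j = 0 then 0 else y (ones i @ 2 # ones (j - 1)) * c)"
      unfolding tensor_mult_one_two x1[rule_format] y1[rule_format] sel by simp
    show ?thesis
      unfolding fun_diff_def 1 2 x2[rule_format] y2[rule_format]
      by (cases i; cases j) (simp_all add: algebra_simps)
  qed
  ultimately show ?case
    by (intro exI[of _ 0] exI[of _ "\<lambda>k. if k = 0 then 0 else c * d' (k - 1) - c' * d (k - 1)"]) simp
qed

section \<open>Endomorphisms of indecomposable modules\<close>

lemma submodule_image:
  assumes M: "kg_module M" and N: "kg_module N" and f: "kg_hom M N f"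
  shows "submodule (f ` rep_space M) N"
proof -
  interpret M: kg M by unfold_locales (rule M)
  interpret N: kg N by unfold_locales (rule N)
  note fD = kg_homD[OF f]
  have 0: "0 \<in> M.carr" using M.carr_subspace by (rule M.vs.subspace_0)
  have "N.vs.subspace (f ` M.carr)"
  proof (rule N.vs.subspaceI)
    show "0 \<in> f ` M.carr" using linear_map_on_zero[OF fD(2) 0] 0 by (metis imageI)
    show "x + y \<in> f ` M.carr" if "x \<in> f ` M.carr" "y \<in> f ` M.carr" for x y
    proof -
      obtain a b where ab: "a \<in> M.carr" "x = f a" "b \<in> M.carr" "y = f b" using \<open>x \<in> f ` M.carr\<close> \<open>y \<in> f ` M.carr\<close> by auto
      have "x + y = f (a + b)" using linear_map_on_add[OF fD(2) ab(1,3)] ab by simp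
      moreover have "a + b \<in> M.carr" using M.carr_subspace ab(1,3) by (rule M.vs.subspace_add)
      ultimately show ?thesis by (rule image_eqI)
    qed
    show "N.scal c x \<in> f ` M.carr" if "x \<in> f ` M.carr" for c x
    proof -
      obtain a where a: "a \<in> M.carr" "x = f a" using \<open>x \<in> f ` M.carr\<close> by auto
      have "N.scal c x = f (M.scal c a)" using linear_map_on_scale[OF fD(2) a(1)] a by simp
      moreover have "M.scal c a \<in> M.carr" using M.carr_subspace a(1) by (rule M.vs.subspace_scale)
      ultimately show ?thesis by (rule image_eqI)
    qed
  qed
  moreover have "N.act g ` f ` M.carr \<subseteq> f ` M.carr" if g: "g \<in> GL2" for g
  proof (intro image_subsetI)
    fix y assume "y \<in> f ` M.carr"
    then obtain a where a: "a \<in> M.carr" "y = f a" by auto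
    have "N.act g y = f (M.act g a)" using fD(3)[OF g a(1)] a by simp
    thus "N.act g y \<in> f ` M.carr" using M.act_in[OF g a(1)] by (rule image_eqI)
  qed
  moreover have "f ` M.carr \<subseteq> N.carr" using fD(1) by auto
  ultimately show ?thesis by (simp add: submodule_def)
qed

lemma submodule_kernel:
  assumes M: "kg_module M" and N: "kg_module N" and f: "kg_hom M N f"
  shows "submodule {x \<in> rep_space M. f x = 0} M"
proof -
  interpret M: kg M by unfold_locales (rule M)
  interpret N: kg N by unfold_locales (rule N)
  note fD = kg_homD[OF f]
  have 0: "0 \<in> M.carr" using M.carr_subspace by (rule M.vs.subspace_0)
  have N0: "0 \<in> N.carr" using N.carr_subspace by (rule N.vs.subspace_0)
  have "M.vs.subspace {x \<in> M.carr. f x = 0}"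
  proof (rule M.vs.subspaceI)
    show "0 \<in> {x \<in> M.carr. f x = 0}" using linear_map_on_zero[OF fD(2) 0] 0 by simp
    show "x + y \<in> {x \<in> M.carr. f x = 0}" if "x \<in> {x \<in> M.carr. f x = 0}" "y \<in> {x \<in> M.carr. f x = 0}" for x y
      using that linear_map_on_add[OF fD(2), of x y] M.vs.subspace_add[OF M.carr_subspace, of x y] by simp
    show "M.scal c x \<in> {x \<in> M.carr. f x = 0}" if "x \<in> {x \<in> M.carr. f x = 0}" for c x
      using that linear_map_on_scale[OF fD(2), of x c] M.vs.subspace_scale[OF M.carr_subspace, of x c] by simp
  qed
  moreover have "M.act g ` {x \<in> M.carr. f x = 0} \<subseteq> {x \<in> M.carr. f x = 0}" if g: "g \<in> GL2" for g
  proof (intro image_subsetI)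
    fix y assume y: "y \<in> {x \<in> M.carr. f x = 0}"
    have "N.act g 0 = 0" by (rule linear_map_on_zero[OF N.linear_act[OF g] N0])
    thus "M.act g y \<in> {x \<in> M.carr. f x = 0}" using fD(3)[OF g, of y] y g by simp
  qed
  ultimately show ?thesis by (simp add: submodule_def)
qed

lemma kg_hom_funpow:
  assumes "kg_hom M M f"
  shows "kg_hom M M (f ^^ n)"
proof (induction n)
  case 0
  show ?case by (simp add: kg_hom_def linear_map_on_def)
next
  case (Suc n)
  show ?case using kg_hom_compose[OF Suc assms] by (simp add: o_def)
qed

lemma (in fin_prep) subspace_dim_mono:
  assumes U: "vs.subspace U" and W: "vs.subspace W" "W \<subseteq> carr" and UW: "U \<subseteq> W"
  shows "vs.dim U \<le> vs.dim W" "vs.dim U = vs.dim W \<Longrightarrow> U = W" "vs.dim W \<le> card B"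
proof -
  obtain B1 where B1: "B1 \<subseteq> U" "vs.independent B1" "U \<subseteq> vs.span B1" "card B1 = vs.dim U"
    by (rule vs.basis_exists[of U])
  obtain B2 where B2: "B1 \<subseteq> B2" "B2 \<subseteq> W" "vs.independent B2" "W \<subseteq> vs.span B2"
    by (rule vs.maximal_independent_subset_extend[of B1 W]) (use B1 UW in auto)
  have fin: "finite B2" "card B2 \<le> card B"
    using vs.independent_span_bound[OF finite_basis B2(3)] B2(2) W(2) by (auto simp: span_basis)
  have c: "card B2 = vs.dim W" by (rule vs.basis_card_eq_dim[OF B2(2,4,3)])
  show "vs.dim U \<le> vs.dim W" using card_mono[OF fin(1) B2(1)] B1(4) c by simp
  show "vs.dim W \<le> card B" using fin(2) c by simp
  assume "vs.dim U = vs.dim W"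
  hence "B1 = B2" using card_subset_eq[OF fin(1) B2(1)] B1(4) c by simp
  hence "W \<subseteq> vs.span B1" using B2(4) by simp
  also have "\<dots> \<subseteq> U" using B1(1) U by (rule vs.span_minimal)
  finally show "U = W" using UW by simp
qed

text \<open>
  Fitting's lemma: the module is the direct sum of kernel and image of a high power of \<open>f\<close>, and the image contains
  \<open>v\<close>.
\<close>
lemma (in fin_prep) indecomposable_endomorphism:
  assumes ind: "indecomposable M" and f: "kg_hom M M f" and v: "v \<in> carr" "v \<noteq> 0" "f v = v"
  shows "bij_betw f carr carr"
proof -
  define I where "I n = (f ^^ n) ` carr" for n
  define K where "K n = {x \<in> carr. (f ^^ n) x = 0}" for n
  note fD = kg_homD[OF f]
  have fn: "kg_hom M M (f ^^ n)" for n by (rule kg_hom_funpow[OF f])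
  note fnD = kg_homD[OF fn]
  have subI: "submodule (I n) M" and subK: "submodule (K n) M" for n
    unfolding I_def K_def by (rule submodule_image[OF kg kg fn], rule submodule_kernel[OF kg kg fn])
  hence I: "vs.subspace (I n)" "I n \<subseteq> carr" and K: "vs.subspace (K n)" "K n \<subseteq> carr" for n
    by (simp_all add: submodule_def)
  have f0: "(f ^^ n) 0 = 0" for n by (rule linear_map_on_zero[OF fnD(2) vs.subspace_0[OF carr_subspace]])
  have Imono: "I (n + m) \<subseteq> I n" for n m
    unfolding I_def funpow_add using fnD(1) by auto
  have Kmono: "K n \<subseteq> K (m + n)" for n m
    unfolding K_def funpow_add using f0 by auto
  \<comment> \<open>Images and kernels of the powers become stationary because their dimensions do.\<close>
  obtain n1 where n1: "\<And>n. vs.dim (I n1) \<le> vs.dim (I n)"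
    using ex_has_least_nat[of "\<lambda>_. True" 0 "\<lambda>n. vs.dim (I n)"] by auto
  obtain n2 where n2: "\<And>n. vs.dim (K n) \<le> vs.dim (K n2)"
    using ex_has_greatest_nat[of "\<lambda>_. True" 0 "\<lambda>n. vs.dim (K n)" "Suc (card B)"]
      subspace_dim_mono(3)[OF K(1) K order_refl] by (auto simp: less_Suc_eq_le)
  have In1: "I (n1 + m) = I n1" for m
    by (rule subspace_dim_mono(2)[OF I(1) I Imono]) (rule antisym[OF subspace_dim_mono(1)[OF I(1) I Imono] n1])
  have Kn2: "K n2 = K (m + n2)" for m
    by (rule subspace_dim_mono(2)[OF K(1) K Kmono]) (rule antisym[OF subspace_dim_mono(1)[OF K(1) K Kmono] n2])
  define N where "N = Suc (n1 + n2)"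
  have N: "N = n1 + Suc n2" "N + N = n1 + (Suc n2 + N)" "N = Suc n1 + n2" "N + N = (N + Suc n1) + n2"
    by (simp_all add: N_def)
  have IN: "I (N + N) = I N"
  proof -
    have "I (N + N) = I n1" by (subst N(2)) (rule In1)
    moreover have "I N = I n1" by (subst N(1)) (rule In1)
    ultimately show ?thesis by simp
  qed
  have KN: "K (N + N) = K N"
  proof -
    have "K (N + N) = K n2" by (subst N(4)) (rule Kn2[symmetric])
    moreover have "K N = K n2" by (subst N(3)) (rule Kn2[symmetric])
    ultimately show ?thesis by simp
  qed
  have "direct_sum_decomp M (K N) (I N)"
    unfolding direct_sum_decomp_def
  proof (intro conjI subI subK)
    show "K N \<inter> I N = {0}"
    proof (intro equalityI subsetI)
      fix x assume x: "x \<in> K N \<inter> I N"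
      then obtain y where y: "y \<in> carr" "x = (f ^^ N) y" by (auto simp: I_def)
      hence "y \<in> K (N + N)" using x by (simp add: K_def funpow_add)
      with KN y show "x \<in> {0}" by (simp add: K_def)
    qed (use vs.subspace_0[OF I(1)] vs.subspace_0[OF K(1)] in auto)
    show "{a + b |a b. a \<in> K N \<and> b \<in> I N} = carr"
    proof (intro equalityI subsetI)
      fix x assume "x \<in> {a + b |a b. a \<in> K N \<and> b \<in> I N}"
      then obtain a b where ab: "x = a + b" "a \<in> K N" "b \<in> I N" by auto
      show "x \<in> carr" unfolding ab(1) using ab(2,3) I(2) K(2) by (intro vs.subspace_add carr_subspace) auto
    next
      fix x assume x: "x \<in> carr"
      hence "(f ^^ N) x \<in> I (N + N)" unfolding IN by (simp add: I_def)
      then obtain y where y: "y \<in> carr" "(f ^^ N) x = (f ^^ (N + N)) y" by (auto simp: I_def)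
      have yN: "(f ^^ N) y \<in> carr" using fnD(1) y(1) .
      have "(f ^^ N) (x - (f ^^ N) y) = 0"
        using linear_map_on_diff[OF fnD(2) vs.vector_space_axioms carr_subspace x yN] y(2) by (simp add: funpow_add)
      moreover have "x - (f ^^ N) y \<in> carr" using carr_subspace x yN by (rule vs.subspace_diff)
      ultimately have "x - (f ^^ N) y \<in> K N" by (simp add: K_def)
      moreover have "(f ^^ N) y \<in> I N" using y(1) by (simp add: I_def)
      moreover have "x = (x - (f ^^ N) y) + (f ^^ N) y" by simp
      ultimately show "x \<in> {a + b |a b. a \<in> K N \<and> b \<in> I N}" by blast
    qed
  qed
  note dec = this
  have "(f ^^ N) v = v" by (induction N) (simp_all add: v(3))
  hence "v \<in> I N" using v(1) unfolding I_def by (metis imageI)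
  hence "K N = {0}" using ind dec v(2) unfolding indecomposable_def by auto
  have sum: "{a + b |a b. a \<in> K N \<and> b \<in> I N} = carr" using dec unfolding direct_sum_decomp_def by simp
  have INc: "I N = carr"
  proof
    show "carr \<subseteq> I N" unfolding sum[symmetric] \<open>K N = {0}\<close> by auto
  qed (rule I(2))
  have inj: "inj_on f carr"
  proof (rule inj_onI)
    fix x y assume xy: "x \<in> carr" "y \<in> carr" "f x = f y"
    have "f (x - y) = 0" using linear_map_on_diff[OF fD(2) vs.vector_space_axioms carr_subspace xy(1,2)] xy(3) by simp
    hence "(f ^^ N) (x - y) = 0" unfolding N_def funpow_Suc_right using f0 by simp
    moreover have "x - y \<in> carr" using carr_subspace xy(1,2) by (rule vs.subspace_diff)
    ultimately have "x - y \<in> K N" by (simp add: K_def)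
    thus "x = y" using \<open>K N = {0}\<close> by simp
  qed
  have "carr \<subseteq> f ` carr"
  proof
    fix x assume "x \<in> carr"
    hence "x \<in> I N" by (simp only: INc)
    then obtain y where "y \<in> carr" "x = (f ^^ N) y" unfolding I_def by (elim imageE) simp
    hence "x = f ((f ^^ (n1 + n2)) y)" "(f ^^ (n1 + n2)) y \<in> carr" using fnD(1) by (simp_all add: N_def)
    thus "x \<in> f ` carr" by (rule image_eqI)
  qed
  with inj fD(1) show ?thesis unfolding bij_betw_def by auto
qed

lemma (in fin_prep) iso_direct_summand_of_retract:
  fixes L :: "('k, 'w::ab_group_add) rep"
  assumes L: "kg_module L" and ind: "indecomposable M"
    and a: "kg_hom M L \<alpha>" and b: "kg_hom L M \<beta>" and v: "v \<in> carr" "v \<noteq> 0" "\<beta> (\<alpha> v) = v"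
  shows "iso_direct_summand M L"
proof -
  interpret L: kg L by unfold_locales (rule L)
  note aD = kg_homD[OF a] and bD = kg_homD[OF b]
  have bij: "bij_betw (\<lambda>x. \<beta> (\<alpha> x)) carr carr"
    by (rule indecomposable_endomorphism[OF ind kg_hom_compose[OF a b] v])
  let ?A = "\<alpha> ` carr" and ?B = "{y \<in> L.carr. \<beta> y = 0}"
  have A: "submodule ?A L" by (rule submodule_image[OF kg L a])
  have B: "submodule ?B L" by (rule submodule_kernel[OF L kg b])
  have a0: "\<alpha> 0 = 0" by (rule linear_map_on_zero[OF aD(2) vs.subspace_0[OF carr_subspace]])
  have b0: "\<beta> 0 = 0" by (rule linear_map_on_zero[OF bD(2) L.vs.subspace_0[OF L.carr_subspace]])
  have "direct_sum_decomp L ?A ?B"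
    unfolding direct_sum_decomp_def
  proof (intro conjI A B)
    show "?A \<inter> ?B = {0}"
    proof (intro equalityI subsetI)
      fix y assume y: "y \<in> ?A \<inter> ?B"
      then obtain x where x: "x \<in> carr" "y = \<alpha> x" by auto
      have "\<beta> (\<alpha> x) = \<beta> (\<alpha> 0)" using y x a0 b0 by simp
      hence "x = 0" using bij_betw_imp_inj_on[OF bij] x(1) vs.subspace_0[OF carr_subspace]
        by (auto dest: inj_onD)
      thus "y \<in> {0}" using x a0 by simp
    next
      fix y assume "y \<in> {0::'w}"
      thus "y \<in> ?A \<inter> ?B"
        using L.vs.subspace_0[OF L.carr_subspace] vs.subspace_0[OF carr_subspace] a0 b0 by (auto intro: image_eqI[of _ _ 0])
    qed
    show "{a + b |a b. a \<in> ?A \<and> b \<in> ?B} = L.carr"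
    proof (intro equalityI subsetI)
      fix x assume "x \<in> {a + b |a b. a \<in> ?A \<and> b \<in> ?B}"
      then obtain a b where ab: "x = a + b" "a \<in> ?A" "b \<in> ?B" by auto
      show "x \<in> L.carr" unfolding ab(1) using ab(2,3) aD(1) by (intro L.vs.subspace_add L.carr_subspace) auto
    next
      fix y assume y: "y \<in> L.carr"
      have "\<beta> y \<in> (\<lambda>x. \<beta> (\<alpha> x)) ` carr" using bD(1)[OF y] bij by (simp add: bij_betw_def)
      then obtain x where x: "x \<in> carr" "\<beta> y = \<beta> (\<alpha> x)" by auto
      have "\<beta> (y - \<alpha> x) = 0"
        using linear_map_on_diff[OF bD(2) L.vs.vector_space_axioms L.carr_subspace y aD(1)[OF x(1)]] x(2) by simp
      moreover have "y - \<alpha> x \<in> L.carr" using L.carr_subspace y aD(1)[OF x(1)] by (rule L.vs.subspace_diff)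
      ultimately have "y - \<alpha> x \<in> ?B" by simp
      moreover have "\<alpha> x \<in> ?A" using x(1) by simp
      moreover have "y = \<alpha> x + (y - \<alpha> x)" by simp
      ultimately show "y \<in> {a + b |a b. a \<in> ?A \<and> b \<in> ?B}" by blast
    qed
  qed
  moreover have "kg_iso M (L\<lparr>rep_space := ?A\<rparr>)"
    unfolding kg_iso_def
  proof (intro exI conjI)
    show "kg_hom M (L\<lparr>rep_space := ?A\<rparr>) \<alpha>" using a unfolding kg_hom_def by simp
    have "inj_on \<alpha> carr" using bij_betw_imp_inj_on[OF bij] by (auto simp: inj_on_def)
    thus "bij_betw \<alpha> carr (rep_space (L\<lparr>rep_space := ?A\<rparr>))" by (simp add: bij_betw_def)
  qed
  ultimately show ?thesis unfolding iso_direct_summand_def by (intro exI[of _ ?A] exI[of _ ?B]) simp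
qed

section \<open>Binomial coefficients modulo a prime\<close>

lemma prime_dvd_prime_power_choose:
  fixes p :: nat
  assumes p: "prime p" and j: "0 < j" "j < p ^ k"
  shows "p dvd (p ^ k choose j)"
proof (rule ccontr)
  assume "\<not> p dvd (p ^ k choose j)"
  hence "coprime (p ^ k) (p ^ k choose j)" using p by (simp add: prime_imp_coprime coprime_power_left_iff)
  moreover have "j * (p ^ k choose j) = p ^ k * ((p ^ k - 1) choose (j - 1))"
    using times_binomial_minus1_eq[of j "p ^ k"] j by simp
  hence "p ^ k dvd j * (p ^ k choose j)" by simp
  ultimately have "p ^ k dvd j" using coprime_dvd_mult_left_iff by blast
  with j show False by (simp add: nat_dvd_not_less)
qed

text \<open>
  The inner binomial coefficients of \<open>p\<^sup>k\<close> vanish modulo \<open>p\<close>, so by Pascal's rule those of \<open>p\<^sup>k - 1\<close> alternate in sign.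
\<close>
lemma alternating_choose_prime_power:
  fixes p :: nat
  assumes p: "prime p" and char: "CHAR('k::field) = p" and j: "j \<le> p ^ k - 1"
  shows "(- 1) ^ j * of_nat ((p ^ k - 1) choose j) = (1 :: 'k)"
  using j
proof (induction j)
  case (Suc j)
  have "p ^ k > 0" using p prime_gt_0_nat by simp
  then obtain q where q: "p ^ k = Suc q" by (cases "p ^ k") auto
  have "p dvd (p ^ k choose Suc j)" by (rule prime_dvd_prime_power_choose[OF p]) (use Suc.prems q in auto)
  hence "of_nat (p ^ k choose Suc j) = (0 :: 'k)" using char by (simp add: of_nat_eq_0_iff_char_dvd)
  hence "of_nat (q choose j) + of_nat (q choose Suc j) = (0 :: 'k)" by (simp add: q)
  hence "of_nat (q choose Suc j) = - (of_nat (q choose j) :: 'k)" by (simp only: eq_neg_iff_add_eq_0 add.commute)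
  hence "(- 1) ^ Suc j * of_nat (q choose Suc j) = (- 1) ^ j * (of_nat (q choose j) :: 'k)" by simp
  also have "\<dots> = 1" using Suc q by simp
  finally show ?case by (simp only: q diff_Suc_1)
qed simp

lemma coeff_linear_poly_power_choose:
  fixes a b :: "'k::field"
  shows "coeff ([:a, b:] ^ n) i = of_nat (n choose i) * b ^ i * a ^ (n - i)"
proof (cases "i \<le> n")
  case False
  have "degree ([:a, b:] ^ n) \<le> n"
    using degree_power_le[of "[:a, b:]" n] by (rule order_trans) (simp split: if_splits)
  hence "coeff ([:a, b:] ^ n) i = 0" using False by (intro coeff_eq_0) simp
  thus ?thesis using False by (simp add: binomial_eq_0)
qed (simp add: coeff_linear_poly_power)

text \<open>
  Conversely, alternation makes the inner binomial coefficients of \<open>r\<close> vanish modulo \<open>p\<close>. For \<open>r = k p\<^sup>m\<close> with \<open>k\<close> prime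
  to \<open>p\<close>, the one at \<open>p\<^sup>m\<close> is congruent to \<open>k\<close>, because \<open>(1 + X)\<^sup>r = (1 + X\<^sup>q)\<^sup>k\<close> with \<open>q = p\<^sup>m\<close>; so \<open>k = 1\<close>.
\<close>
lemma prime_power_if_alternating_choose:
  fixes p r :: nat
  assumes p: "prime p" and char: "CHAR('k::field) = p" and r: "r \<ge> 1"
    and all: "\<And>j. j \<le> r - 1 \<Longrightarrow> (- 1) ^ j * of_nat ((r - 1) choose j) = (1 :: 'k)"
  shows "\<exists>k. r = p ^ k"
proof -
  have zero: "of_nat (r choose j) = (0 :: 'k)" if j: "0 < j" "j < r" for j
  proof -
    obtain i q where iq: "j = Suc i" "r = Suc q" using j by (cases j; cases r) auto
    have "(- 1) ^ i * of_nat (q choose i) = (1 :: 'k)" "- ((- 1) ^ i * of_nat (q choose Suc i)) = (1 :: 'k)"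
      using all[of i] all[of "Suc i"] j iq by simp_all
    moreover from this(2) have "(- 1) ^ i * of_nat (q choose Suc i) = (- 1 :: 'k)"
      unfolding minus_equation_iff[of _ 1] by (rule sym)
    ultimately have "(- 1) ^ i * (of_nat (q choose i) + of_nat (q choose Suc i)) = (0 :: 'k)" by (simp add: distrib_left)
    thus ?thesis by (simp add: iq)
  qed
  have "r \<noteq> 0" "\<not> is_unit p" using r p by (auto simp: prime_nat_iff)
  then obtain k where k: "r = p ^ multiplicity p r * k" "\<not> p dvd k" by (rule multiplicity_decompose')
  define m where "m = multiplicity p r"
  have mk: "r = k * p ^ m" unfolding m_def by (rule trans[OF k(1) mult.commute])
  have "k = 1"
  proof (rule ccontr)
    assume "k \<noteq> 1"
    moreover have "k \<noteq> 0" using k(2) by (cases "k = 0") simp_all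
    ultimately have k2: "k \<ge> 2" by simp
    have pm: "p ^ m > 0" using p prime_gt_0_nat by simp
    have "p ^ m < r" using k2 pm mk by simp
    define P where "P = [:1, 1 :: 'k:] ^ p ^ m"
    have P: "P = 1 + monom 1 (p ^ m)"
    proof (rule poly_eqI)
      fix i
      have c: "coeff P i = of_nat (p ^ m choose i)" for i by (simp add: P_def coeff_linear_poly_power_choose)
      consider "i = 0" | "i = p ^ m" | "0 < i" "i < p ^ m" | "i > p ^ m" by linarith
      thus "coeff P i = coeff (1 + monom 1 (p ^ m)) i"
      proof cases
        case 3
        with prime_dvd_prime_power_choose[OF p 3] char show ?thesis
          by (simp add: c of_nat_eq_0_iff_char_dvd)
      qed (use pm in \<open>simp_all add: c binomial_eq_0\<close>)
    qed
    have "[:1, 1 :: 'k:] ^ r = P ^ k" unfolding P_def mk by (simp only: power_mult[symmetric] mult.commute)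
    also have "\<dots> = (\<Sum>i\<le>k. of_nat (k choose i) * monom 1 (p ^ m * i))"
      unfolding P add.commute[of 1] binomial_ring by (simp add: monom_power)
    finally have "coeff ([:1, 1 :: 'k:] ^ r) (p ^ m) = (\<Sum>i\<le>k. coeff (of_nat (k choose i) * monom 1 (p ^ m * i)) (p ^ m))"
      by (simp add: coeff_sum)
    also have "\<dots> = (\<Sum>i\<le>k. if i = 1 then of_nat k else 0)"
      using pm by (intro sum.cong refl) (auto simp: of_nat_poly)
    also have "\<dots> = of_nat k" using k2 by simp
    finally have "of_nat (r choose p ^ m) = (of_nat k :: 'k)" by (simp add: coeff_linear_poly_power_choose)
    hence "of_nat k = (0 :: 'k)" using zero[of "p ^ m"] pm \<open>p ^ m < r\<close> by simp
    with k(2) char show False by (simp add: of_nat_eq_0_iff_char_dvd)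
  qed
  thus ?thesis using mk by auto
qed

lemma choose_nonzero_below_char:
  fixes p :: nat
  assumes p: "prime p" and char: "CHAR('k::field) = p" and n: "n < p" "i \<le> n"
  shows "of_nat (n choose i) \<noteq> (0 :: 'k)"
proof
  assume "of_nat (n choose i) = (0 :: 'k)"
  hence "p dvd (n choose i)" using char by (simp add: of_nat_eq_0_iff_char_dvd)
  hence "p dvd fact i * fact (n - i) * (n choose i)" by simp
  hence "p dvd fact n" using binomial_fact_lemma[OF n(2)] by simp
  thus False using p n by (simp add: prime_dvd_fact_iff)
qed

section \<open>Homomorphisms to and from the dual Weyl module\<close>

lemma poly_eq_on_infinite:
  fixes P Q :: "'k::field poly"
  assumes "infinite S" "\<And>t. t \<in> S \<Longrightarrow> poly P t = poly Q t"
  shows "P = Q"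
proof (rule ccontr)
  assume "P \<noteq> Q"
  hence "finite {t. poly (P - Q) t = 0}" by (intro poly_roots_finite) simp
  moreover have "S \<subseteq> {t. poly (P - Q) t = 0}" using assms(2) by auto
  ultimately show False using assms(1) finite_subset by blast
qed

lemma poly_sym_act_eq:
  assumes "degree P \<le> n" "g $ 1 $ 1 + g $ 2 $ 1 * t \<noteq> 0"
  shows "poly (sym_act n g P) t =
    (g $ 1 $ 1 + g $ 2 $ 1 * t) ^ n * poly P ((g $ 1 $ 2 + g $ 2 $ 2 * t) / (g $ 1 $ 1 + g $ 2 $ 1 * t))"
  unfolding poly_sym_act poly_altdef_le[OF assms(1)] sum_distrib_left
proof (rule sum.cong[OF refl])
  fix i assume "i \<in> {..n}"
  define s x where "s = g $ 1 $ 1 + g $ 2 $ 1 * t" and "x = g $ 1 $ 2 + g $ 2 $ 2 * t"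
  have "s ^ n = s ^ (n - i) * s ^ i" using \<open>i \<in> {..n}\<close> by (simp flip: power_add)
  moreover have "s \<noteq> 0" using assms(2) by (simp add: s_def)
  ultimately have "coeff P i * (s ^ (n - i) * x ^ i) = s ^ n * (coeff P i * (x / s) ^ i)" by (simp add: power_divide)
  thus "coeff P i * ((g $ 1 $ 1 + g $ 2 $ 1 * t) ^ (n - i) * (g $ 1 $ 2 + g $ 2 $ 2 * t) ^ i) =
    (g $ 1 $ 1 + g $ 2 $ 1 * t) ^ n * (coeff P i * ((g $ 1 $ 2 + g $ 2 $ 2 * t) / (g $ 1 $ 1 + g $ 2 $ 1 * t)) ^ i)"
    unfolding s_def x_def .
qed

lemma swap_low_up:
  assumes "(t::'k::field) \<noteq> 0"
  shows "mat2 t 1 1 0 = low (1 / t) ** (diag2 t (- 1 / t) ** up (1 / t))"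
  using mat2_eq_low_diag_up[OF assms, of 1 1 0] by simp

context prep
begin

text \<open>
  The coefficient of \<open>t\<^sup>j\<close> in the action of \<open>up t\<close> on \<open>v\<close> has weight \<open>(r - 1 + j, 1 - j)\<close>: excluded by hypothesis for \<open>j = 1\<close>,
  and not a weight of a polynomial module of degree \<open>r\<close> for \<open>j > 1\<close>.
\<close>
lemma highest_weight_vector_invariant:
  assumes r: "r \<ge> 2" and v: "v \<in> weight_space M (r - 1, 1)" and no: "\<not> is_weight M (r, 0)"
  shows "act (up t) v = v"
proof -
  have vc: "v \<in> carr" using v by (simp add: weight_space_def)
  have inf': "infinite (- {0::'k})" using inf by (simp add: Compl_eq_Diff_UNIV)
  obtain z' where z': "\<And>i. z' i \<in> carr" "\<And>t. act (up t) v = (\<Sum>i\<le>r. scal (t ^ i) (z' i))"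
    by (rule up_curve[OF vc carr_subspace]) (use vc in auto)
  define z where "z i = (if i \<le> r then z' i else 0)" for i
  have z: "z i \<in> carr" "r < i \<Longrightarrow> z i = 0" "act (up t) v = (\<Sum>i\<le>r. scal (t ^ i) (z i))" for i t
    using z' vs.subspace_0[OF carr_subspace] by (simp_all add: z_def)
  have diag: "act (diag2 s 1) (z j) = scal (s ^ (r - 1 + j)) (z j)" if "j \<le> r" "s \<noteq> 0" for j s
    by (rule up_curve_relations(2)[OF vc z that(1) v that(2)])
  have "z j = 0" if j: "1 \<le> j" "j \<le> r" for j
  proof (cases "j = 1")
    case True
    have "act (diag2 s t) (z 1) = scal (s ^ r * t ^ 0) (z 1)" if "s \<noteq> 0" "t \<noteq> 0" for s t
    proof -
      have "diag2 s t = diag2 t t ** diag2 (s / t) 1" using that by (simp add: diag2_mat2 mat2_mult)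
      hence "act (diag2 s t) (z 1) = act (diag2 t t) (act (diag2 (s / t) 1) (z 1))"
        using that z(1) by (simp add: act_mult)
      also have "\<dots> = scal (t ^ r) (act (diag2 (s / t) 1) (z 1))"
        by (rule act_scalar) (use that z(1) in auto)
      also have "\<dots> = scal (t ^ r * (s / t) ^ r) (z 1)" using diag[of 1 "s / t"] r that by simp
      also have "t ^ r * (s / t) ^ r = s ^ r" using that by (simp add: power_divide)
      finally show ?thesis by simp
    qed
    hence "z 1 \<in> weight_space M (r, 0)" using z(1) by (simp add: weight_space_def)
    with no show ?thesis unfolding is_weight_def True by blast
  next
    case False
    obtain y where y: "\<And>i. y i \<in> carr" "\<And>s t. s \<noteq> 0 \<Longrightarrow> t \<noteq> 0 \<Longrightarrow> act (diag2 s t) (z j) = (\<Sum>i\<le>r. scal (s ^ i * t ^ (r - i)) (y i))"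
      by (rule weight_components[OF z(1)[of j] carr_subspace _ order_refl]) (use z(1) in auto)
    have "(if r - 1 + j = r - 1 + j then z j else 0) = (if r - 1 + j \<le> r then y (r - 1 + j) else 0)"
    proof (rule vs.poly_curve_unique[OF inf', where d = "r + r" and y = "\<lambda>i. if i = r - 1 + j then z j else 0"
          and z = "\<lambda>i. if i \<le> r then y i else 0"])
      fix s :: 'k assume s: "s \<in> - {0}"
      have "(\<Sum>i\<le>r + r. scal (s ^ i) (if i = r - 1 + j then z j else 0)) = (\<Sum>i\<le>r + r. if i = r - 1 + j then scal (s ^ i) (z j) else 0)"
        by (intro sum.cong) auto
      also have "\<dots> = scal (s ^ (r - 1 + j)) (z j)"
      proof -
        have "r - 1 + j \<le> r + r" using j by linarith
        thus ?thesis by (simp only: sum.delta finite_atMost atMost_iff if_True)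
      qed
      also have "\<dots> = act (diag2 s 1) (z j)" using diag[of j s] j s by simp
      also have "\<dots> = (\<Sum>i\<le>r. scal (s ^ i) (y i))" using y(2)[of s 1] s by simp
      also have "\<dots> = (\<Sum>i\<le>r + r. scal (s ^ i) (if i \<le> r then y i else 0))"
        by (intro sum.mono_neutral_cong_left) auto
      finally show "(\<Sum>i\<le>r + r. scal (s ^ i) (if i = r - 1 + j then z j else 0)) =
        (\<Sum>i\<le>r + r. scal (s ^ i) (if i \<le> r then y i else 0))" .
    qed (use j in simp)
    moreover have "\<not> r - 1 + j \<le> r" using False j r by simp
    ultimately show ?thesis by simp
  qed
  hence "act (up t) v = (\<Sum>i\<le>r. if i = 0 then z 0 else 0)" for t
    unfolding z(3) by (intro sum.cong) (auto simp: Suc_le_eq)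
  hence e: "act (up t) v = z 0" for t by simp
  have "z 0 = v" using e[of 0] vc by (simp flip: mat_1_mat2)
  with e show ?thesis by simp
qed

text \<open>
  The universal property of the dual Weyl module, which is induced from the lower triangular matrices: a functional \<open>\<phi>\<close> that is
  semi-invariant under them gives the homomorphism that sends \<open>m\<close> to the polynomial function
  \<open>t \<mapsto> \<phi>(up t m)\<close>. The swap of the basis vectors bounds the degree of this polynomial.
\<close>
lemma hom_to_dual_weyl:
  assumes r: "r \<ge> 2" and lin: "linear_map_on carr scal (*) \<phi>"
    and low: "\<And>s m. m \<in> carr \<Longrightarrow> \<phi> (act (low s) m) = \<phi> m"
    and diag: "\<And>s t m. s \<noteq> 0 \<Longrightarrow> t \<noteq> 0 \<Longrightarrow> m \<in> carr \<Longrightarrow> \<phi> (act (diag2 s t) m) = s ^ (r - 1) * t * \<phi> m"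
    and v: "v \<in> carr" "\<And>t. act (up t) v = v"
  shows "\<exists>\<tau>. kg_hom M (dual_weyl (r - 1, 1)) \<tau> \<and> \<tau> v = [:\<phi> v:]"
proof -
  define n where "n = r - 2"
  have n: "n \<le> r" "r - 1 = Suc n" "fst (r - 1, 1) - snd (r - 1, 1::nat) = n" using r by (auto simp: n_def)
  have key: "\<phi> (act (up t ** g) m) = det g * s ^ n * \<phi> (act (up ((g $ 1 $ 2 + g $ 2 $ 2 * t) / s)) m)"
    if g: "g \<in> GL2" and s: "s = g $ 1 $ 1 + g $ 2 $ 1 * t" "s \<noteq> 0" and m: "m \<in> carr" for g t s m
  proof -
    let ?u = "up ((g $ 1 $ 2 + g $ 2 $ 2 * t) / s)"
    have "det g \<noteq> 0" using g by (simp add: GL2_iff)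
    hence d: "diag2 s (det g / s) \<in> GL2" "det g / s \<noteq> 0" using s(2) by simp_all
    have "up t ** g = low (g $ 2 $ 1 / s) ** (diag2 s (det g / s) ** ?u)"
      unfolding s(1) by (rule up_mult_GL2) (use s in simp)
    hence "\<phi> (act (up t ** g) m) = \<phi> (act (low (g $ 2 $ 1 / s)) (act (diag2 s (det g / s)) (act ?u m)))"
      using d m by (simp only: act_mult GL2_mult GL2_simps(1,2) act_in)
    also have "\<dots> = \<phi> (act (diag2 s (det g / s)) (act ?u m))" by (rule low) (use d m in simp)
    also have "\<dots> = s ^ (r - 1) * (det g / s) * \<phi> (act ?u m)" by (rule diag) (use d m in auto)
    also have "s ^ (r - 1) * (det g / s) = det g * s ^ n" unfolding n(2) using s(2) by simp
    finally show ?thesis .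
  qed
  have ex: "\<exists>P. degree P \<le> n \<and> (\<forall>t. poly P t = \<phi> (act (up t) m))" if m: "m \<in> carr" for m
  proof -
    obtain z where z: "\<And>i. z i \<in> carr" "\<And>t. act (up t) m = (\<Sum>i\<le>r. scal (t ^ i) (z i))"
      by (rule up_curve[OF m carr_subspace]) (use m in auto)
    define m' where "m' = act (mat2 0 1 1 0) m"
    have sw: "mat2 0 1 1 0 \<in> GL2" by (simp add: mat2_GL2_iff)
    have m': "m' \<in> carr" unfolding m'_def by (rule act_in[OF sw m])
    obtain y where y: "\<And>i. y i \<in> carr" "\<And>t. act (up t) m' = (\<Sum>i\<le>r. scal (t ^ i) (y i))"
      by (rule up_curve[OF m' carr_subspace]) (use m' in auto)
    note lsum = linear_map_on_sum_scale[OF lin vs.vector_space_axioms carr_subspace]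
    have 0: "\<phi> (z i) = 0" if i: "n < i" "i \<le> r" for i
    proof (rule vector_space_over_itself.poly_curve_pole_order[OF inf n(1) _ _ i, where c = "- 1" and y = "\<lambda>i. \<phi> (y i)" and z = "\<lambda>i. \<phi> (z i)"])
      fix t :: 'k assume t: "t \<noteq> 0"
      have "(\<Sum>j\<le>r. t ^ j * \<phi> (y j)) = \<phi> (act (up t) m')" unfolding y(2) by (rule lsum[OF y(1), symmetric])
      also have "\<dots> = \<phi> (act (up t ** mat2 0 1 1 0) m)" unfolding m'_def act_mult[OF GL2_simps(2) sw m] ..
      also have "\<dots> = - 1 * t ^ n * \<phi> (act (up (1 / t)) m)"
        using key[OF sw _ _ m, of t t] t by simp
      also have "\<phi> (act (up (1 / t)) m) = (\<Sum>i\<le>r. (1 / t) ^ i * \<phi> (z i))" unfolding z(2) by (rule lsum[OF z(1)])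
      finally show "(\<Sum>j\<le>r. t ^ j * \<phi> (y j)) = - 1 * t ^ n * (\<Sum>i\<le>r. (1 / t) ^ i * \<phi> (z i))" .
    qed simp
    let ?P = "\<Sum>i\<le>n. monom (\<phi> (z i)) i"
    have "degree ?P \<le> n" by (intro degree_sum_le) (auto intro: order_trans[OF degree_monom_le])
    moreover have "poly ?P t = \<phi> (act (up t) m)" for t
    proof -
      have "\<phi> (act (up t) m) = (\<Sum>i\<le>r. t ^ i * \<phi> (z i))" unfolding z(2) by (rule lsum[OF z(1)])
      also have "\<dots> = (\<Sum>i\<le>n. t ^ i * \<phi> (z i))"
        by (rule sum.mono_neutral_right) (use n(1) 0 in auto)
      finally show ?thesis by (simp add: poly_sum poly_monom mult.commute)
    qed
    ultimately show ?thesis by blast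
  qed
  have "\<forall>m\<in>carr. \<exists>P. degree P \<le> n \<and> (\<forall>t. poly P t = \<phi> (act (up t) m))" by (rule ballI) (rule ex)
  from bchoice[OF this] obtain \<tau> where \<tau>': "\<forall>m\<in>carr. degree (\<tau> m) \<le> n \<and> (\<forall>t. poly (\<tau> m) t = \<phi> (act (up t) m))"
    by (elim exE) (rule that)
  hence \<tau>: "degree (\<tau> m) \<le> n" "poly (\<tau> m) t = \<phi> (act (up t) m)" if "m \<in> carr" for m t
    using that by simp_all
  have add: "\<tau> (x + y) = \<tau> x + \<tau> y" and scale: "\<tau> (scal c x) = smult c (\<tau> x)" if xy: "x \<in> carr" "y \<in> carr" for x y c
  proof -
    have s: "x + y \<in> carr" "scal c x \<in> carr"
      using xy vs.subspace_add[OF carr_subspace] vs.subspace_scale[OF carr_subspace] by simp_all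
    have u: "act (up t) x \<in> carr" "act (up t) y \<in> carr" for t using xy by simp_all
    show "\<tau> (x + y) = \<tau> x + \<tau> y"
      by (rule poly_eq_on_infinite[OF inf])
         (simp add: \<tau>(2) xy s linear_map_on_add[OF linear_act] linear_map_on_add[OF lin] u)
    show "\<tau> (scal c x) = smult c (\<tau> x)"
      by (rule poly_eq_on_infinite[OF inf])
         (simp add: \<tau>(2) xy s linear_map_on_scale[OF linear_act] linear_map_on_scale[OF lin] u)
  qed
  have equi: "\<tau> (act g m) = smult (det g) (sym_act n g (\<tau> m))" if g: "g \<in> GL2" and m: "m \<in> carr" for g m
  proof (rule poly_eq_on_infinite)
    show "infinite {t. g $ 1 $ 1 + g $ 2 $ 1 * t \<noteq> 0}"
      using g by (intro infinite_affine_nonzero[OF inf]) (auto simp: GL2_iff det_2)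
    fix t assume t: "t \<in> {t. g $ 1 $ 1 + g $ 2 $ 1 * t \<noteq> 0}"
    have "poly (\<tau> (act g m)) t = \<phi> (act (up t ** g) m)" using g m by (simp add: \<tau>(2) act_mult)
    also have "\<dots> = poly (smult (det g) (sym_act n g (\<tau> m))) t"
      using key[OF g refl _ m, of t] t m by (simp add: poly_sym_act_eq[OF \<tau>(1)] \<tau>(2))
    finally show "poly (\<tau> (act g m)) t = poly (smult (det g) (sym_act n g (\<tau> m))) t" .
  qed
  have "kg_hom M (dual_weyl (r - 1, 1)) \<tau>"
    unfolding kg_hom_def linear_map_on_def using \<tau>(1) add scale equi
    by (auto simp: dual_weyl_def n(3)[simplified])
  moreover have "\<tau> v = [:\<phi> v:]" by (rule poly_eq_on_infinite[OF inf]) (simp add: \<tau>(2) v)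
  ultimately show ?thesis by blast
qed

text \<open>
  When the binomial coefficients of \<open>n = r - 2\<close> are invertible, the powers \<open>(1 + t X)\<^sup>n\<close>, which are the images of the
  constant \<open>1\<close> under lower unitriangular matrices, span the polynomials of degree at most \<open>n\<close>. So a
  homomorphism is determined by the image \<open>v\<close> of \<open>1\<close>, and \<open>X\<^sup>i\<close> has to go to \<open>f\<^sup>i / i!\<close> applied to \<open>v\<close>, divided by the
  binomial coefficient of \<open>n\<close> over \<open>i\<close>.
\<close>
lemma hom_from_dual_weyl:
  assumes r: "r \<ge> 2" and v: "v \<in> weight_space M (r - 1, 1)" "\<And>t. act (up t) v = v"
    and binom: "\<And>i. i \<le> r - 2 \<Longrightarrow> of_nat ((r - 2) choose i) \<noteq> (0 :: 'k)"
  shows "\<exists>\<kappa>. kg_hom (dual_weyl (r - 1, 1)) M \<kappa> \<and> \<kappa> 1 = v"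
proof -
  define n where "n = r - 2"
  have n: "n \<le> r" "r - 1 = Suc n" "fst (r - 1, 1) - snd (r - 1, 1::nat) = n" using r by (auto simp: n_def)
  have vc: "v \<in> carr" using v by (simp add: weight_space_def)
  obtain z where z: "\<And>i. z i \<in> carr" "\<And>t. act (low t) v = (\<Sum>i\<le>r. scal (t ^ i) (z i))"
    by (rule low_curve[OF vc carr_subspace]) (use vc in auto)
  obtain y where y: "\<And>i. y i \<in> carr" "\<And>t. act (mat2 t 1 1 0) v = (\<Sum>i\<le>r. scal (t ^ i) (y i))"
    by (rule swap_curve[OF vc carr_subspace]) (use vc in auto)
  have low_diag_up: "act (low u ** (diag2 s s' ** up w)) v = scal (s ^ Suc n * s') (act (low u) v)"
    if "s \<noteq> 0" "s' \<noteq> 0" for u s s' w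
  proof -
    have "act (low u ** (diag2 s s' ** up w)) v = act (low u) (act (diag2 s s') v)"
      using that vc by (simp add: act_mult v(2))
    also have "\<dots> = act (low u) (scal (s ^ Suc n * s') v)"
      using v(1) that unfolding weight_space_def n(2) by simp
    also have "\<dots> = scal (s ^ Suc n * s') (act (low u) v)" by (rule linear_map_on_scale[OF linear_act vc]) simp
    finally show ?thesis .
  qed
  have z0: "z i = 0" if i: "n < i" "i \<le> r" for i
  proof (rule vs.poly_curve_pole_order[OF inf n(1) _ _ i, where c = "- 1" and y = y])
    fix t :: 'k assume t: "t \<noteq> 0"
    have "(\<Sum>j\<le>r. scal (t ^ j) (y j)) = scal (t ^ Suc n * (- 1 / t)) (act (low (1 / t)) v)"
      unfolding y(2)[symmetric] swap_low_up[OF t] by (rule low_diag_up) (use t in auto)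
    also have "t ^ Suc n * (- 1 / t) = - 1 * t ^ n" using t by simp
    finally show "(\<Sum>j\<le>r. scal (t ^ j) (y j)) = scal (- 1 * t ^ n) (\<Sum>i\<le>r. scal ((1 / t) ^ i) (z i))"
      unfolding z(2) .
  qed simp
  have low_n: "act (low t) v = (\<Sum>i\<le>n. scal (t ^ i) (z i))" for t
    unfolding z(2) by (rule sum.mono_neutral_right) (use n(1) z0 in auto)
  define \<kappa> where "\<kappa> f = (\<Sum>i\<le>n. scal (coeff f i / of_nat (n choose i)) (z i))" for f
  have \<kappa>_in: "\<kappa> f \<in> carr" for f
    unfolding \<kappa>_def by (intro vs.subspace_sum vs.subspace_scale carr_subspace z)
  have \<kappa>_add: "\<kappa> (f + g) = \<kappa> f + \<kappa> g" and \<kappa>_scale: "\<kappa> (smult c f) = scal c (\<kappa> f)" for f g c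
    by (simp_all add: \<kappa>_def add_divide_distrib vs.scale_left_distrib sum.distrib vs.scale_sum_right)
  have \<kappa>_power: "\<kappa> ([:1, t:] ^ n) = act (low t) v" for t
    unfolding low_n \<kappa>_def using binom by (intro sum.cong refl) (simp add: coeff_linear_poly_power_choose n_def)
  define A where "A g f = rep_act (dual_weyl (r - 1, 1)) g f" for g :: "'k^2^2" and f
  have A: "A g f = smult (det g) (sym_act n g f)" for g f by (simp add: A_def dual_weyl_def n_def numeral_2_eq_2)
  have A_add: "A g (f + f') = A g f + A g f'" and A_scale: "A g (smult c f) = smult c (A g f)" for g f f' c
  proof -
    show "A g (f + f') = A g f + A g f'"
      by (simp add: A sym_act_def smult_add_left smult_add_right sum.distrib)
    have "sym_act n g (smult c f) = smult c (sym_act n g f)"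
      unfolding sym_act_def
      by (rule poly_eqI) (simp add: coeff_sum sum_distrib_left mult.assoc)
    thus "A g (smult c f) = smult c (A g f)" by (simp add: A mult.commute)
  qed
  have A_power: "A g ([:1, t:] ^ n) = smult (det g * s ^ n) ([:1, (g $ 2 $ 1 + g $ 2 $ 2 * t) / s:] ^ n)"
    if s: "s = g $ 1 $ 1 + g $ 1 $ 2 * t" "s \<noteq> 0" for g t s
  proof -
    have "sym_act n g ([:1, t:] ^ n) = (\<Sum>i\<le>n. of_nat (n choose i) * (smult t [:g $ 1 $ 2, g $ 2 $ 2:]) ^ i * [:g $ 1 $ 1, g $ 2 $ 1:] ^ (n - i))"
    proof -
      have "smult (of_nat c * t ^ i) (A * B ^ i) = of_nat c * smult t B ^ i * A" for A B :: "'k poly" and c i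
        by (simp add: smult_power of_nat_poly mult_ac)
      thus ?thesis unfolding sym_act_def coeff_linear_poly_power_choose by simp
    qed
    also have "\<dots> = (smult t [:g $ 1 $ 2, g $ 2 $ 2:] + [:g $ 1 $ 1, g $ 2 $ 1:]) ^ n" by (rule binomial_ring[symmetric])
    also have "smult t [:g $ 1 $ 2, g $ 2 $ 2:] + [:g $ 1 $ 1, g $ 2 $ 1:] = smult s [:1, (g $ 2 $ 1 + g $ 2 $ 2 * t) / s:]"
    proof -
      have "smult s [:1, (g $ 2 $ 1 + g $ 2 $ 2 * t) / s:] = [:s, g $ 2 $ 1 + g $ 2 $ 2 * t:]" using s(2) by simp
      also have "\<dots> = smult t [:g $ 1 $ 2, g $ 2 $ 2:] + [:g $ 1 $ 1, g $ 2 $ 1:]" by (simp add: s(1) algebra_simps)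
      finally show ?thesis by (rule sym)
    qed
    finally show ?thesis unfolding A smult_power by (simp only: smult_smult)
  qed
  have monom: "\<kappa> (A g (monom 1 i)) = act g (\<kappa> (monom 1 i))" if g: "g \<in> GL2" and i: "i \<le> n" for g i
  proof -
    have sub: "linear_map_on UNIV smult scal (\<lambda>f. \<kappa> (A g f))" "linear_map_on UNIV smult scal (\<lambda>f. act g (\<kappa> f))"
      using g unfolding linear_map_on_def
      by (simp_all add: A_add A_scale \<kappa>_add \<kappa>_scale linear_map_on_add[OF linear_act] linear_map_on_scale[OF linear_act] \<kappa>_in)
    have vs: "vector_space (smult :: 'k \<Rightarrow> _)" by unfold_locales (simp_all add: smult_add_right smult_add_left)
    have U: "module.subspace (smult :: 'k \<Rightarrow> _) UNIV"
    proof - interpret vector_space "smult :: 'k \<Rightarrow> _" by (rule vs) show ?thesis by (rule subspace_UNIV) qed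
    let ?b = "\<lambda>i. smult (of_nat (n choose i)) (monom (1::'k) i)"
    have expand: "[:1, t:] ^ n = (\<Sum>i\<le>n. smult (t ^ i) (?b i))" for t :: 'k
      by (rule poly_eqI) (simp add: coeff_linear_poly_power_choose coeff_sum mult.commute if_distrib binomial_eq_0 not_le cong: if_cong)
    have "\<kappa> (A g (?b i)) = act g (\<kappa> (?b i))"
    proof (rule vs.poly_curve_unique[where S = "{t. g $ 1 $ 1 + g $ 1 $ 2 * t \<noteq> 0}" and d = n
          and y = "\<lambda>i. \<kappa> (A g (?b i))" and z = "\<lambda>i. act g (\<kappa> (?b i))"])
      show "infinite {t. g $ 1 $ 1 + g $ 1 $ 2 * t \<noteq> 0}"
        using g by (intro infinite_affine_nonzero[OF inf]) (auto simp: GL2_iff det_2)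
      fix t assume "t \<in> {t. g $ 1 $ 1 + g $ 1 $ 2 * t \<noteq> 0}"
      hence t: "g $ 1 $ 1 + g $ 1 $ 2 * t \<noteq> 0" by simp
      define s where "s = g $ 1 $ 1 + g $ 1 $ 2 * t"
      let ?u = "(g $ 2 $ 1 + g $ 2 $ 2 * t) / s"
      have "(\<Sum>j\<le>n. scal (t ^ j) (\<kappa> (A g (?b j)))) = \<kappa> (A g ([:1, t:] ^ n))"
        unfolding expand by (rule linear_map_on_sum_scale[OF sub(1) vs U, symmetric]) simp
      also have "\<dots> = scal (det g * s ^ n) (act (low ?u) v)"
        using A_power[OF s_def] t by (simp add: s_def \<kappa>_scale \<kappa>_power)
      also have "det g * s ^ n = s ^ Suc n * (det g / s)" using t by (simp add: s_def)
      also have "scal (s ^ Suc n * (det g / s)) (act (low ?u) v) = act (g ** low t) v"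
        unfolding GL2_mult_low[OF t] s_def[symmetric]
        by (rule low_diag_up[symmetric]) (use t g in \<open>auto simp: s_def GL2_iff\<close>)
      also have "\<dots> = act g (\<kappa> ([:1, t:] ^ n))" using g vc by (simp add: \<kappa>_power act_mult)
      also have "\<dots> = (\<Sum>j\<le>n. scal (t ^ j) (act g (\<kappa> (?b j))))"
        unfolding expand by (rule linear_map_on_sum_scale[OF sub(2) vs U]) simp
      finally show "(\<Sum>j\<le>n. scal (t ^ j) (\<kappa> (A g (?b j)))) = (\<Sum>j\<le>n. scal (t ^ j) (act g (\<kappa> (?b j))))" .
    qed (rule i)
    hence "scal (of_nat (n choose i)) (\<kappa> (A g (monom 1 i))) = scal (of_nat (n choose i)) (act g (\<kappa> (monom 1 i)))"
      using g by (simp only: A_scale \<kappa>_scale linear_map_on_scale[OF linear_act] \<kappa>_in)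
    moreover have "of_nat (n choose i) \<noteq> (0 :: 'k)" using binom[of i] i unfolding n_def by blast
    ultimately show ?thesis unfolding vs.scale_cancel_left by blast
  qed
  have equi: "\<kappa> (A g f) = act g (\<kappa> f)" if g: "g \<in> GL2" and f: "degree f \<le> n" for g f
  proof -
    have sub: "linear_map_on UNIV smult scal (\<lambda>f. \<kappa> (A g f))" "linear_map_on UNIV smult scal (\<lambda>f. act g (\<kappa> f))"
      using g unfolding linear_map_on_def
      by (simp_all add: A_add A_scale \<kappa>_add \<kappa>_scale linear_map_on_add[OF linear_act] linear_map_on_scale[OF linear_act] \<kappa>_in)
    have vs: "vector_space (smult :: 'k \<Rightarrow> _)" by unfold_locales (simp_all add: smult_add_right smult_add_left)
    have U: "module.subspace (smult :: 'k \<Rightarrow> _) UNIV"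
    proof - interpret vector_space "smult :: 'k \<Rightarrow> _" by (rule vs) show ?thesis by (rule subspace_UNIV) qed
    define S where "S = (\<Sum>i\<le>degree f. smult (coeff f i) (monom 1 i))"
    have fS: "S = f"
      unfolding S_def using poly_as_sum_of_monoms[of f] by (simp add: smult_monom)
    have "\<kappa> (A g S) = (\<Sum>i\<le>degree f. scal (coeff f i) (\<kappa> (A g (monom 1 i))))"
      unfolding S_def by (rule linear_map_on_sum_scale[OF sub(1) vs U]) simp
    also have "\<dots> = (\<Sum>i\<le>degree f. scal (coeff f i) (act g (\<kappa> (monom 1 i))))"
      using f by (intro sum.cong refl) (simp add: monom[OF g])
    also have "\<dots> = act g (\<kappa> S)"
      unfolding S_def by (rule linear_map_on_sum_scale[OF sub(2) vs U, symmetric]) simp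
    finally show ?thesis unfolding fS .
  qed
  have "kg_hom (dual_weyl (r - 1, 1)) M \<kappa>"
    unfolding kg_hom_def
  proof (intro conjI ballI)
    show "\<kappa> ` rep_space (dual_weyl (r - 1, 1)) \<subseteq> carr" using \<kappa>_in by auto
    show "linear_map_on (rep_space (dual_weyl (r - 1, 1))) (rep_scale (dual_weyl (r - 1, 1))) scal \<kappa>"
      unfolding linear_map_on_def by (simp add: \<kappa>_add dual_weyl_def \<kappa>_scale)
    show "\<kappa> (rep_act (dual_weyl (r - 1, 1)) g f) = act g (\<kappa> f)"
      if "g \<in> GL2" "f \<in> rep_space (dual_weyl (r - 1, 1))" for g f
      using equi[OF that(1), of f] that(2) unfolding A_def by (simp add: dual_weyl_def n_def numeral_2_eq_2)
  qed
  moreover have "\<kappa> 1 = v" using \<kappa>_power[of 0] vc by (simp flip: mat_1_mat2 one_pCons)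
  ultimately show ?thesis by blast
qed

end

section \<open>Highest weight vectors in tensor powers and Lie powers\<close>

lemma (in kg) weight_space_subspace: "vs.subspace (weight_space M \<mu>)"
proof (rule vs.subspaceI)
  have zero: "0 \<in> carr" by (rule vs.subspace_0[OF carr_subspace])
  show "0 \<in> weight_space M \<mu>"
    using zero linear_map_on_zero[OF linear_act zero] by (simp add: weight_space_def)
  show "x + y \<in> weight_space M \<mu>" if "x \<in> weight_space M \<mu>" "y \<in> weight_space M \<mu>" for x y
    using that vs.subspace_add[OF carr_subspace, of x y]
    by (simp add: weight_space_def linear_map_on_add[OF linear_act] vs.scale_right_distrib)
  show "scal c x \<in> weight_space M \<mu>" if "x \<in> weight_space M \<mu>" for c x
    using that vs.subspace_scale[OF carr_subspace, of x c]
    by (simp add: weight_space_def linear_map_on_scale[OF linear_act] mult.commute)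
qed

lemma kg_hom_weight_space:
  assumes f: "kg_hom M N f" and x: "x \<in> weight_space M \<mu>"
  shows "f x \<in> weight_space N \<mu>"
proof -
  note fD = kg_homD[OF f]
  have xc: "x \<in> rep_space M" using x by (simp add: weight_space_def)
  have "rep_act N (diag2 s t) (f x) = rep_scale N (s ^ fst \<mu> * t ^ snd \<mu>) (f x)" if "s \<noteq> 0" "t \<noteq> 0" for s t
  proof -
    have "rep_act N (diag2 s t) (f x) = f (rep_act M (diag2 s t) x)" by (rule fD(3)[symmetric]) (use that xc in simp_all)
    also have "\<dots> = f (rep_scale M (s ^ fst \<mu> * t ^ snd \<mu>) x)" using x that by (simp add: weight_space_def)
    finally show ?thesis by (simp add: linear_map_on_scale[OF fD(2) xc])
  qed
  thus ?thesis using fD(1)[OF xc] by (simp add: weight_space_def)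
qed

abbreviation one_two :: "nat \<Rightarrow> nat \<Rightarrow> 'k::field tensor" where
  "one_two i j \<equiv> word_tensor (ones i @ 2 # ones j)"

lemma word_tensor_Nil_Cons: "(\<lambda>v. word_tensor [] (c # v)) = (\<lambda>_. 0)"
  by (simp add: word_tensor_def)

lemma count_ones: "count_list (ones n) 1 = n" "count_list (ones n) 2 = 0"
  by (induction n) simp_all

lemma one_two_weight: "one_two i j \<in> weight_space (tens (Suc (i + j))) (i + j, 1)"
proof -
  let ?v = "ones i @ 2 # ones j :: 2 list"
  have c: "count_list ?v 1 = i + j" "count_list ?v 2 = 1" by (simp_all add: count_ones)
  have "word_tensor ?v \<in> tensor_power (Suc (i + j))" using word_tensor_in_tensor_power[of ?v] by simp
  moreover have "tensor_act (diag2 s t) (word_tensor ?v) = tensor_scale (s ^ (i + j) * t ^ 1) (word_tensor ?v)" for s t :: 'a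
  proof
    fix w show "tensor_act (diag2 s t) (word_tensor ?v) w = tensor_scale (s ^ (i + j) * t ^ 1) (word_tensor ?v) w"
      by (cases "w = ?v") (simp_all only: tensor_act_diag2 tensor_scale_def word_tensor_def c if_True if_False mult_zero_right)
  qed
  ultimately show ?thesis by (simp add: weight_space_def)
qed

lemma tensor_act_up_ones: "tensor_act (up t) (word_tensor (ones n)) w = word_tensor (ones n) w"
proof (induction n arbitrary: w)
  case 0
  show ?case by (cases w) (simp_all add: tensor_act_Cons_2 word_tensor_Nil_Cons, simp add: word_tensor_def)
next
  case (Suc n)
  show ?case
  proof (cases w)
    case (Cons a v)
    show ?thesis
      using exhaust_2[of a] Suc[of v]
      by (auto simp: Cons tensor_act_Cons_2 word_tensor_Cons) (auto simp: word_tensor_def)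
  qed (simp add: word_tensor_def)
qed

text \<open>
  All words with a single \<open>y\<close> are changed by the same vector, so their differences are invariant.
\<close>
lemma tensor_act_up_one_two:
  "tensor_act (up t) (one_two i j) = one_two i j + tensor_scale t (word_tensor (ones (Suc (i + j))))"
proof
  fix w
  show "tensor_act (up t) (one_two i j) w = (one_two i j + tensor_scale t (word_tensor (ones (Suc (i + j))))) w"
  proof (induction i arbitrary: w)
    case 0
    show ?case
    proof (cases w)
      case (Cons a v)
      show ?thesis
        using exhaust_2[of a]
        by (auto simp: Cons tensor_act_Cons_2 word_tensor_Cons tensor_act_up_ones) (auto simp: word_tensor_def tensor_scale_def)
    qed (simp add: word_tensor_def tensor_scale_def)
  next
    case (Suc i)
    show ?case
    proof (cases w)
      case (Cons a v)
      show ?thesis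
        using exhaust_2[of a] Suc[of v]
        by (auto simp: Cons tensor_act_Cons_2 word_tensor_Cons) (auto simp: word_tensor_def tensor_scale_def)
    qed (simp add: word_tensor_def tensor_scale_def)
  qed
qed

lemma lie_bracket_zero: "lie_bracket x 0 = (0 :: 'k::field tensor)"
  by (simp add: lie_bracket_def tensor_mult_def fun_eq_iff)

lemma dynkin_zero: "dynkin r (\<lambda>_. 0) = (0 :: 'k::field tensor)"
proof -
  have "dynkin r (tensor_scale 0 0) = tensor_scale 0 (dynkin r 0 :: 'k tensor)" by (rule dynkin_linear(2))
  thus ?thesis unfolding tensor_scale_def by (simp add: zero_fun_def)
qed

lemma dynkin_Cons:
  "dynkin (Suc (Suc r)) (word_tensor (a # u)) =
     lie_bracket (word_tensor [a]) (dynkin (Suc r) (word_tensor u :: 'k::field tensor))"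
  using exhaust_2[of a] by (elim disjE) (simp_all add: word_tensor_Cons dynkin_zero lie_bracket_zero)

lemma dynkin_ones: "dynkin (Suc (Suc r)) (word_tensor (ones (Suc (Suc r)))) = (0 :: 'k::field tensor)"
proof (induction r)
  case 0
  have "dynkin (Suc (Suc 0)) (word_tensor (ones (Suc (Suc 0)))) = lie_bracket (word_tensor [1]) (word_tensor [1 :: 2] :: 'k tensor)"
    using dynkin_Cons[of 0 1 "[1]", where 'k = 'k] by simp
  thus ?case by (simp only: lie_bracket_def diff_self)
next
  case (Suc r)
  have "dynkin (Suc (Suc (Suc r))) (word_tensor (1 # ones (Suc (Suc r)))) = lie_bracket (word_tensor [1]) (0 :: 'k tensor)"
    unfolding dynkin_Cons Suc ..
  thus ?case unfolding lie_bracket_zero by simp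
qed

lemma tensor_mult_word_singleton_Cons: "tensor_mult (word_tensor [a]) y (b # w) = (if a = b then y w else 0)"
proof -
  have one: "tensor_mult (word_tensor []) y w = y w"
    by (cases w) (simp_all add: tensor_mult_Cons word_tensor_Nil_Cons tensor_mult_left_linear, simp_all add: word_tensor_def)
  show ?thesis unfolding tensor_mult_Cons word_tensor_Cons
    by (simp add: one tensor_mult_left_linear) (simp add: word_tensor_def)
qed

lemma tensor_mult_word_singleton_snoc: "tensor_mult x (word_tensor [a]) (w @ [b]) = (if a = b then x w else 0)"
proof -
  have "x (take i (w @ [b])) * word_tensor [a] (drop i (w @ [b])) = (if i = length w then if a = b then x w else 0 else 0)"
    if "i \<le> length (w @ [b])" for i
  proof (cases "i = length w")
    case True
    thus ?thesis by (simp add: word_tensor_def)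
  next
    case False
    have "length (drop i (w @ [b])) \<noteq> length [a]" using False that by simp
    hence "drop i (w @ [b]) \<noteq> [a]" by metis
    with False show ?thesis by (simp add: word_tensor_def)
  qed
  hence "tensor_mult x (word_tensor [a]) (w @ [b]) = (\<Sum>i\<le>length (w @ [b]). if i = length w then if a = b then x w else 0 else 0)"
    unfolding tensor_mult_def by (intro sum.cong) simp_all
  thus ?thesis by simp
qed

lemma dynkin_one_two_last: "dynkin (Suc n) (one_two n 0) (ones n @ [2]) = (1 :: 'k::field)"
proof (induction n)
  case 0
  show ?case by (simp add: word_tensor_def)
next
  case (Suc n)
  define D where "D = dynkin (Suc n) (one_two n 0 :: 'k tensor)"
  have "dynkin (Suc (Suc n)) (one_two (Suc n) 0) = lie_bracket (word_tensor [1]) D"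
    unfolding D_def using dynkin_Cons[of n 1 "ones n @ [2]", where 'k = 'k] by simp
  moreover have "tensor_mult D (word_tensor [1]) ((1 # ones n) @ [2]) = 0"
    unfolding tensor_mult_word_singleton_snoc by simp
  moreover have "D (ones n @ [2]) = 1" using Suc by (simp add: D_def)
  ultimately show ?case by (simp add: lie_bracket_def tensor_mult_word_singleton_Cons)
qed

lemma dynkin_two_first_last:
  "dynkin (Suc (Suc n)) (one_two 0 (Suc n)) (ones (Suc n) @ [2]) = (if n = 0 then -1 else 0 :: 'k::field)"
proof -
  define D where "D = dynkin (Suc n) (word_tensor (ones (Suc n)) :: 'k tensor)"
  have "dynkin (Suc (Suc n)) (one_two 0 (Suc n)) = lie_bracket (word_tensor [2]) D"
    unfolding D_def using dynkin_Cons[of n 2 "ones (Suc n)", where 'k = 'k] by simp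
  moreover have "tensor_mult D (word_tensor [2]) (ones (Suc n) @ [2]) = D (ones (Suc n))"
    unfolding tensor_mult_word_singleton_snoc by simp
  moreover have "tensor_mult (word_tensor [2]) D (1 # ones n @ [2]) = 0"
    unfolding tensor_mult_word_singleton_Cons by simp
  moreover have "D (ones (Suc n)) = (if n = 0 then 1 else 0)"
  proof (cases n)
    case (Suc m)
    show ?thesis unfolding D_def Suc dynkin_ones by simp
  qed (simp add: word_tensor_def D_def)
  ultimately show ?thesis by (simp add: lie_bracket_def)
qed

lemma tensor_act_low_last: "tensor_act (low s) z (ones n @ [2]) = z (ones n @ [2]) + s * z (ones (Suc n))"
proof (induction n arbitrary: z)
  case 0
  show ?case by (simp add: tensor_act_Cons_2)
next
  case (Suc n)
  show ?case using Suc[of "\<lambda>v. z (1 # v)"] by (simp add: tensor_act_Cons_2)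
qed

lemma word_with_one_two:
  assumes "count_list w 2 = 1"
  shows "\<exists>i j. w = ones i @ 2 # ones j"
  using assms
proof (induction w)
  case (Cons a w)
  have no2: "w = ones (length w)" if "count_list w 2 = 0" for w :: "2 list"
    using that
  proof (induction w)
    case (Cons b w)
    then show ?case using exhaust_2[of b] by auto
  qed simp
  from exhaust_2[of a] show ?case
  proof
    assume a: "a = 1"
    with Cons obtain i j where "w = ones i @ 2 # ones j" by auto
    with a have "a # w = ones (Suc i) @ 2 # ones j" by simp
    thus ?case by blast
  next
    assume a: "a = 2"
    with Cons.prems have "count_list w 2 = 0" by simp
    hence "a # w = ones 0 @ 2 # ones (length w)" using no2[of w] a by simp
    thus ?case by blast
  qed
qed simp

lemma fop_1_ones: "fop 1 (word_tensor (ones n)) w = (if length w = n \<and> count_list w 2 = 1 then 1 else 0)"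
proof (induction w arbitrary: n)
  case (Cons a w)
  have ones_iff: "w = ones m \<longleftrightarrow> length w = m \<and> count_list w 2 = 0" for m and w :: "2 list"
  proof (induction w arbitrary: m)
    case (Cons b w)
    then show ?case using exhaust_2[of b] by (cases m) auto
  qed (cases m; simp)
  show ?case
  proof (cases n)
    case 0
    then show ?thesis by (simp add: word_tensor_Nil_Cons subst_op_linear)
  next
    case (Suc m)
    from exhaust_2[of a] show ?thesis
    proof
      assume "a = 1"
      then show ?thesis using Cons[of m] Suc by (simp add: word_tensor_Cons)
    next
      assume "a = 2"
      then show ?thesis using Suc ones_iff[of w m] by (simp add: word_tensor_Cons subst_op_linear) (simp add: word_tensor_def)
    qed
  qed
qed simp

lemma indecomposable_tiltingD:
  assumes T: "is_indecomposable_tilting (r - 1, 1) T" and r: "r \<ge> 2"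
  shows "polynomial_module r T" "indecomposable T"
    "has_filtration T (weyl ` two_part_partitions r)" "has_filtration T (dual_weyl ` two_part_partitions r)"
    "is_weight T (r - 1, 1)" "\<not> is_weight T (r, 0)"
proof -
  have s: "fst (r - 1, 1) + snd (r - 1, 1) = r" using r by simp
  have T': "polynomial_module r T \<and> indecomposable T \<and> has_filtration T (weyl ` two_part_partitions r) \<and>
      has_filtration T (dual_weyl ` two_part_partitions r) \<and> is_weight T (r - 1, 1) \<and>
      (\<forall>\<mu>. is_weight T \<mu> \<longrightarrow> dominated \<mu> (r - 1, 1))"
    using T unfolding is_indecomposable_tilting_def Let_def s highest_weight_def .
  thus "polynomial_module r T" "indecomposable T"
    "has_filtration T (weyl ` two_part_partitions r)" "has_filtration T (dual_weyl ` two_part_partitions r)"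
    "is_weight T (r - 1, 1)"
    by simp_all
  have "\<forall>\<mu>. is_weight T \<mu> \<longrightarrow> dominated \<mu> (r - 1, 1)" using T' by (elim conjE)
  moreover have "\<not> dominated (r, 0) (r - 1, 1)" using r by (simp add: dominated_def)
  ultimately show "\<not> is_weight T (r, 0)" by blast
qed

lemma (in kg) weight_vector:
  assumes "is_weight M \<mu>"
  obtains v where "v \<in> weight_space M \<mu>" "v \<noteq> 0" "v \<in> carr"
proof -
  have "0 \<in> weight_space M \<mu>" by (rule vs.subspace_0[OF weight_space_subspace])
  with assms obtain v where v: "v \<in> weight_space M \<mu>" "v \<noteq> 0" unfolding is_weight_def by blast
  moreover from v(1) have "v \<in> carr" by (simp add: weight_space_def)
  ultimately show thesis by (rule that)
qed

lemma one_two_diff_highest: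
  fixes r :: nat
  assumes "Suc (i + j) = r" "Suc (i' + j') = r"
  shows "one_two i j - one_two i' j' \<in> weight_space (tens r :: ('k::field, 'k tensor) rep) (r - 1, 1)"
    "tensor_act (up t) (one_two i j - one_two i' j') = (one_two i j - one_two i' j' :: 'k tensor)"
proof -
  interpret N: kg "tens r :: ('k, 'k tensor) rep" by unfold_locales (rule kg_module_tens)
  have w: "one_two i j \<in> weight_space (tens r :: ('k, 'k tensor) rep) (r - 1, 1)"
    "one_two i' j' \<in> weight_space (tens r :: ('k, 'k tensor) rep) (r - 1, 1)"
    using one_two_weight[of i j, where 'a = 'k] one_two_weight[of i' j', where 'a = 'k] assms by auto
  show "one_two i j - one_two i' j' \<in> weight_space (tens r :: ('k, 'k tensor) rep) (r - 1, 1)"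
    by (rule N.vs.subspace_diff[OF N.weight_space_subspace w])
  show "tensor_act (up t) (one_two i j - one_two i' j') = (one_two i j - one_two i' j' :: 'k tensor)"
    unfolding tensor_act_linear tensor_act_up_one_two using assms by simp
qed

lemma word_pairing_word_diff:
  assumes "length u = r" "length u' = r"
  shows "word_pairing r (word_tensor u - word_tensor u') y = y u - y u'"
proof -
  have fin: "finite {w :: 2 list. length w = r}" using finite_lists_length_eq[of "UNIV :: 2 set" r] by simp
  have "word_pairing r (word_tensor u - word_tensor u') y =
    (\<Sum>w | length w = r. (if w = u then y w else 0) - (if w = u' then y w else 0))"
    unfolding word_pairing_def by (intro sum.cong) (simp_all add: word_tensor_def left_diff_distrib)
  also have "\<dots> = y u - y u'" using fin assms by (simp add: sum_subtractf)
  finally show ?thesis .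
qed

lemma kg_hom_restrict_lie_power:
  assumes "kg_hom (tens r) M b"
  shows "kg_hom (lie_power r) M b"
  using assms unfolding kg_hom_def lie_power_def linear_map_on_def by auto

lemma kg_module_lie_power: "kg_module (lie_power r)"
  using poly_rep_lie_power unfolding poly_rep_def by blast

section \<open>Degrees that are not powers of the characteristic\<close>

lemma tilting_summand_not_prime_power:
  fixes T :: "('k::field, 'v::ab_group_add) rep"
  assumes inf: "infinite (UNIV :: 'k set)" and p: "prime p" and char: "CHAR('k) = p" and r: "r \<ge> 2"
    and T: "is_indecomposable_tilting (r - 1, 1) T" and np: "\<not> (\<exists>k. r = p ^ k)"
  shows "iso_direct_summand T (lie_power r)"
proof -
  note TD = indecomposable_tiltingD[OF T r]
  obtain B where "polynomial_rep T r B" using polynomial_module_imp_polynomial_rep[OF inf TD(1)] by blast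
  then interpret T: polynomial_rep T r B .
  obtain n where n: "r = Suc (Suc n)" using r by (metis add_2_eq_Suc le_Suc_ex)
  obtain j where j: "j \<le> r - 1" "(- 1) ^ j * of_nat ((r - 1) choose j) \<noteq> (1 :: 'k)"
    using prime_power_if_alternating_choose[OF p char, of r] np r by auto
  \<comment> \<open>\<open>w\<close> is the image of the highest weight vector of \<open>T\<close>; the Dynkin operator does not kill it. \<open>w'\<close> is
     the image of that of the dual; it picks two different coordinates of \<open>dynkin r w\<close>.\<close>
  define w where "w = (one_two (r - 1) 0 - one_two 0 (r - 1) :: 'k tensor)"
  define w' where "w' = (one_two (r - 1) 0 - one_two (r - 1 - j) j :: 'k tensor)"
  have w: "w \<in> weight_space (tens r) (r - 1, 1)" "\<And>t. tensor_act (up t) w = w"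
    unfolding w_def by (rule one_two_diff_highest; use r in simp)+
  have w': "w' \<in> weight_space (tens r) (r - 1, 1)" "\<And>t. tensor_act (up t) w' = w'"
    unfolding w'_def by (rule one_two_diff_highest; use r j in simp)+
  define z where "z = dynkin r w"
  have z: "z \<in> weight_space (lie_power r) (r - 1, 1)" unfolding z_def by (rule kg_hom_weight_space[OF kg_hom_dynkin w(1)])
  have "z \<in> free_lie" using z by (simp add: weight_space_def lie_power_def)
  from free_lie_coordinates[OF this] obtain d where d: "\<forall>i j. z (ones i @ 2 # ones j) = (-1) ^ j * of_nat ((i + j) choose j) * d (i + j)"
    by (elim exE conjE) (rule that)
  have "z (ones (r - 1) @ [2]) \<noteq> 0"
  proof -
    have "z = dynkin r (one_two (r - 1) 0) - dynkin r (one_two 0 (r - 1))"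
    proof -
      have "dynkin r (w + one_two 0 (r - 1)) = z + dynkin r (one_two 0 (r - 1))" unfolding z_def by (rule dynkin_linear(1))
      moreover have "w + one_two 0 (r - 1) = one_two (r - 1) 0" by (simp only: w_def diff_add_cancel)
      ultimately show ?thesis by (simp only: add_diff_cancel_right')
    qed
    hence "z (ones (r - 1) @ [2]) = 1 - (if n = 0 then - 1 else 0)"
      using dynkin_one_two_last[of "Suc n", where 'k = 'k] dynkin_two_first_last[of n, where 'k = 'k] by (simp add: n)
    \<comment> \<open>In degree \<open>2\<close> both words contribute; then \<open>p\<close> is odd because \<open>2\<close> is not a power of \<open>p\<close>.\<close>
    moreover have "(2 :: 'k) \<noteq> 0" if "n = 0"
    proof
      assume "(2 :: 'k) = 0"
      hence "of_nat 2 = (0 :: 'k)" by simp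
      hence "p dvd 2" unfolding of_nat_eq_0_iff_char_dvd char .
      hence "p = r" using p prime_ge_2_nat[OF p] dvd_imp_le[of p 2] n that by simp
      with np show False by (metis power_one_right)
    qed
    ultimately show ?thesis by auto
  qed
  moreover have dr: "z (ones (r - 1) @ [2]) = d (r - 1)" using d[rule_format, of "r - 1" 0] by simp
  ultimately have d0: "d (r - 1) \<noteq> 0" by simp
  have pair: "word_pairing r w' z \<noteq> 0"
  proof -
    have "word_pairing r w' z = z (ones (r - 1) @ 2 # ones 0) - z (ones (r - 1 - j) @ 2 # ones j)"
      unfolding w'_def by (rule word_pairing_word_diff) (use r j in simp_all)
    also have "\<dots> = (1 - (- 1) ^ j * of_nat ((r - 1) choose j)) * d (r - 1)"
    proof -
      have "r - 1 - j + j = r - 1" using j(1) by simp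
      thus ?thesis unfolding d[rule_format] by (simp add: left_diff_distrib)
    qed
    finally show ?thesis using d0 j(2) by simp
  qed
  obtain v0 where v0: "v0 \<in> weight_space T (r - 1, 1)" "v0 \<noteq> 0" by (rule T.weight_vector[OF TD(5)])
  obtain \<phi> where \<phi>: "\<phi> \<in> weight_space T.D (r - 1, 1)" "\<phi> v0 = 1" using T.dual_weight_vector[OF v0 r] by (elim bexE) (rule that)
  have \<phi>D: "\<phi> \<in> rep_space T.D" using \<phi>(1) by (simp add: weight_space_def)
  have "\<phi> \<noteq> 0" using \<phi>(2) by auto
  obtain a' where a': "kg_hom T.D (tens r) a'" "a' \<phi> = w'"
    using highest_weight_hom_to_tensor_power[OF inf T.poly_rep_dual r T.dual_filtration[OF TD(4)] \<phi>(1) \<open>\<phi> \<noteq> 0\<close> T.dual_weight[OF TD(6)] w']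
    by (elim exE conjE) (rule that)
  obtain b where b: "kg_hom (tens r) T b" "\<forall>\<phi>\<in>rep_space T.D. \<forall>y. \<phi> (b y) = word_pairing r (a' \<phi>) y"
    using T.transposed_hom[OF a'(1)] by (elim exE conjE) (rule that)
  define v where "v = b z"
  have bL: "kg_hom (lie_power r) T b" by (rule kg_hom_restrict_lie_power[OF b(1)])
  have v: "v \<in> weight_space T (r - 1, 1)" unfolding v_def by (rule kg_hom_weight_space[OF bL z])
  have "\<phi> v = word_pairing r (a' \<phi>) z" unfolding v_def by (rule b(2)[rule_format, OF \<phi>D])
  hence "\<phi> v \<noteq> 0" using pair unfolding a'(2) by simp
  moreover have "\<phi> 0 = 0" using \<phi>D linear_map_on_zero[OF _ T.vs.subspace_0[OF T.carr_subspace]] unfolding T.dual_space by blast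
  ultimately have v_nz: "v \<noteq> 0" by auto
  obtain a where a: "kg_hom T (tens r) a" "a v = w"
    using highest_weight_hom_to_tensor_power[OF inf T.poly_rep r TD(3) v v_nz TD(6) w] by (elim exE conjE) (rule that)
  have "b (dynkin r (a v)) = b (dynkin r w)" by (simp only: a(2))
  also have "\<dots> = v" by (simp only: v_def z_def)
  finally have "b (dynkin r (a v)) = v" .
  moreover have "v \<in> T.carr" using v by (simp add: weight_space_def)
  ultimately show ?thesis
    using T.iso_direct_summand_of_retract[OF kg_module_lie_power TD(2) kg_hom_compose[OF a(1) kg_hom_dynkin] bL _ v_nz] by blast
qed

section \<open>Degree equal to the characteristic\<close>

lemma tilting_summand_prime:
  fixes T :: "('k::field, 'v::ab_group_add) rep"
  assumes inf: "infinite (UNIV :: 'k set)" and p: "prime p" and char: "CHAR('k) = p" and r: "r \<ge> 2"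
    and T: "is_indecomposable_tilting (r - 1, 1) T" and rp: "r = p"
  shows "iso_direct_summand T (lie_power r)"
proof -
  note TD = indecomposable_tiltingD[OF T r]
  obtain B where "polynomial_rep T r B" using polynomial_module_imp_polynomial_rep[OF inf TD(1)] by blast
  then interpret T: polynomial_rep T r B .
  interpret D: prep T.D r by (rule prepI[OF T.poly_rep_dual inf])
  interpret L: prep "lie_power r :: ('k, 'k tensor) rep" r by (rule prepI[OF poly_rep_lie_power inf])
  obtain n where n: "r = Suc (Suc n)" using r by (metis add_2_eq_Suc le_Suc_ex)
  have binom: "of_nat ((r - 2) choose i) \<noteq> (0 :: 'k)" if "i \<le> r - 2" for i
    by (rule choose_nonzero_below_char[OF p char _ that]) (use rp n in simp)
  obtain v where v: "v \<in> weight_space T (r - 1, 1)" "v \<noteq> 0" "v \<in> T.carr" by (rule T.weight_vector[OF TD(5)])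
  have v_up: "T.act (up t) v = v" for t by (rule T.highest_weight_vector_invariant[OF r v(1) TD(6)])
  obtain \<phi> where \<phi>: "\<phi> \<in> weight_space T.D (r - 1, 1)" "\<phi> v = 1" using T.dual_weight_vector[OF v(1,2) r] by (elim bexE) (rule that)
  have lin: "linear_map_on T.carr T.scal (*) \<phi>" using \<phi>(1) unfolding weight_space_def T.dual_space by simp
  have \<phi>_up: "rep_act T.D (up t) \<phi> = \<phi>" for t
    by (rule D.highest_weight_vector_invariant[OF r \<phi>(1) T.dual_weight[OF TD(6)]])
  have \<phi>_low: "\<phi> (T.act (low s) m) = \<phi> m" if "m \<in> T.carr" for s m
    using fun_cong[OF \<phi>_up[of s], of m] that by (simp add: T.dual_act transpose_mat2)
  have \<phi>_diag: "\<phi> (T.act (diag2 s t) m) = s ^ (r - 1) * t * \<phi> m" if "s \<noteq> 0" "t \<noteq> 0" "m \<in> T.carr" for s t m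
  proof -
    have "rep_act T.D (diag2 s t) \<phi> m = rep_scale T.D (s ^ (r - 1) * t) \<phi> m"
      using \<phi>(1) that unfolding weight_space_def by simp
    thus ?thesis using that by (simp add: T.dual_act T.dual_scale diag2_mat2 transpose_mat2)
  qed
  have "\<exists>\<tau>T. kg_hom T (dual_weyl (r - 1, 1)) \<tau>T \<and> \<tau>T v = [:\<phi> v:]"
    by (rule T.hom_to_dual_weyl[OF r lin \<phi>_low \<phi>_diag v(3) v_up])
  then obtain \<tau>T where \<tau>T: "kg_hom T (dual_weyl (r - 1, 1)) \<tau>T" "\<tau>T v = [:\<phi> v:]" by (elim exE conjE) (rule that)
  have "\<exists>\<kappa>T. kg_hom (dual_weyl (r - 1, 1)) T \<kappa>T \<and> \<kappa>T 1 = v"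
    by (rule T.hom_from_dual_weyl[OF r v(1) v_up binom])
  then obtain \<kappa>T where \<kappa>T: "kg_hom (dual_weyl (r - 1, 1)) T \<kappa>T" "\<kappa>T 1 = v" by (elim exE conjE) (rule that)
  \<comment> \<open>\<open>u\<close> is \<open>ad(x)\<^sup>r\<^sup>-\<^sup>1(y)\<close>; the word itself is not invariant, but the Dynkin operator kills the error \<open>x\<^sup>r\<close>.\<close>
  define u where "u = dynkin r (one_two (r - 1) 0 :: 'k tensor)"
  have "one_two (r - 1) 0 \<in> weight_space (tens r :: ('k, 'k tensor) rep) (r - 1, 1)"
    using one_two_weight[of "r - 1" 0, where 'a = 'k] r by simp
  hence u: "u \<in> weight_space (lie_power r) (r - 1, 1)" unfolding u_def by (rule kg_hom_weight_space[OF kg_hom_dynkin])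
  have uc: "u \<in> L.carr" using u by (simp add: weight_space_def)
  have u_up: "L.act (up t) u = u" for t
  proof -
    have "tensor_act (up t) u = dynkin r (one_two (r - 1) 0 + tensor_scale t (word_tensor (ones r)))"
      unfolding u_def dynkin_act[symmetric] tensor_act_up_one_two using r by simp
    also have "\<dots> = u + tensor_scale t (dynkin r (word_tensor (ones r)))"
      unfolding u_def dynkin_linear ..
    also have "dynkin r (word_tensor (ones r)) = (0 :: 'k tensor)" unfolding n by (rule dynkin_ones)
    also have "u + tensor_scale t 0 = u" by (simp add: tensor_scale_def fun_eq_iff)
    finally show ?thesis by (simp add: lie_power_def)
  qed
  define \<psi> where "\<psi> z = z (ones (r - 1) @ [2])" for z :: "'k tensor"
  have \<psi>u: "\<psi> u = 1" unfolding \<psi>_def u_def n using dynkin_one_two_last[of "Suc n", where 'k = 'k] by simp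
  have lin\<psi>: "linear_map_on L.carr L.scal (*) \<psi>"
    unfolding linear_map_on_def by (simp add: lie_power_def \<psi>_def tensor_scale_def)
  have \<psi>_low: "\<psi> (L.act (low s) m) = \<psi> m" if "m \<in> L.carr" for s m
  proof -
    have "m \<in> free_lie" using that by (simp add: lie_power_def)
    from free_lie_coordinates[OF this] obtain c where c: "\<forall>n. m (ones n) = (if n = 1 then c else 0)" by (elim exE conjE) (rule that)
    have "m (ones (Suc (r - 1))) = 0" using c[rule_format, of "Suc (r - 1)"] n by simp
    thus ?thesis unfolding \<psi>_def using tensor_act_low_last[of s m "r - 1"] by (simp add: lie_power_def)
  qed
  have \<psi>_diag: "\<psi> (L.act (diag2 s t) m) = s ^ (r - 1) * t * \<psi> m" if "s \<noteq> 0" "t \<noteq> 0" "m \<in> L.carr" for s t m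
    by (simp add: \<psi>_def lie_power_def tensor_act_diag2 count_ones)
  have "\<exists>\<tau>L. kg_hom (lie_power r) (dual_weyl (r - 1, 1)) \<tau>L \<and> \<tau>L u = [:\<psi> u:]"
    by (rule L.hom_to_dual_weyl[OF r lin\<psi> \<psi>_low \<psi>_diag uc u_up])
  then obtain \<tau>L where \<tau>L: "kg_hom (lie_power r) (dual_weyl (r - 1, 1)) \<tau>L" "\<tau>L u = [:\<psi> u:]" by (elim exE conjE) (rule that)
  have "\<exists>\<kappa>L. kg_hom (dual_weyl (r - 1, 1)) (lie_power r) \<kappa>L \<and> \<kappa>L 1 = u"
    by (rule L.hom_from_dual_weyl[OF r u u_up binom])
  then obtain \<kappa>L where \<kappa>L: "kg_hom (dual_weyl (r - 1, 1)) (lie_power r) \<kappa>L" "\<kappa>L 1 = u" by (elim exE conjE) (rule that)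
  have "\<kappa>T (\<tau>L (\<kappa>L (\<tau>T v))) = v"
    using \<tau>T(2) \<tau>L(2) \<kappa>L(2) \<kappa>T(2) \<phi>(2) \<psi>u by (simp flip: one_pCons)
  thus ?thesis
    using T.iso_direct_summand_of_retract[OF kg_module_lie_power TD(2)
        kg_hom_compose[OF \<tau>T(1) \<kappa>L(1)] kg_hom_compose[OF \<tau>L(1) \<kappa>T(1)] v(3,2)] by blast
qed

section \<open>Higher powers of the characteristic\<close>

lemma tilting_not_summand_higher_prime_power:
  fixes T :: "('k::field, 'v::ab_group_add) rep"
  assumes inf: "infinite (UNIV :: 'k set)" and p: "prime p" and char: "CHAR('k) = p" and r: "r \<ge> 2"
    and T: "is_indecomposable_tilting (r - 1, 1) T" and rk: "r = p ^ k" "r \<noteq> p"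
  shows "\<not> iso_direct_summand T (lie_power r)"
proof
  assume "iso_direct_summand T (lie_power r)"
  then obtain A C f where dec: "direct_sum_decomp (lie_power r) A C"
    and f: "kg_hom T (lie_power r\<lparr>rep_space := A\<rparr>) f" "bij_betw f (rep_space T) A"
    unfolding iso_direct_summand_def kg_iso_def by auto
  have A: "A \<subseteq> free_lie \<inter> tensor_power r"
    using dec unfolding direct_sum_decomp_def submodule_def by (auto simp: lie_power_def)
  note TD = indecomposable_tiltingD[OF T r]
  obtain B where "polynomial_rep T r B" using polynomial_module_imp_polynomial_rep[OF inf TD(1)] by blast
  then interpret T: polynomial_rep T r B .
  have f': "kg_hom T (tens r) f"
    using f(1) A unfolding kg_hom_def by (auto simp: lie_power_def)
  note fD = kg_homD[OF f', simplified]
  obtain v where v: "v \<in> weight_space T (r - 1, 1)" "v \<noteq> 0" "v \<in> T.carr" by (rule T.weight_vector[OF TD(5)])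
  have p2: "p \<ge> 2" using p by (rule prime_ge_2_nat)
  have "k \<noteq> 0" "k \<noteq> 1" using rk r by (auto intro: ccontr)
  hence k2: "k = Suc (Suc (k - 2))" by simp
  have "p * p \<le> p * (p * p ^ (k - 2))" using p2 by simp
  also have "\<dots> = r" unfolding rk(1) by (subst (2) k2) simp
  finally have "p * p \<le> r" .
  moreover have "2 * p \<le> p * p" using p2 by simp
  ultimately have "2 * p \<le> r" by (rule order_trans[rotated])
  hence pr: "p - 1 \<le> r - 2" "p - 1 \<le> r" using p2 by linarith+
  obtain m W where filt: "W 0 = {0} \<and> W m = T.carr \<and> (\<forall>i\<le>m. submodule (W i) T) \<and>
      (\<forall>i<m. W i \<subseteq> W (Suc i) \<and> (\<exists>N\<in>weyl ` two_part_partitions r. section_iso T (W i) (W (Suc i)) N))"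
    using TD(3) unfolding has_filtration_def by (elim exE) (rule that)
  hence W: "W 0 = {0}" "W m = T.carr" "\<And>i. i \<le> m \<Longrightarrow> submodule (W i) T"
      "\<And>i. i < m \<Longrightarrow> \<exists>N\<in>weyl ` two_part_partitions r. section_iso T (W i) (W (Suc i)) N"
    by simp_all
  have "\<exists>k<m. v \<in> W (Suc k) \<and> (\<exists>q. kg_hom (T\<lparr>rep_space := W (Suc k)\<rparr>) (weyl (r - 1, 1)) q \<and>
      {x \<in> W (Suc k). q x = 0} = W k \<and> q v = weyl_generator (r - 2))"
    by (rule highest_weight_section[OF inf T.poly_rep r W v(1,2) TD(6)])
  then obtain l q where l: "l < m" "v \<in> W (Suc l)" and q: "kg_hom (T\<lparr>rep_space := W (Suc l)\<rparr>) (weyl (r - 1, 1)) q"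
    "q v = weyl_generator (r - 2)"
    by (elim exE conjE) (rule that)
  have Ws: "submodule (W (Suc l)) T" using W(3) l(1) by simp
  hence Wl: "T.vs.subspace (W (Suc l))" "W (Suc l) \<subseteq> T.carr" by (simp_all add: submodule_def)
  obtain z where z: "\<And>i. z i \<in> W (Suc l)" "\<And>t. T.act (low t) v = (\<Sum>i\<le>r. T.scal (t ^ i) (z i))"
    by (rule T.low_curve[OF v(3) Wl(1)]) (use Ws l(2) in \<open>auto simp: submodule_def image_subset_iff\<close>)
  have zc: "z i \<in> T.carr" for i using z(1) Wl(2) by auto
  note qD = kg_homD[OF q(1), simplified]
  \<comment> \<open>In the Weyl module, the coefficient of \<open>t\<^sup>i\<close> in evaluation at \<open>t\<close> is the coefficient functional at \<open>X\<^sup>i\<close>.\<close>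
  have "q (z (p - 1)) (monom 1 (p - 1)) = (if p - 1 = p - 1 then 1 else 0)"
  proof (rule vector_space_over_itself.poly_curve_unique[OF inf _ pr(2), where y = "\<lambda>i. q (z i) (monom 1 (p - 1))"
        and z = "\<lambda>i. if i = p - 1 then 1 else 0"])
    fix t :: 'k
    have lin: "linear_map_on (W (Suc l)) T.scal (*) (\<lambda>x. q x (monom 1 (p - 1)))"
      using linear_functional_coordinate[OF q(1), of "monom 1 (p - 1)"] by simp
    have deg: "degree (monom (1::'k) (p - 1)) \<le> fst (r - 1, 1) - snd (r - 1, 1::nat)"
      using pr(1) by (simp add: degree_monom_eq numeral_2_eq_2)
    have gen: "q v = weyl_generator (fst (r - 1, 1) - snd (r - 1, 1::nat))" using q(2) by (simp add: numeral_2_eq_2)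
    have "(\<Sum>i\<le>r. t ^ i * q (z i) (monom 1 (p - 1))) = q (T.act (low t) v) (monom 1 (p - 1))"
      unfolding z(2) by (rule linear_map_on_sum_scale[OF lin T.vs.vector_space_axioms Wl(1) z(1), symmetric])
    also have "\<dots> = rep_act (weyl (r - 1, 1)) (low t) (q v) (monom 1 (p - 1))"
      using qD(3)[OF GL2_simps(1) l(2)] by simp
    also have "\<dots> = poly (monom 1 (p - 1)) t"
      by (subst gen) (rule weyl_act_low[OF deg])
    also have "\<dots> = t ^ (p - 1)" by (simp add: poly_monom)
    also have "\<dots> = (\<Sum>i\<le>r. if i = p - 1 then t ^ i else 0)" using pr(2) by simp
    also have "\<dots> = (\<Sum>i\<le>r. t ^ i * (if i = p - 1 then 1 else 0))" by (intro sum.cong) auto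
    finally show "(\<Sum>i\<le>r. t ^ i * q (z i) (monom 1 (p - 1))) = (\<Sum>i\<le>r. t ^ i * (if i = p - 1 then 1 else 0))" .
  qed
  hence q1: "q (z (p - 1)) (monom 1 (p - 1)) = 1" by simp
  have z_nz: "z (p - 1) \<noteq> 0"
  proof
    assume "z (p - 1) = 0"
    moreover have "q 0 = 0" by (rule linear_map_on_zero[OF qD(2) T.vs.subspace_0[OF Wl(1)]])
    ultimately show False using q1 by simp
  qed
  define y where "y = f v"
  have yt: "y \<in> tensor_power r" unfolding y_def by (rule fD(1)[OF v(3)])
  have "y \<in> A" unfolding y_def using f(2) v(3) by (auto simp: bij_betw_def)
  hence "y \<in> free_lie" using A by auto
  from free_lie_coordinates[OF this] obtain d where d: "\<forall>i j. y (ones i @ 2 # ones j) = (-1) ^ j * of_nat ((i + j) choose j) * d (i + j)"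
    by (elim exE conjE) (rule that)
  have yw: "y \<in> weight_space (tens r) (r - 1, 1)" unfolding y_def by (rule kg_hom_weight_space[OF f' v(1)])
  \<comment> \<open>All coordinates of \<open>y\<close> at words with a single \<open>2\<close> agree because \<open>r\<close> is a power of \<open>p\<close>.\<close>
  have y: "y w = d (r - 1) * fop 1 (word_tensor (ones r)) w" for w
  proof (cases "length w = r \<and> count_list w 2 = 1")
    case True
    then obtain i j where ij: "w = ones i @ 2 # ones j" using word_with_one_two by blast
    have r': "i + j = r - 1" using True ij by simp
    have "y w = (-1) ^ j * of_nat ((r - 1) choose j) * d (r - 1)"
      using d[rule_format, of i j] unfolding r' ij .
    also have "(-1) ^ j * of_nat ((r - 1) choose j) = (1 :: 'k)"
      unfolding rk(1) by (rule alternating_choose_prime_power[OF p char]) (use r' rk(1) in simp)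
    finally show ?thesis using True by (simp add: fop_1_ones)
  next
    case False
    have "y w = 0"
    proof (rule ccontr)
      assume yw_nz: "y w \<noteq> 0"
      have "tensor_act (diag2 s 1) y = tensor_scale (s ^ (r - 1)) y" if "s \<noteq> 0" for s
        using yw that by (simp add: weight_space_def)
      hence "count_list w 1 = r - 1"
        by (rule tens_weight_count[where x = y and w = w and a = "r - 1", OF inf _ yw_nz])
      moreover have "length w = r" using yt yw_nz by (auto simp: tensor_power_def)
      ultimately show False using False count_list_2[of w] r by simp
    qed
    moreover have "fop 1 (word_tensor (ones r)) w = (0 :: 'k)" unfolding fop_1_ones using False by (simp only: if_False)
    ultimately show ?thesis by simp
  qed
  have "f (z (p - 1)) = 0"
  proof
    fix w
    show "f (z (p - 1)) w = 0 w"
    proof (cases "length w = r")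
      case True
      have "f (z (p - 1)) w = fop (int (p - 1)) y w"
      proof (rule vector_space_over_itself.poly_curve_unique[OF inf _ pr(2), where y = "\<lambda>i. f (z i) w"
            and z = "\<lambda>i. fop (int i) y w"])
        fix t :: 'k
        have "f (T.act (low t) v) = (\<Sum>i\<le>r. tensor_scale (t ^ i) (f (z i)))"
          unfolding z(2) by (rule linear_map_on_sum_scale[OF fD(2) T.vs.vector_space_axioms T.carr_subspace zc])
        moreover have "f (T.act (low t) v) = tensor_act (low t) y" unfolding y_def by (rule fD(3)) (use v(3) in simp_all)
        ultimately have "tensor_act (low t) y w = (\<Sum>i\<le>r. t ^ i * f (z i) w)"
          by (simp add: sum_tensor_apply tensor_scale_def)
        thus "(\<Sum>i\<le>r. t ^ i * f (z i) w) = (\<Sum>i\<le>r. t ^ i * fop (int i) y w)"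
          using True by (simp add: tensor_act_low)
      qed
      also have "\<dots> = fop (int (p - 1)) (\<lambda>w. d (r - 1) * fop (int 1) (word_tensor (ones r)) w) w"
        by (rule subst_op_cong) (simp add: y)
      also have "\<dots> = d (r - 1) * (of_nat ((p - 1 + 1) choose (p - 1)) * fop (int (p - 1 + 1)) (word_tensor (ones r)) w)"
        unfolding subst_op_linear by (subst subst_op_compose) simp_all
      also have "of_nat ((p - 1 + 1) choose (p - 1)) = (of_nat p :: 'k)" using p2 by (cases p) simp_all
      also have "of_nat p = (0 :: 'k)" using char by (simp add: of_nat_eq_0_iff_char_dvd)
      finally show ?thesis by simp
    next
      case False
      thus ?thesis using fD(1)[OF zc] by (simp add: tensor_power_def)
    qed
  qed
  moreover have "f 0 = 0" by (rule linear_map_on_zero[OF fD(2) T.vs.subspace_0[OF T.carr_subspace]])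
  ultimately have "f (z (p - 1)) = f 0" by simp
  hence "z (p - 1) = 0"
    using f(2) zc T.vs.subspace_0[OF T.carr_subspace] unfolding bij_betw_def inj_on_def by blast
  with z_nz show False ..
qed

section \<open>The tilting module as a summand of the Lie power\<close>

theorem theoremB:
  fixes p r :: nat and T :: "('k::field, 'v::ab_group_add) rep"
  assumes "infinite (UNIV :: 'k set)"
    and "prime p" and "CHAR('k) = p"
    and "r \<ge> 2"
    and "is_indecomposable_tilting (r - 1, 1) T"
  shows "iso_direct_summand T (lie_power r :: ('k, 'k tensor) rep) \<longleftrightarrow>
    r = p \<or> \<not> (\<exists>k. r = p ^ k)"
  using tilting_summand_not_prime_power[OF assms] tilting_summand_prime[OF assms]
    tilting_not_summand_higher_prime_power[OF assms] by blast

end
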